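(* Let $(M,\omega)$ be a compact connected Hermitian manifold of complex dimension $n$, and let $\Theta^{(2)}=\mathrm{Tr}_\omega\Theta$ be its second Ricci-Chern curvature. (1) If $\Theta^{(2)}$ is nonnegative everywhere and positive at some point, then $H^{p,0}_{\bar\partial}(M)=0$ for every $1\le p\le n$. In particular, the arithmetic genus satisfies $\chi(M,\mathcal O)=1$. (2) If $\Theta^{(2)}$ is nonpositive everywhere and negative at some point, then the holomorphic vector bundle $\Lambda^pT^{1,0}M$ has no nonzero holomorphic section for every $1\le p\le n$.
   Context: Let $h=(h_{i\bar j})$ be the Hermitian metric in local holomorphic coordinates, $(h^{i\bar j})$ its inverse. The Chern curvature of $(T^{1,0}M,h)$ has components $\Theta_{i\bar jk\bar\ell}=-\frac{\partial^2h_{k\bar\ell}}{\partial z^i\partial\bar z^j}+h^{p\bar q}\frac{\partial h_{p\bar\ell}}{\partial\bar z^j}\frac{\partial h_{k\bar q}}{\partial z^i}$, and the second Ricci-Chern curvature has components $\Theta^{(2)}_{i\bar j}=h^{k\bar\ell}\Theta_{k\bar\ell i\bar j}$. It is called positive (nonnegative, negative, nonpositive) at a point if the Hermitian matrix $(\Theta^{(2)}_{i\bar j})$ is. $H^{p,0}_{\bar\partial}(M)$ is the space of holomorphic $p$-forms, $h^{p,0}(M)$ its dimension, and in this paper $\chi(M,\mathcal O):=\sum_{p=0}^n(-1)^ph^{p,0}(M)$. *)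

theory Defs
  imports "HOL-Analysis.Analysis" "HOL-Library.Function_Algebras"
begin

section \<open>Calculus on open subsets of complex n-space\<close>

text \<open>
  Here \<open>n\<close> is the cardinality of the finite index type \<open>'n\<close>.
  Differentiability classes are taken in the real sense; the set \<open>S\<close> is meant to be open.
\<close>

fun C_k_on :: "nat \<Rightarrow> 'a::real_normed_vector set \<Rightarrow> ('a \<Rightarrow> 'b::real_normed_vector) \<Rightarrow> bool" where
  "C_k_on 0 S f \<longleftrightarrow> continuous_on S f"
| "C_k_on (Suc k) S f \<longleftrightarrow>
     (\<forall>x\<in>S. f differentiable (at x)) \<and>
     (\<forall>v. C_k_on k S (\<lambda>x. frechet_derivative f (at x) v))"

definition smooth_on :: "'a::real_normed_vector set \<Rightarrow> ('a \<Rightarrow> 'b::real_normed_vector) \<Rightarrow> bool" where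
  "smooth_on S f \<longleftrightarrow> (\<forall>k. C_k_on k S f)"

text \<open>Holomorphy in several variables: the real derivative exists and is complex linear.\<close>

definition hol_on :: "(complex ^ 'n) set \<Rightarrow> (complex ^ 'n \<Rightarrow> complex) \<Rightarrow> bool" where
  "hol_on S f \<longleftrightarrow>
     (\<forall>z\<in>S. \<exists>f'. (f has_derivative f') (at z) \<and> (\<forall>c v. f' (c *s v) = c * f' v))"

text \<open>
  The Wirtinger derivatives along \<open>z\<^sup>i\<close> and its conjugate, that is
  \<open>(\<partial>/\<partial>x\<^sup>i - \<i> \<partial>/\<partial>y\<^sup>i)/2\<close> and \<open>(\<partial>/\<partial>x\<^sup>i + \<i> \<partial>/\<partial>y\<^sup>i)/2\<close>.
\<close>

definition d_z :: "'n \<Rightarrow> (complex ^ 'n \<Rightarrow> complex) \<Rightarrow> complex ^ 'n \<Rightarrow> complex" where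
  "d_z i f z =
     (frechet_derivative f (at z) (axis i 1) - \<i> * frechet_derivative f (at z) (axis i \<i>)) / 2"

definition d_zbar :: "'n \<Rightarrow> (complex ^ 'n \<Rightarrow> complex) \<Rightarrow> complex ^ 'n \<Rightarrow> complex" where
  "d_zbar i f z =
     (frechet_derivative f (at z) (axis i 1) + \<i> * frechet_derivative f (at z) (axis i \<i>)) / 2"


section \<open>Complex manifolds\<close>

text \<open>A chart is a coordinate domain together with its coordinate map (relevant on the domain only).\<close>

type_synonym ('a, 'n) chart = "'a set \<times> ('a \<Rightarrow> (complex, 'n) vec)"

definition chart_image :: "('a, 'n::finite) chart \<Rightarrow> (complex ^ 'n) set" where
  "chart_image c = snd c ` fst c"

definition is_chart :: "'a topology \<Rightarrow> ('a, 'n::finite) chart \<Rightarrow> bool" where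
  "is_chart X c \<longleftrightarrow>
     openin X (fst c) \<and> open (chart_image c) \<and>
     homeomorphic_map (subtopology X (fst c)) (top_of_set (chart_image c)) (snd c)"

text \<open>The part of the image of \<open>c\<close> lying over the overlap of \<open>c\<close> and \<open>d\<close>, where the
  change of coordinates from \<open>c\<close> to \<open>d\<close> is defined.\<close>

definition overlap :: "('a, 'n::finite) chart \<Rightarrow> ('a, 'n) chart \<Rightarrow> (complex ^ 'n) set" where
  "overlap c d = snd c ` (fst c \<inter> fst d)"

definition transition ::
    "('a, 'n::finite) chart \<Rightarrow> ('a, 'n) chart \<Rightarrow> complex ^ 'n \<Rightarrow> complex ^ 'n" where
  "transition c d z = snd d (inv_into (fst c) (snd c) z)"

text \<open>\<open>transition_deriv c d z k i\<close> is the derivative of the \<open>k\<close>-th coordinate of \<open>d\<close> along the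
  \<open>i\<close>-th coordinate of \<open>c\<close>.\<close>

definition transition_deriv ::
    "('a, 'n::finite) chart \<Rightarrow> ('a, 'n) chart \<Rightarrow> complex ^ 'n \<Rightarrow> 'n \<Rightarrow> 'n \<Rightarrow> complex" where
  "transition_deriv c d z k i = d_z i (\<lambda>w. transition c d w $ k) z"

definition complex_manifold :: "'a topology \<Rightarrow> ('a, 'n::finite) chart set \<Rightarrow> bool" where
  "complex_manifold X A \<longleftrightarrow>
     topspace X \<noteq> {} \<and> Hausdorff_space X \<and> second_countable X \<and>
     (\<forall>c\<in>A. is_chart X c) \<and> (\<Union>c\<in>A. fst c) = topspace X \<and>
     (\<forall>c\<in>A. \<forall>d\<in>A. \<forall>k. hol_on (overlap c d) (\<lambda>z. transition c d z $ k))"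


section \<open>Hermitian metrics and the second Ricci-Chern curvature\<close>

definition hermitian_mat :: "complex ^ 'n ^ 'n \<Rightarrow> bool" where
  "hermitian_mat H \<longleftrightarrow> (\<forall>i j. H $ j $ i = cnj (H $ i $ j))"

text \<open>The value is real when \<open>H\<close> is Hermitian, so taking the real part loses nothing there.\<close>

definition herm_form :: "complex ^ 'n ^ 'n \<Rightarrow> complex ^ 'n \<Rightarrow> real" where
  "herm_form H v = Re (\<Sum>i\<in>UNIV. \<Sum>j\<in>UNIV. H $ i $ j * v $ i * cnj (v $ j))"

definition pos_mat :: "complex ^ 'n ^ 'n \<Rightarrow> bool" where
  "pos_mat H \<longleftrightarrow> (\<forall>v. v \<noteq> 0 \<longrightarrow> herm_form H v > 0)"

definition nonneg_mat :: "complex ^ 'n ^ 'n \<Rightarrow> bool" where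
  "nonneg_mat H \<longleftrightarrow> (\<forall>v. herm_form H v \<ge> 0)"

definition neg_mat :: "complex ^ 'n ^ 'n \<Rightarrow> bool" where
  "neg_mat H \<longleftrightarrow> (\<forall>v. v \<noteq> 0 \<longrightarrow> herm_form H v < 0)"

definition nonpos_mat :: "complex ^ 'n ^ 'n \<Rightarrow> bool" where
  "nonpos_mat H \<longleftrightarrow> (\<forall>v. herm_form H v \<le> 0)"

text \<open>
  A metric is given by its components in every chart, as functions of the coordinates:
  \<open>h c z $ i $ j\<close> pairs the \<open>i\<close>-th coordinate field with the conjugate of the \<open>j\<close>-th one.
\<close>

type_synonym ('a, 'n) local_metric =
  "('a, 'n) chart \<Rightarrow> (complex, 'n) vec \<Rightarrow> ((complex, 'n) vec, 'n) vec"

definition hermitian_metric ::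
    "('a, 'n::finite) chart set \<Rightarrow> ('a, 'n) local_metric \<Rightarrow> bool" where
  "hermitian_metric A h \<longleftrightarrow>
     (\<forall>c\<in>A. (\<forall>i j. smooth_on (chart_image c) (\<lambda>z. h c z $ i $ j)) \<and>
            (\<forall>z\<in>chart_image c. hermitian_mat (h c z) \<and> pos_mat (h c z))) \<and>
     (\<forall>c\<in>A. \<forall>d\<in>A. \<forall>z\<in>overlap c d. \<forall>i j.
        h c z $ i $ j =
          (\<Sum>k\<in>UNIV. \<Sum>l\<in>UNIV.
             transition_deriv c d z k i * cnj (transition_deriv c d z l j) * h d (transition c d z) $ k $ l))"

text \<open>
  The entry with upper indices \<open>p\<close> and conjugate \<open>q\<close> of the inverse metric. It is normalised by
  \<open>(\<Sum>q. inv_metric H p q * H $ k $ q) = (if k = p then 1 else 0)\<close>, hence the transposed indices.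
\<close>

definition inv_metric :: "complex ^ 'n ^ 'n \<Rightarrow> 'n \<Rightarrow> 'n \<Rightarrow> complex" where
  "inv_metric H p q = matrix_inv H $ q $ p"

text \<open>In the following two definitions \<open>g\<close> is the local expression of a metric in one chart.\<close>

definition chern_curvature ::
    "(complex ^ 'n \<Rightarrow> complex ^ 'n ^ 'n) \<Rightarrow> complex ^ 'n \<Rightarrow> 'n \<Rightarrow> 'n \<Rightarrow> 'n \<Rightarrow> 'n \<Rightarrow> complex" where
  "chern_curvature g z i j k l =
     - d_z i (d_zbar j (\<lambda>w. g w $ k $ l)) z
     + (\<Sum>p\<in>UNIV. \<Sum>q\<in>UNIV.
          inv_metric (g z) p q * d_zbar j (\<lambda>w. g w $ p $ l) z * d_z i (\<lambda>w. g w $ k $ q) z)"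

definition second_ricci ::
    "(complex ^ 'n \<Rightarrow> complex ^ 'n ^ 'n) \<Rightarrow> complex ^ 'n \<Rightarrow> complex ^ 'n ^ 'n" where
  "second_ricci g z =
     (\<chi> i j. \<Sum>k\<in>UNIV. \<Sum>l\<in>UNIV. inv_metric (g z) k l * chern_curvature g z k l i j)"

text \<open>
  A sign condition \<open>P\<close> on the second Ricci-Chern curvature at a point \<open>x\<close> of the manifold.
  The four conditions used for \<open>P\<close> are invariant under changes of coordinates.
\<close>

definition second_ricci_at ::
    "(complex ^ 'n ^ 'n \<Rightarrow> bool) \<Rightarrow> ('a, 'n::finite) chart set \<Rightarrow> ('a, 'n) local_metric \<Rightarrow> 'a \<Rightarrow> bool"
  where
  "second_ricci_at P A h x \<longleftrightarrow>
     (\<forall>c\<in>A. x \<in> fst c \<longrightarrow> P (second_ricci (h c) (snd c x)))"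


section \<open>Holomorphic forms and polyvector fields\<close>

text \<open>
  An element of the \<open>p\<close>-th exterior power of complex n-space, or of its dual, is given by its
  components in the standard basis: a totally antisymmetric family indexed by multi-indices
  of length \<open>p\<close>. The other multi-indices carry the junk value 0.
\<close>

definition alternating :: "nat \<Rightarrow> ('n list \<Rightarrow> complex) \<Rightarrow> bool" where
  "alternating p t \<longleftrightarrow>
     (\<forall>I. length I \<noteq> p \<longrightarrow> t I = 0) \<and>
     (\<forall>I a b. length I = p \<and> a < p \<and> b < p \<and> a \<noteq> b \<longrightarrow> t (I[a := I ! b, b := I ! a]) = - t I)"

text \<open>
  A section is given by its components in every chart, as functions of the coordinates. The
  value 0 off the charts makes the representation unique, so that sections form a genuine
  complex vector space.
\<close>

type_synonym ('a, 'n) local_section =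
  "('a, 'n) chart \<Rightarrow> (complex, 'n) vec \<Rightarrow> 'n list \<Rightarrow> complex"

definition hol_components ::
    "('a, 'n::finite) chart set \<Rightarrow> nat \<Rightarrow> ('a, 'n) local_section \<Rightarrow> bool" where
  "hol_components A p s \<longleftrightarrow>
     (\<forall>c z. \<not> (c \<in> A \<and> z \<in> chart_image c) \<longrightarrow> s c z = 0) \<and>
     (\<forall>c z. alternating p (s c z)) \<and>
     (\<forall>c\<in>A. \<forall>I. hol_on (chart_image c) (\<lambda>z. s c z I))"

text \<open>Holomorphic \<open>p\<close>-forms: the components transform like those of a covariant tensor.\<close>

definition holomorphic_forms ::
    "('a, 'n::finite) chart set \<Rightarrow> nat \<Rightarrow> ('a, 'n) local_section set" where
  "holomorphic_forms A p =
     {s. hol_components A p s \<and>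
         (\<forall>c\<in>A. \<forall>d\<in>A. \<forall>z\<in>overlap c d. \<forall>I. length I = p \<longrightarrow>
            s c z I =
              (\<Sum>J | length J = p.
                 (\<Prod>m<p. transition_deriv c d z (J ! m) (I ! m)) * s d (transition c d z) J))}"

text \<open>Holomorphic sections of the \<open>p\<close>-th exterior power of the holomorphic tangent bundle: the
  components transform like those of a contravariant tensor.\<close>

definition holomorphic_polyvectors ::
    "('a, 'n::finite) chart set \<Rightarrow> nat \<Rightarrow> ('a, 'n) local_section set" where
  "holomorphic_polyvectors A p =
     {s. hol_components A p s \<and>
         (\<forall>c\<in>A. \<forall>d\<in>A. \<forall>z\<in>overlap c d. \<forall>I. length I = p \<longrightarrow>
            s d (transition c d z) I =
              (\<Sum>J | length J = p.
                 (\<Prod>m<p. transition_deriv c d z (I ! m) (J ! m)) * s c z J))}"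

definition section_scale ::
    "complex \<Rightarrow> ('a, 'n::finite) local_section \<Rightarrow> ('a, 'n) local_section" where
  "section_scale a s = (\<lambda>c z I. a * s c z I)"

lemma vector_space_section_scale: "vector_space section_scale"
  by unfold_locales (auto simp: section_scale_def fun_eq_iff algebra_simps)

lemma hol_on_add:
  assumes "hol_on S f" and "hol_on S g"
  shows "hol_on S (\<lambda>z. f z + g z)"
  unfolding hol_on_def
proof
  fix z assume z: "z \<in> S"
  obtain f' where f': "(f has_derivative f') (at z)" "\<forall>c v. f' (c *s v) = c * f' v"
    using assms(1) z unfolding hol_on_def by blast
  obtain g' where g': "(g has_derivative g') (at z)" "\<forall>c v. g' (c *s v) = c * g' v"
    using assms(2) z unfolding hol_on_def by blast
  show "\<exists>d. ((\<lambda>z. f z + g z) has_derivative d) (at z) \<and> (\<forall>c v. d (c *s v) = c * d v)"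
    using has_derivative_add[OF f'(1) g'(1)] f'(2) g'(2)
    by (intro exI[of _ "\<lambda>v. f' v + g' v"]) (simp add: distrib_left)
qed

lemma hol_on_scale:
  assumes "hol_on S f"
  shows "hol_on S (\<lambda>z. a * f z)"
  unfolding hol_on_def
proof
  fix z assume z: "z \<in> S"
  obtain f' where f': "(f has_derivative f') (at z)" "\<forall>c v. f' (c *s v) = c * f' v"
    using assms z unfolding hol_on_def by blast
  show "\<exists>d. ((\<lambda>z. a * f z) has_derivative d) (at z) \<and> (\<forall>c v. d (c *s v) = c * d v)"
    using has_derivative_mult_right[OF f'(1), of a] f'(2)
    by (intro exI[of _ "\<lambda>v. a * f' v"]) simp
qed

lemma hol_on_zero: "hol_on S (\<lambda>z. 0)"
  unfolding hol_on_def by (auto intro!: exI[of _ "\<lambda>v. 0"])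

lemma subspace_holomorphic_forms: "module.subspace section_scale (holomorphic_forms A p)"
proof -
  interpret vector_space section_scale by (rule vector_space_section_scale)
  show ?thesis
  proof (rule subspaceI)
    show "0 \<in> holomorphic_forms A p"
      by (simp add: holomorphic_forms_def hol_components_def alternating_def hol_on_zero)
  next
    fix s t assume s: "s \<in> holomorphic_forms A p" and t: "t \<in> holomorphic_forms A p"
    have "hol_components A p (s + t)"
      using s t unfolding holomorphic_forms_def hol_components_def alternating_def
      by (simp add: hol_on_add)
    with s t show "s + t \<in> holomorphic_forms A p"
      unfolding holomorphic_forms_def by (simp add: distrib_left sum.distrib)
  next
    fix a s assume s: "s \<in> holomorphic_forms A p"
    have "hol_components A p (section_scale a s)"
      using s unfolding holomorphic_forms_def hol_components_def alternating_def section_scale_def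
      by (auto simp: fun_eq_iff intro: hol_on_scale)
    with s show "section_scale a s \<in> holomorphic_forms A p"
      unfolding holomorphic_forms_def
      by (simp add: section_scale_def sum_distrib_left mult.left_commute)
  qed
qed

text \<open>The complex dimension; the library assigns 0 to spaces of infinite dimension, which do not
  arise on a compact manifold.\<close>

definition hodge_p0 :: "('a, 'n::finite) chart set \<Rightarrow> nat \<Rightarrow> nat" where
  "hodge_p0 A p = vector_space.dim section_scale (holomorphic_forms A p)"

definition arithmetic_genus :: "('a, 'n::finite) chart set \<Rightarrow> int" where
  "arithmetic_genus A = (\<Sum>p=0..CARD('n). (-1) ^ p * int (hodge_p0 A p))"

end

theory Submission
  imports Defs "HOL-Complex_Analysis.Cauchy_Integral_Formula"
begin

text \<open>
  A holomorphic \<open>p\<close>-form or polyvector field \<open>s\<close> is measured by the supremum \<open>N\<close> of its values on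
  \<open>p\<close>-tuples of unit (co)vectors. Near a point where the supremum is attained, \<open>N\<close> is bounded below by
  the values of \<open>s\<close> on (co)vectors moving along a complex line so that the values stay holomorphic to
  second order and the lengths have a critical point whose \<open>\<partial>\<partial>bar\<close>-derivative is, up to sign, the Chern
  curvature. Summing over a unitary frame of directions turns this curvature into the second
  Ricci-Chern curvature, so under the sign hypothesis \<open>N\<close> is subharmonic for the trace of \<open>\<partial>\<partial>bar\<close> in
  the viscosity sense. Hopf's barrier argument then makes \<open>N\<close> constant, and a point of strict sign
  forces the constant to be 0. For \<open>p = 0\<close> the same principle, applied to \<open>s - s(x0)\<close>, shows that
  holomorphic functions are constant.
\<close>

section \<open>Second-order jets along complex lines\<close>

text \<open>Without a Kaehler condition the trace of \<partial>\<partial>bar need not be the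
  Laplace-Beltrami operator, and integrating a Bochner formula leaves torsion terms. The argument
  therefore rests on pointwise second-order information and a maximum principle. The supremum over
  tuples replaces the Hermitian norm on exterior powers so that only the curvature of the tangent
  bundle occurs: at a maximising tuple the arguments contribute separately and their curvature terms
  add. The price is that \<open>N\<close> is merely continuous, whence the test functions. Comparing
  \<open>N\<close> and not its square produces the factor 1/2 in \<open>bochner_line\<close>. All
  second-order data live on one complex line and are read off on its real and imaginary axes, so the
  product rule is nearly all the calculus required. Both orders of mixed derivatives are averaged
  instead of identified. Forms and polyvectors differ in the map \<open>Q\<close> and the sign
  \<sigma> only: passing to dual covectors reverses the curvature.\<close>

definition jet2 :: "(real \<Rightarrow> complex) \<Rightarrow> complex \<Rightarrow> complex \<Rightarrow> bool" where
  "jet2 f a b \<longleftrightarrow> (\<exists>f'. (\<forall>\<^sub>F r in nhds 0. (f has_vector_derivative f' r) (at r)) \<and> f' 0 = a \<and>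
     (f' has_vector_derivative b) (at 0))"

lemma jet2_const: "jet2 (\<lambda>r. c) 0 0"
  unfolding jet2_def by (rule exI[of _ "\<lambda>r. 0"]) simp

lemma jet2_linear: "jet2 (\<lambda>r. c * of_real r) c 0"
  unfolding jet2_def
proof (intro exI[of _ "\<lambda>r. c"] conjI always_eventually allI)
  fix r :: real
  show "((\<lambda>r. c * of_real r) has_vector_derivative c) (at r)"
    by (auto intro!: derivative_eq_intros simp: has_vector_derivative_def scaleR_conv_of_real)
qed auto

lemma jet2_add:
  assumes "jet2 f a b" "jet2 g c d"
  shows "jet2 (\<lambda>r. f r + g r) (a + c) (b + d)"
proof -
  obtain f' where f': "\<forall>\<^sub>F r in nhds 0. (f has_vector_derivative f' r) (at r)" "f' 0 = a"
    "(f' has_vector_derivative b) (at 0)" using assms(1) unfolding jet2_def by blast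
  obtain g' where g': "\<forall>\<^sub>F r in nhds 0. (g has_vector_derivative g' r) (at r)" "g' 0 = c"
    "(g' has_vector_derivative d) (at 0)" using assms(2) unfolding jet2_def by blast
  have "\<forall>\<^sub>F r in nhds 0. ((\<lambda>r. f r + g r) has_vector_derivative f' r + g' r) (at r)"
    using f'(1) g'(1) by eventually_elim (rule has_vector_derivative_add)
  with f' g' show ?thesis
    unfolding jet2_def by (intro exI[of _ "\<lambda>r. f' r + g' r"]) (auto intro: has_vector_derivative_add)
qed

lemma jet2_mult:
  assumes "jet2 f a b" "jet2 g c d"
  shows "jet2 (\<lambda>r. f r * g r) (f 0 * c + a * g 0) (f 0 * d + 2 * a * c + b * g 0)"
proof -
  obtain f' where f': "\<forall>\<^sub>F r in nhds 0. (f has_vector_derivative f' r) (at r)" "f' 0 = a"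
    "(f' has_vector_derivative b) (at 0)" using assms(1) unfolding jet2_def by blast
  obtain g' where g': "\<forall>\<^sub>F r in nhds 0. (g has_vector_derivative g' r) (at r)" "g' 0 = c"
    "(g' has_vector_derivative d) (at 0)" using assms(2) unfolding jet2_def by blast
  have *: "\<forall>\<^sub>F r in nhds 0. ((\<lambda>r. f r * g r) has_vector_derivative f r * g' r + f' r * g r) (at r)"
    using f'(1) g'(1) by eventually_elim (rule has_vector_derivative_mult)
  have "(f has_vector_derivative a) (at 0)" "(g has_vector_derivative c) (at 0)"
    using eventually_nhds_x_imp_x[OF f'(1)] eventually_nhds_x_imp_x[OF g'(1)] f' g' by auto
  then have "((\<lambda>r. f r * g' r + f' r * g r) has_vector_derivative
      (f 0 * d + a * g' 0) + (f' 0 * c + b * g 0)) (at 0)"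
    using f' g' by (intro has_vector_derivative_add has_vector_derivative_mult)
  with f' g' * show ?thesis
    unfolding jet2_def by (intro exI[of _ "\<lambda>r. f r * g' r + f' r * g r"]) (auto simp: algebra_simps)
qed

lemma jet2_cnj:
  assumes "jet2 f a b"
  shows "jet2 (\<lambda>r. cnj (f r)) (cnj a) (cnj b)"
proof -
  obtain f' where f': "\<forall>\<^sub>F r in nhds 0. (f has_vector_derivative f' r) (at r)" "f' 0 = a"
    "(f' has_vector_derivative b) (at 0)" using assms(1) unfolding jet2_def by blast
  have "\<forall>\<^sub>F r in nhds 0. ((\<lambda>r. cnj (f r)) has_vector_derivative cnj (f' r)) (at r)"
    using f'(1) by eventually_elim (rule has_vector_derivative_cnj)
  with f' show ?thesis
    unfolding jet2_def by (intro exI[of _ "\<lambda>r. cnj (f' r)"]) (auto intro: has_vector_derivative_cnj)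
qed

text \<open>If \<open>Re b < 0\<close>, the derivative of \<open>Re f\<close>, which vanishes at the
  minimum 0, is negative just to the right of 0; the mean value theorem then pushes
  \<open>Re f\<close> below its minimum.\<close>

lemma jet2_second_derivative_test:
  assumes "jet2 f a b" and min: "\<forall>\<^sub>F r in nhds 0. Re (f 0) \<le> Re (f r)"
  shows "Re b \<ge> 0"
proof (rule ccontr)
  assume "\<not> Re b \<ge> 0"
  then have neg: "Re b < 0" by simp
  obtain f' where f': "\<forall>\<^sub>F r in nhds 0. (f has_vector_derivative f' r) (at r)" "f' 0 = a"
    "(f' has_vector_derivative b) (at 0)" using assms(1) unfolding jet2_def by blast
  define g where "g = (\<lambda>r. Re (f r))"
  define g' where "g' = (\<lambda>r. Re (f' r))"
  have Re_deriv: "((\<lambda>r. Re (u r)) has_real_derivative Re v) (at x)"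
    if "(u has_vector_derivative v) (at x)" for u v x
    using bounded_linear.has_vector_derivative[OF bounded_linear_Re that]
    by (simp add: has_real_derivative_iff_has_vector_derivative)
  have ev: "\<forall>\<^sub>F r in nhds 0. (g has_real_derivative g' r) (at r) \<and> g 0 \<le> g r"
    using f'(1) min by eventually_elim (simp add: g_def g'_def Re_deriv)
  then obtain d where d: "d > 0" "\<And>r. \<bar>r\<bar> < d \<Longrightarrow> (g has_real_derivative g' r) (at r) \<and> g 0 \<le> g r"
    unfolding eventually_nhds_metric by (auto simp: dist_real_def)
  have g'0: "g' 0 = 0"
    using d by (intro DERIV_local_min[of g "g' 0" 0 d]) auto
  have "(g' has_real_derivative Re b) (at 0)"
    unfolding g'_def by (rule Re_deriv[OF f'(3)])
  from DERIV_neg_dec_right[OF this neg] obtain e where e: "e > 0"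
    "\<And>h. 0 < h \<Longrightarrow> h < e \<Longrightarrow> g' h < 0" using g'0 by auto
  define r where "r = min d e / 2"
  have r: "0 < r" "r < d" "r < e" using d e by (auto simp: r_def)
  have "\<exists>z. 0 < z \<and> z < r \<and> g r - g 0 = (r - 0) * g' z"
    using r d by (intro MVT2) auto
  then obtain z where z: "0 < z" "z < r" "g r - g 0 = r * g' z" by auto
  have "r * g' z < 0" using e(2)[of z] z r by (simp add: mult_pos_neg)
  moreover have "g 0 \<le> g r" using d(2)[of r] r by auto
  ultimately show False using z by simp
qed

text \<open>The 2-jet at 0 of a function of one complex variable:
  \<open>\<alpha>\<close>, \<open>\<beta>\<close> and \<open>\<mu>\<close> are its derivatives along \<open>\<partial>\<close>, \<open>\<partial>bar\<close> and \<open>\<partial>\<partial>bar\<close>.\<close>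

definition wjet :: "(complex \<Rightarrow> complex) \<Rightarrow> complex \<Rightarrow> complex \<Rightarrow> complex \<Rightarrow> bool" where
  "wjet f \<alpha> \<beta> \<mu> \<longleftrightarrow> (\<exists>b b'. jet2 (\<lambda>r. f (of_real r)) (\<alpha> + \<beta>) b \<and>
     jet2 (\<lambda>r. f (\<i> * of_real r)) (\<i> * (\<alpha> - \<beta>)) b' \<and> b + b' = 4 * \<mu>)"

lemma wjet_const: "wjet (\<lambda>t. c) 0 0 0"
  unfolding wjet_def using jet2_const by fastforce

lemma wjet_ident: "wjet (\<lambda>t. t) 1 0 0"
  unfolding wjet_def using jet2_linear[of 1] jet2_linear[of \<i>] by fastforce

lemma wjet_add:
  assumes "wjet f \<alpha> \<beta> \<mu>" "wjet g \<alpha>' \<beta>' \<mu>'"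
  shows "wjet (\<lambda>t. f t + g t) (\<alpha> + \<alpha>') (\<beta> + \<beta>') (\<mu> + \<mu>')"
proof -
  obtain b b' where 1: "jet2 (\<lambda>r. f (of_real r)) (\<alpha> + \<beta>) b"
     "jet2 (\<lambda>r. f (\<i> * of_real r)) (\<i> * (\<alpha> - \<beta>)) b'" "b + b' = 4 * \<mu>"
    using assms(1) unfolding wjet_def by blast
  obtain c c' where 2: "jet2 (\<lambda>r. g (of_real r)) (\<alpha>' + \<beta>') c"
     "jet2 (\<lambda>r. g (\<i> * of_real r)) (\<i> * (\<alpha>' - \<beta>')) c'" "c + c' = 4 * \<mu>'"
    using assms(2) unfolding wjet_def by blast
  from jet2_add[OF 1(1) 2(1)] jet2_add[OF 1(2) 2(2)] 1(3) 2(3) show ?thesis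
    unfolding wjet_def by (intro exI[of _ "b + c"] exI[of _ "b' + c'"]) (simp add: algebra_simps)
qed

text \<open>Recording only the sum of the second derivatives along the two axes is enough for
  products: the cross terms 2(\<alpha> + \<beta>)(\<alpha>' + \<beta>') and -2(\<alpha> -
  \<beta>)(\<alpha>' - \<beta>') add up to 4(\<alpha>\<beta>' + \<beta>\<alpha>').\<close>

lemma wjet_mult:
  assumes "wjet f \<alpha> \<beta> \<mu>" "wjet g \<alpha>' \<beta>' \<mu>'"
  shows "wjet (\<lambda>t. f t * g t) (f 0 * \<alpha>' + \<alpha> * g 0) (f 0 * \<beta>' + \<beta> * g 0)
    (f 0 * \<mu>' + \<alpha> * \<beta>' + \<beta> * \<alpha>' + \<mu> * g 0)"
proof -
  obtain b b' where 1: "jet2 (\<lambda>r. f (of_real r)) (\<alpha> + \<beta>) b"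
     "jet2 (\<lambda>r. f (\<i> * of_real r)) (\<i> * (\<alpha> - \<beta>)) b'" "b + b' = 4 * \<mu>"
    using assms(1) unfolding wjet_def by blast
  obtain c c' where 2: "jet2 (\<lambda>r. g (of_real r)) (\<alpha>' + \<beta>') c"
     "jet2 (\<lambda>r. g (\<i> * of_real r)) (\<i> * (\<alpha>' - \<beta>')) c'" "c + c' = 4 * \<mu>'"
    using assms(2) unfolding wjet_def by blast
  have "(f 0 * c + 2 * (\<alpha> + \<beta>) * (\<alpha>' + \<beta>') + b * g 0) +
      (f 0 * c' + 2 * (\<i> * (\<alpha> - \<beta>)) * (\<i> * (\<alpha>' - \<beta>')) + b' * g 0) =
      f 0 * (c + c') + 4 * (\<alpha> * \<beta>' + \<beta> * \<alpha>') + (b + b') * g 0"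
    by (simp add: algebra_simps)
  then have "(f 0 * c + 2 * (\<alpha> + \<beta>) * (\<alpha>' + \<beta>') + b * g 0) +
      (f 0 * c' + 2 * (\<i> * (\<alpha> - \<beta>)) * (\<i> * (\<alpha>' - \<beta>')) + b' * g 0) =
      4 * (f 0 * \<mu>' + \<alpha> * \<beta>' + \<beta> * \<alpha>' + \<mu> * g 0)"
    unfolding 1(3) 2(3) by (simp add: algebra_simps)
  with jet2_mult[OF 1(1) 2(1)] jet2_mult[OF 1(2) 2(2)] show ?thesis
    unfolding wjet_def
    by (intro exI[of _ "f 0 * c + 2 * (\<alpha> + \<beta>) * (\<alpha>' + \<beta>') + b * g 0"]
        exI[of _ "f 0 * c' + 2 * (\<i> * (\<alpha> - \<beta>)) * (\<i> * (\<alpha>' - \<beta>')) + b' * g 0"])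
      (simp add: algebra_simps)
qed

lemma wjet_cnj:
  assumes "wjet f \<alpha> \<beta> \<mu>"
  shows "wjet (\<lambda>t. cnj (f t)) (cnj \<beta>) (cnj \<alpha>) (cnj \<mu>)"
proof -
  obtain b b' where 1: "jet2 (\<lambda>r. f (of_real r)) (\<alpha> + \<beta>) b"
     "jet2 (\<lambda>r. f (\<i> * of_real r)) (\<i> * (\<alpha> - \<beta>)) b'" "b + b' = 4 * \<mu>"
    using assms(1) unfolding wjet_def by blast
  have "cnj b + cnj b' = 4 * cnj \<mu>" using arg_cong[OF 1(3), of cnj] by simp
  with jet2_cnj[OF 1(1)] jet2_cnj[OF 1(2)] show ?thesis
    unfolding wjet_def
    by (intro exI[of _ "cnj b"] exI[of _ "cnj b'"]) (simp add: algebra_simps)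
qed

lemma wjet_cmult:
  assumes "wjet f \<alpha> \<beta> \<mu>"
  shows "wjet (\<lambda>t. c * f t) (c * \<alpha>) (c * \<beta>) (c * \<mu>)"
  using wjet_mult[OF wjet_const[of c] assms] by simp

lemma wjet_diff:
  assumes "wjet f \<alpha> \<beta> \<mu>" "wjet g \<alpha>' \<beta>' \<mu>'"
  shows "wjet (\<lambda>t. f t - g t) (\<alpha> - \<alpha>') (\<beta> - \<beta>') (\<mu> - \<mu>')"
  using wjet_add[OF assms(1) wjet_cmult[OF assms(2), of "- 1"]] by simp

lemma wjet_sum:
  assumes "\<And>i. i \<in> I \<Longrightarrow> wjet (f i) (\<alpha> i) (\<beta> i) (\<mu> i)"
  shows "wjet (\<lambda>t. \<Sum>i\<in>I. f i t) (\<Sum>i\<in>I. \<alpha> i) (\<Sum>i\<in>I. \<beta> i) (\<Sum>i\<in>I. \<mu> i)"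
  using assms by (induction I rule: infinite_finite_induct) (auto intro: wjet_const wjet_add)

lemma wjet_prod_antiholomorphic_free:
  assumes "\<And>i. i \<in> I \<Longrightarrow> \<exists>\<alpha>. wjet (f i) \<alpha> 0 0"
  shows "\<exists>\<alpha>. wjet (\<lambda>t. \<Prod>i\<in>I. f i t) \<alpha> 0 0"
  using assms
proof (induction I rule: infinite_finite_induct)
  case (insert x F)
  then obtain \<alpha> \<alpha>' where "wjet (f x) \<alpha> 0 0" "wjet (\<lambda>t. \<Prod>i\<in>F. f i t) \<alpha>' 0 0" by (metis insertCI)
  from wjet_mult[OF this] insert.hyps show ?case by auto
qed (auto intro: wjet_const)

lemma wjet_sum_antiholomorphic_free:
  assumes "\<And>i. i \<in> I \<Longrightarrow> \<exists>\<alpha>. wjet (f i) \<alpha> 0 0"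
  shows "\<exists>\<alpha>. wjet (\<lambda>t. \<Sum>i\<in>I. f i t) \<alpha> 0 0"
proof -
  obtain \<alpha> where "\<And>i. i \<in> I \<Longrightarrow> wjet (f i) (\<alpha> i) 0 0" using assms by metis
  from wjet_sum[of I f \<alpha> "\<lambda>_. 0" "\<lambda>_. 0", OF this] show ?thesis by auto
qed

text \<open>First derivatives vanish and factors equal 1 at 0, so every mixed term of the product
  rule drops out. This is how the curvatures of the separate arguments come to add up.\<close>

lemma wjet_prod_critical:
  assumes "finite I" "\<And>i. i \<in> I \<Longrightarrow> wjet (f i) 0 0 (\<mu> i)" "\<And>i. i \<in> I \<Longrightarrow> f i 0 = 1"
  shows "wjet (\<lambda>t. \<Prod>i\<in>I. f i t) 0 0 (\<Sum>i\<in>I. \<mu> i)"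
  using assms
proof (induction I rule: finite_induct)
  case (insert x F)
  have "wjet (f x) 0 0 (\<mu> x)" "wjet (\<lambda>t. \<Prod>i\<in>F. f i t) 0 0 (\<Sum>i\<in>F. \<mu> i)" "f x 0 = 1"
    "(\<Prod>i\<in>F. f i 0) = 1"
    using insert by auto
  from wjet_mult[OF this(1,2)] this insert.hyps show ?case by (simp add: add.commute)
qed (auto intro: wjet_const)

text \<open>Along the directions 1 and \<i> the second derivatives at 0 are f'' and -f'', so their
  sum vanishes.\<close>

lemma wjet_holomorphic:
  assumes "open T" "0 \<in> T" "f holomorphic_on T"
  shows "wjet f (deriv f 0) 0 0"
proof -
  have f': "deriv f holomorphic_on T" using assms by (intro holomorphic_deriv)
  have df: "(f has_field_derivative deriv f z) (at z)" if "z \<in> T" for z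
    using assms that by (auto intro: holomorphic_derivI)
  have d2f: "(deriv f has_field_derivative deriv (deriv f) z) (at z)" if "z \<in> T" for z
    using assms f' that by (auto intro: holomorphic_derivI)
  have line: "jet2 (\<lambda>r. f (c * of_real r)) (c * deriv f 0) (c * c * deriv (deriv f) 0)" for c
  proof -
    have lin: "((\<lambda>r. c * of_real r) has_vector_derivative c) (at r)" for r
      by (auto intro!: derivative_eq_intros simp: has_vector_derivative_def scaleR_conv_of_real)
    have "((\<lambda>r::real. c * of_real r) \<longlongrightarrow> c * of_real 0) (nhds 0)"
      unfolding tendsto_nhds_iff by (auto intro!: tendsto_eq_intros)
    then have "\<forall>\<^sub>F r::real in nhds 0. c * of_real r \<in> T"
      by (rule topological_tendstoD) (use assms in auto)
    then have 1: "\<forall>\<^sub>F r in nhds 0. ((\<lambda>r. f (c * of_real r)) has_vector_derivative c * deriv f (c * of_real r)) (at r)"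
    proof eventually_elim
      case (elim r)
      from field_vector_diff_chain_at[OF lin df[OF elim]] show ?case by (simp add: o_def)
    qed
    have "((\<lambda>r. deriv f (c * of_real r)) has_vector_derivative c * deriv (deriv f) 0) (at 0)"
      using field_vector_diff_chain_at[OF lin[of 0], of "deriv f" "deriv (deriv f) 0"] d2f[OF assms(2)]
      by (simp add: o_def)
    from has_vector_derivative_mult_right[OF this, of c] 1 show ?thesis
      unfolding jet2_def by (intro exI[of _ "\<lambda>r. c * deriv f (c * of_real r)"]) (auto simp: mult.assoc)
  qed
  from line[of 1] line[of \<i>] show ?thesis unfolding wjet_def by fastforce
qed

lemma wjet_local_min:
  assumes "wjet f \<alpha> \<beta> \<mu>" "\<forall>\<^sub>F t in nhds 0. Re (f 0) \<le> Re (f t)"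
  shows "Re \<mu> \<ge> 0"
proof -
  obtain b b' where 1: "jet2 (\<lambda>r. f (of_real r)) (\<alpha> + \<beta>) b"
     "jet2 (\<lambda>r. f (\<i> * of_real r)) (\<i> * (\<alpha> - \<beta>)) b'" "b + b' = 4 * \<mu>"
    using assms(1) unfolding wjet_def by blast
  have line: "\<forall>\<^sub>F r::real in nhds 0. Re (f 0) \<le> Re (f (c * of_real r))" for c
  proof -
    have "filterlim (\<lambda>r::real. c * of_real r) (nhds (c * of_real 0)) (nhds 0)"
      unfolding tendsto_nhds_iff by (auto intro!: tendsto_eq_intros)
    then show ?thesis using assms(2) by (auto simp: filterlim_iff)
  qed
  have "Re b \<ge> 0" using jet2_second_derivative_test[OF 1(1)] line[of 1] by simp
  moreover have "Re b' \<ge> 0" using jet2_second_derivative_test[OF 1(2)] line[of \<i>] by simp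
  ultimately show ?thesis using arg_cong[OF 1(3), of Re] by simp
qed

section \<open>Hermitian forms and unitary frames\<close>

definition cform :: "complex ^ 'n ^ 'n \<Rightarrow> complex ^ 'n \<Rightarrow> complex ^ 'n \<Rightarrow> complex" where
  "cform H v w = (\<Sum>i\<in>UNIV. \<Sum>j\<in>UNIV. H $ i $ j * v $ i * cnj (w $ j))"

lemma herm_form_eq: "herm_form H v = Re (cform H v v)"
  by (simp add: herm_form_def cform_def)

lemma cnj_cform:
  assumes "hermitian_mat H"
  shows "cnj (cform H v w) = cform H w v"
proof -
  have "cnj (H $ i $ j) = H $ j $ i" for i j
    using assms unfolding hermitian_mat_def by metis
  then have "cnj (cform H v w) = (\<Sum>i\<in>UNIV. \<Sum>j\<in>UNIV. H $ j $ i * cnj (v $ i) * w $ j)"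
    by (simp add: cform_def)
  also have "\<dots> = cform H w v"
    unfolding cform_def by (subst sum.swap) (simp add: mult_ac)
  finally show ?thesis .
qed

lemma cform_self:
  assumes "hermitian_mat H"
  shows "cform H v v = of_real (herm_form H v)"
  using cnj_cform[OF assms, of v v] by (simp add: herm_form_eq complex_eq_iff)

lemma cform_scale_left: "cform H (c *s v) w = c * cform H v w"
  by (simp add: cform_def sum_distrib_left mult_ac)

lemma cform_scale_right: "cform H v (c *s w) = cnj c * cform H v w"
  by (simp add: cform_def sum_distrib_left mult_ac)

lemma herm_form_scale: "herm_form H (c *s v) = (cmod c)\<^sup>2 * herm_form H v"
proof -
  have "cform H (c *s v) (c *s v) = (c * cnj c) * cform H v v"
    by (simp add: cform_scale_left cform_scale_right)
  also have "\<dots> = of_real ((cmod c)\<^sup>2) * cform H v v" 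
    by (simp only: complex_norm_square)
  finally show ?thesis by (simp add: herm_form_eq)
qed

lemma cform_sum_right: "cform H v (\<Sum>m\<in>M. c m *s w m) = (\<Sum>m\<in>M. cnj (c m) * cform H v (w m))"
proof -
  have "cform H v (\<Sum>m\<in>M. c m *s w m) =
      (\<Sum>i\<in>UNIV. \<Sum>j\<in>UNIV. \<Sum>m\<in>M. cnj (c m) * (H $ i $ j * v $ i * cnj (w m $ j)))"
    by (simp add: cform_def sum_distrib_left mult_ac)
  also have "\<dots> = (\<Sum>i\<in>UNIV. \<Sum>m\<in>M. \<Sum>j\<in>UNIV. cnj (c m) * (H $ i $ j * v $ i * cnj (w m $ j)))"
    by (rule sum.cong[OF refl], rule sum.swap)
  also have "\<dots> = (\<Sum>m\<in>M. \<Sum>i\<in>UNIV. \<Sum>j\<in>UNIV. cnj (c m) * (H $ i $ j * v $ i * cnj (w m $ j)))"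
    by (rule sum.swap)
  also have "\<dots> = (\<Sum>m\<in>M. cnj (c m) * cform H v (w m))"
    by (simp add: cform_def sum_distrib_left)
  finally show ?thesis .
qed

lemma pos_mat_invertible:
  fixes H :: "complex ^ 'n ^ 'n"
  assumes "pos_mat H"
  shows "invertible H"
proof -
  have "x = 0" if "transpose H *v x = 0" for x
  proof (rule ccontr)
    assume "x \<noteq> 0"
    then have "herm_form H x > 0" using assms by (simp add: pos_mat_def)
    moreover have "cform H x x = (\<Sum>j\<in>UNIV. (transpose H *v x) $ j * cnj (x $ j))"
      unfolding cform_def
      by (subst sum.swap) (simp add: matrix_vector_mult_def transpose_def sum_distrib_right)
    ultimately show False using that by (simp add: herm_form_eq)
  qed
  then have "\<exists>B. B ** transpose H = mat 1" by (simp add: matrix_left_invertible_ker)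
  then have "invertible (transpose H)" using invertible_left_inverse by blast
  then show ?thesis by (simp add: invertible_det_nz)
qed

definition unitary_frame :: "complex ^ 'n ^ 'n \<Rightarrow> ('n \<Rightarrow> complex ^ 'n) \<Rightarrow> bool" where
  "unitary_frame H e \<longleftrightarrow> (\<forall>m m'. cform H (e m) (e m') = (if m = m' then 1 else 0))"

lemma exists_unitary_frame:
  fixes H :: "complex ^ 'n::finite ^ 'n"
  assumes herm: "hermitian_mat H" and pos: "pos_mat H"
  obtains e where "unitary_frame H e"
proof -
  have "\<exists>e. \<forall>m\<in>B. \<forall>m'\<in>B. cform H (e m) (e m') = (if m = m' then 1 else 0)" if "finite B" for B :: "'n set"
    using that
  proof (induction B rule: finite_induct)
    case (insert x B)
    then obtain e where e: "\<And>m m'. m \<in> B \<Longrightarrow> m' \<in> B \<Longrightarrow> cform H (e m) (e m') = (if m = m' then 1 else 0)"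
      by blast
    define A :: "complex ^ 'n ^ 'n" where
      "A = (\<chi> m j. if m \<in> B then \<Sum>l\<in>UNIV. H $ j $ l * cnj (e m $ l) else 0)"
    \<comment> \<open>the conditions of orthogonality to fewer than \<open>n\<close> vectors form a singular square system\<close>
    have "row x A = 0" using insert.hyps by (simp add: A_def row_def vec_eq_iff)
    then have "det A = 0" by (rule det_zero_row)
    then have "\<not> (\<exists>B. B ** A = mat 1)" 
      using invertible_det_nz invertible_left_inverse by metis
    then obtain w where w: "A *v w = 0" "w \<noteq> 0" by (auto simp: matrix_left_invertible_ker)
    have orth: "cform H w (e m) = 0" if "m \<in> B" for m
    proof -
      have "cform H w (e m) = (A *v w) $ m"
        using that by (simp add: cform_def A_def matrix_vector_mult_def sum_distrib_left mult_ac)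
      then show ?thesis using w by simp
    qed
    define r where "r = 1 / sqrt (herm_form H w)"
    have hw: "herm_form H w > 0" using pos w by (simp add: pos_mat_def)
    define w' where "w' = of_real r *s w"
    have "cform H w' w' = of_real (r * r * herm_form H w)"
      by (simp add: w'_def cform_scale_left cform_scale_right cform_self[OF herm])
    also have "r * r * herm_form H w = 1" using hw by (simp add: r_def field_simps)
    finally have unit: "cform H w' w' = 1" by simp
    have orth': "cform H w' (e m) = 0" "cform H (e m) w' = 0" if "m \<in> B" for m
    proof -
      show "cform H w' (e m) = 0" using orth[OF that] by (simp add: w'_def cform_scale_left)
      then show "cform H (e m) w' = 0" using cnj_cform[OF herm, of w' "e m"] by simp
    qed
    show ?case
      using e unit orth' insert.hyps by (intro exI[of _ "e(x := w')"]) auto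
  qed simp
  from this[of UNIV] obtain e where "unitary_frame H e"
    unfolding unitary_frame_def by auto
  then show thesis by (rule that)
qed

lemma unitary_frame_unit: "unitary_frame H e \<Longrightarrow> herm_form H (e m) = 1"
  by (simp add: unitary_frame_def herm_form_eq)

text \<open>Orthonormality reads \<open>P ** Q = mat 1\<close> with \<open>P = E ** H\<close> and
  \<open>Q\<close> the conjugate transpose of \<open>E\<close>. One-sided inverses of square
  matrices are two-sided, so \<open>Q ** E\<close> inverts \<open>H\<close>. This converts a sum
  over a frame into a contraction with the inverse metric.\<close>

lemma unitary_frame_inv_metric:
  fixes H :: "complex ^ 'n::finite ^ 'n"
  assumes "unitary_frame H e"
  shows "(\<Sum>m\<in>UNIV. e m $ k * cnj (e m $ l)) = inv_metric H k l"
    and "matrix_inv H ** H = mat 1" "H ** matrix_inv H = mat 1"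
proof -
  define P :: "complex ^ 'n ^ 'n" where "P = (\<chi> m j. \<Sum>i\<in>UNIV. e m $ i * H $ i $ j)"
  define Q :: "complex ^ 'n ^ 'n" where "Q = (\<chi> j m. cnj (e m $ j))"
  define E :: "complex ^ 'n ^ 'n" where "E = (\<chi> m i. e m $ i)"
  have "(P ** Q) $ m $ m' = cform H (e m) (e m')" for m m'
  proof -
    have "(P ** Q) $ m $ m' = (\<Sum>j\<in>UNIV. \<Sum>i\<in>UNIV. e m $ i * H $ i $ j * cnj (e m' $ j))"
      by (simp add: P_def Q_def matrix_matrix_mult_def sum_distrib_right)
    also have "\<dots> = cform H (e m) (e m')"
      unfolding cform_def by (subst sum.swap) (simp add: mult_ac)
    finally show ?thesis .
  qed
  then have "P ** Q = mat 1" using assms by (simp add: unitary_frame_def vec_eq_iff mat_def)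
  then have "Q ** P = mat 1" using matrix_left_right_inverse by metis
  moreover have "P = E ** H" by (simp add: P_def E_def matrix_matrix_mult_def vec_eq_iff)
  ultimately have 1: "(Q ** E) ** H = mat 1" by (simp add: matrix_mul_assoc)
  then have 2: "H ** (Q ** E) = mat 1" using matrix_left_right_inverse by metis
  \<comment> \<open>\<open>matrix_inv\<close> is a Hilbert choice; the explicit inverse
    \<open>Q ** E\<close> shows that the choice is not vacuous.\<close>
  have "H ** matrix_inv H = mat 1 \<and> matrix_inv H ** H = mat 1"
    unfolding matrix_inv_def by (rule someI[of _ "Q ** E"]) (use 1 2 in blast)
  then show "matrix_inv H ** H = mat 1" "H ** matrix_inv H = mat 1" by auto
  then have inv: "matrix_inv H = Q ** E"
    using 2 by (metis (no_types) matrix_mul_assoc matrix_mul_lid matrix_mul_rid)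
  show "(\<Sum>m\<in>UNIV. e m $ k * cnj (e m $ l)) = inv_metric H k l"
    by (simp add: inv_metric_def inv Q_def E_def matrix_matrix_mult_def mult.commute)
qed

lemma unitary_frame_expansion:
  fixes H :: "complex ^ 'n::finite ^ 'n"
  assumes "unitary_frame H e"
  shows "(\<Sum>m\<in>UNIV. cform H y (e m) *s e m) = y"
proof -
  have "(\<Sum>m\<in>UNIV. cform H y (e m) * e m $ k) = y $ k" for k
  proof -
    have "(\<Sum>m\<in>UNIV. cform H y (e m) * e m $ k) =
       (\<Sum>m\<in>UNIV. \<Sum>i\<in>UNIV. \<Sum>j\<in>UNIV. y $ i * H $ i $ j * (e m $ k * cnj (e m $ j)))"
      by (simp add: cform_def sum_distrib_right sum_distrib_left mult_ac)
    also have "\<dots> = (\<Sum>i\<in>UNIV. \<Sum>m\<in>UNIV. \<Sum>j\<in>UNIV. y $ i * H $ i $ j * (e m $ k * cnj (e m $ j)))"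
      by (rule sum.swap)
    also have "\<dots> = (\<Sum>i\<in>UNIV. \<Sum>j\<in>UNIV. \<Sum>m\<in>UNIV. y $ i * H $ i $ j * (e m $ k * cnj (e m $ j)))"
      by (rule sum.cong[OF refl], rule sum.swap)
    also have "\<dots> = (\<Sum>i\<in>UNIV. y $ i * (H ** matrix_inv H) $ i $ k)"
      by (simp only: mult.assoc sum_distrib_left[symmetric] unitary_frame_inv_metric(1)[OF assms]
          inv_metric_def matrix_matrix_mult_def vec_lambda_beta)
    also have "\<dots> = y $ k"
      by (simp add: unitary_frame_inv_metric[OF assms] mat_def if_distrib[where f = "\<lambda>x. y $ i * x" for i]
          cong: if_cong)
    finally show ?thesis .
  qed
  then show ?thesis by (simp add: vec_eq_iff)
qed

lemma norm_sq_vec: "(norm (y :: complex ^ 'n::finite))\<^sup>2 = (\<Sum>k\<in>UNIV. (cmod (y $ k))\<^sup>2)"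
  by (simp add: norm_vec_def L2_set_def sum_nonneg)

text \<open>With \<open>c\<close> the frame coefficients of \<open>y\<close> and \<open>d\<close>
  its Euclidean pairings with the frame, |y|^2 is the sum of the c d, and the sum of the |c|^2 is
  the metric square of \<open>y\<close>. Cauchy-Schwarz gives |y|^4 \<le> b |y|^2 times the sum of
  the |d|^2. Applied to a radius vector, this keeps the gradient of the barrier away from 0.\<close>

lemma unitary_frame_lower:
  fixes H :: "complex ^ 'n::finite ^ 'n"
  assumes herm: "hermitian_mat H" and frame: "unitary_frame H e" and b: "herm_form H y \<le> b * (norm y)\<^sup>2"
  shows "(norm y)\<^sup>2 \<le> b * (\<Sum>m\<in>UNIV. (cmod (\<Sum>k\<in>UNIV. e m $ k * cnj (y $ k)))\<^sup>2)"
proof (cases "y = 0")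
  case False
  define c where "c m = cform H y (e m)" for m
  define d where "d m = (\<Sum>k\<in>UNIV. e m $ k * cnj (y $ k))" for m
  have y: "y = (\<Sum>m\<in>UNIV. c m *s e m)" using unitary_frame_expansion[OF frame, of y] by (simp add: c_def)
  have "cform H y y = (\<Sum>m\<in>UNIV. cnj (c m) * c m)"
    by (subst (2) y, subst cform_sum_right) (simp add: c_def)
  then have hy: "herm_form H y = (\<Sum>m\<in>UNIV. (cmod (c m))\<^sup>2)"
    by (simp add: herm_form_eq complex_norm_square[symmetric] mult.commute flip: of_real_power)
  have "of_real ((norm y)\<^sup>2) = (\<Sum>k\<in>UNIV. y $ k * cnj (y $ k))"
    by (simp add: norm_sq_vec complex_norm_square[symmetric])
  also have "\<dots> = (\<Sum>k\<in>UNIV. \<Sum>m\<in>UNIV. c m * (e m $ k * cnj (y $ k)))"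
    by (subst (1) y) (simp add: sum_distrib_right mult.assoc)
  also have "\<dots> = (\<Sum>m\<in>UNIV. c m * d m)"
    by (subst sum.swap) (simp add: d_def sum_distrib_left)
  finally have "(norm y)\<^sup>2 = cmod (\<Sum>m\<in>UNIV. c m * d m)"
    by (metis norm_of_real abs_of_nonneg zero_le_power2)
  also have "\<dots> \<le> (\<Sum>m\<in>UNIV. cmod (c m) * cmod (d m))"
    by (rule order_trans[OF norm_sum]) (simp add: norm_mult)
  finally have "((norm y)\<^sup>2)\<^sup>2 \<le> (\<Sum>m\<in>UNIV. cmod (c m) * cmod (d m))\<^sup>2"
    by (intro power_mono) auto
  also have "\<dots> \<le> (\<Sum>m\<in>UNIV. (cmod (c m))\<^sup>2) * (\<Sum>m\<in>UNIV. (cmod (d m))\<^sup>2)"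
    by (rule Cauchy_Schwarz_ineq_sum)
  also have "\<dots> \<le> (b * (norm y)\<^sup>2) * (\<Sum>m\<in>UNIV. (cmod (d m))\<^sup>2)"
    using b hy by (intro mult_right_mono sum_nonneg) auto
  finally have "(norm y)\<^sup>2 * (norm y)\<^sup>2 \<le> (norm y)\<^sup>2 * (b * (\<Sum>m\<in>UNIV. (cmod (d m))\<^sup>2))"
    by (simp add: power2_eq_square mult_ac)
  moreover have "(norm y)\<^sup>2 > 0" using False by simp
  ultimately show ?thesis unfolding d_def by (rule mult_left_le_imp_le)
qed simp

section \<open>Wirtinger calculus of twice differentiable functions along complex lines\<close>

abbreviation dir_deriv :: "('a::real_normed_vector \<Rightarrow> complex) \<Rightarrow> 'a \<Rightarrow> 'a \<Rightarrow> complex" where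
  "dir_deriv f v x \<equiv> frechet_derivative f (at x) v"

lemma dir_deriv_wirtinger:
  fixes f :: "complex ^ 'n::finite \<Rightarrow> complex"
  assumes "f differentiable (at x)"
  shows "dir_deriv f v x = (\<Sum>k\<in>UNIV. v $ k * d_z k f x + cnj (v $ k) * d_zbar k f x)"
proof -
  interpret linear "frechet_derivative f (at x)"
    using assms by (rule linear_frechet_derivative)
  have "v = (\<Sum>k\<in>UNIV. Re (v $ k) *\<^sub>R axis k 1 + Im (v $ k) *\<^sub>R axis k \<i>)"
  proof -
    have "(\<Sum>k\<in>UNIV. Re (v $ k) *\<^sub>R axis k (1::complex) $ i + Im (v $ k) *\<^sub>R axis k \<i> $ i) = v $ i" for i
    proof -
      have "(\<Sum>k\<in>UNIV. Re (v $ k) *\<^sub>R axis k (1::complex) $ i + Im (v $ k) *\<^sub>R axis k \<i> $ i) =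
         (\<Sum>k\<in>UNIV. if k = i then Re (v $ k) *\<^sub>R 1 + Im (v $ k) *\<^sub>R \<i> else 0)"
        by (rule sum.cong) (auto simp: axis_def)
      then show ?thesis by (simp add: complex_eq_iff)
    qed
    then show ?thesis by (simp add: vec_eq_iff)
  qed
  then have "dir_deriv f v x =
     dir_deriv f (\<Sum>k\<in>UNIV. Re (v $ k) *\<^sub>R axis k 1 + Im (v $ k) *\<^sub>R axis k \<i>) x" by simp
  also have "\<dots> = (\<Sum>k\<in>UNIV. of_real (Re (v $ k)) * dir_deriv f (axis k 1) x
       + of_real (Im (v $ k)) * dir_deriv f (axis k \<i>) x)"
    by (simp only: sum add scaleR) (simp add: scaleR_conv_of_real)
  also have "\<dots> = (\<Sum>k\<in>UNIV. v $ k * d_z k f x + cnj (v $ k) * d_zbar k f x)"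
    by (rule sum.cong) (auto simp: d_z_def d_zbar_def complex_eq_iff field_simps)
  finally show ?thesis .
qed

lemma d_z_cong_open:
  assumes "f differentiable (at x)" "open U" "x \<in> U" "\<And>y. y \<in> U \<Longrightarrow> f y = g y"
  shows "d_z k f x = d_z k g x" "d_zbar k f x = d_zbar k g x"
  using frechet_derivative_transform_within_open[OF assms] by (simp_all add: d_z_def d_zbar_def)

lemma frechet_derivative_cnj:
  assumes "f differentiable (at x)"
  shows "dir_deriv (\<lambda>y. cnj (f y)) v x = cnj (dir_deriv f v x)"
proof -
  have "(f has_derivative frechet_derivative f (at x)) (at x)"
    using assms by (simp add: frechet_derivative_works)
  then have "((\<lambda>y. cnj (f y)) has_derivative (\<lambda>v. cnj (frechet_derivative f (at x) v))) (at x)"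
    by (rule has_derivative_cnj)
  then show ?thesis by (simp only: frechet_derivative_at[symmetric])
qed

lemma d_zbar_cnj:
  assumes "f differentiable (at x)"
  shows "d_zbar k (\<lambda>y. cnj (f y)) x = cnj (d_z k f x)"
  by (simp add: d_zbar_def d_z_def frechet_derivative_cnj[OF assms])

lemma C_2_onD:
  assumes "C_k_on 2 U f" "x \<in> U"
  shows "f differentiable (at x)" "(\<lambda>y. dir_deriv f v y) differentiable (at x)"
  using assms by (auto simp: numeral_2_eq_2)

lemma C_2_on_wirtinger:
  fixes f :: "complex ^ 'n::finite \<Rightarrow> complex"
  assumes "C_k_on 2 U f" "x \<in> U"
  shows "(\<lambda>y. d_z k f y) differentiable (at x)" "(\<lambda>y. d_zbar k f y) differentiable (at x)"
  unfolding d_z_def d_zbar_def divide_inverse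
  by (intro differentiable_add differentiable_diff differentiable_mult differentiable_const
      C_2_onD(2)[OF assms])+

lemma jet2_line:
  fixes f :: "complex ^ 'n::finite \<Rightarrow> complex"
  assumes "C_k_on 2 U f" "open U" "z \<in> U"
  shows "jet2 (\<lambda>r. f (z + r *\<^sub>R v)) (dir_deriv f v z) (dir_deriv (\<lambda>y. dir_deriv f v y) v z)"
proof -
  have line: "((\<lambda>r. z + r *\<^sub>R v) has_vector_derivative v) (at r)" for r
    by (auto intro!: derivative_eq_intros simp: has_vector_derivative_def)
  have der: "((\<lambda>r. g (z + r *\<^sub>R v)) has_vector_derivative dir_deriv g v (z + r *\<^sub>R v)) (at r)"
    if "g differentiable (at (z + r *\<^sub>R v))" for g :: "complex ^ 'n \<Rightarrow> complex" and r
  proof -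
    have g: "(g has_derivative frechet_derivative g (at (z + r *\<^sub>R v))) (at (z + r *\<^sub>R v))"
      using that by (simp add: frechet_derivative_works)
    interpret linear "frechet_derivative g (at (z + r *\<^sub>R v))" using that by (rule linear_frechet_derivative)
    from diff_chain_at[OF line[unfolded has_vector_derivative_def] g] show ?thesis
      by (simp add: has_vector_derivative_def o_def scaleR)
  qed
  have "((\<lambda>r. z + r *\<^sub>R v) \<longlongrightarrow> z + 0 *\<^sub>R v) (nhds 0)"
    unfolding tendsto_nhds_iff by (auto intro!: tendsto_eq_intros)
  then have "\<forall>\<^sub>F r in nhds 0. z + r *\<^sub>R v \<in> U"
    by (rule topological_tendstoD) (use assms in auto)
  then have "\<forall>\<^sub>F r in nhds 0. ((\<lambda>r. f (z + r *\<^sub>R v)) has_vector_derivative dir_deriv f v (z + r *\<^sub>R v)) (at r)"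
    by eventually_elim (rule der, rule C_2_onD(1)[OF assms(1)])
  moreover have "((\<lambda>r. dir_deriv f v (z + r *\<^sub>R v)) has_vector_derivative
      dir_deriv (\<lambda>y. dir_deriv f v y) v z) (at 0)"
    using der[of "\<lambda>y. dir_deriv f v y" 0] C_2_onD(2)[OF assms(1,3)] by simp
  ultimately show ?thesis
    unfolding jet2_def by (intro exI[of _ "\<lambda>r. dir_deriv f v (z + r *\<^sub>R v)"]) simp
qed

lemma dir_deriv_twice:
  fixes f :: "complex ^ 'n::finite \<Rightarrow> complex"
  assumes "C_k_on 2 U f" "open U" "z \<in> U"
  shows "dir_deriv (\<lambda>y. dir_deriv f v y) v z = (\<Sum>k\<in>UNIV. \<Sum>l\<in>UNIV.
     v $ k * v $ l * d_z l (d_z k f) z + v $ k * cnj (v $ l) * d_zbar l (d_z k f) z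
     + cnj (v $ k) * v $ l * d_z l (d_zbar k f) z + cnj (v $ k) * cnj (v $ l) * d_zbar l (d_zbar k f) z)"
proof -
  let ?g = "\<lambda>y. \<Sum>k\<in>UNIV. v $ k * d_z k f y + cnj (v $ k) * d_zbar k f y"
  have fd: "(h has_derivative frechet_derivative h (at z)) (at z)"
    if "h differentiable (at z)" for h :: "complex ^ 'n \<Rightarrow> complex"
    using that by (simp add: frechet_derivative_works)
  note d = C_2_on_wirtinger[OF assms(1,3)]
  have "(?g has_derivative (\<lambda>w. \<Sum>k\<in>UNIV. v $ k * dir_deriv (d_z k f) w z + cnj (v $ k) * dir_deriv (d_zbar k f) w z)) (at z)"
    using d by (intro has_derivative_sum has_derivative_add has_derivative_mult_right fd) auto
  then have "dir_deriv ?g v z = (\<Sum>k\<in>UNIV. v $ k * dir_deriv (d_z k f) v z + cnj (v $ k) * dir_deriv (d_zbar k f) v z)"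
    by (simp only: frechet_derivative_at[symmetric])
  moreover have "frechet_derivative (\<lambda>y. dir_deriv f v y) (at z) = frechet_derivative ?g (at z)"
    using C_2_onD(2)[OF assms(1,3)] assms(2,3)
  proof (rule frechet_derivative_transform_within_open)
    fix y assume "y \<in> U"
    then show "dir_deriv f v y = ?g y" by (intro dir_deriv_wirtinger C_2_onD(1)[OF assms(1)])
  qed
  ultimately have "dir_deriv (\<lambda>y. dir_deriv f v y) v z =
     (\<Sum>k\<in>UNIV. v $ k * dir_deriv (d_z k f) v z + cnj (v $ k) * dir_deriv (d_zbar k f) v z)" by simp
  also have "\<dots> = (\<Sum>k\<in>UNIV. \<Sum>l\<in>UNIV.
     v $ k * v $ l * d_z l (d_z k f) z + v $ k * cnj (v $ l) * d_zbar l (d_z k f) z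
     + cnj (v $ k) * v $ l * d_z l (d_zbar k f) z + cnj (v $ k) * cnj (v $ l) * d_zbar l (d_zbar k f) z)"
    using d by (simp add: dir_deriv_wirtinger sum_distrib_left sum.distrib algebra_simps)
  finally show ?thesis .
qed

text \<open>Adding the second derivatives along \<open>u\<close> and \<i>\<open>u\<close> cancels
  the pure \<partial>\<partial> and \<partial>bar\<partial>bar terms. The mixed derivatives survive
  in both orders and enter as their average, so that no symmetry of second derivatives is
  invoked.\<close>

lemma wjet_line:
  fixes f :: "complex ^ 'n::finite \<Rightarrow> complex"
  assumes "C_k_on 2 U f" "open U" "z \<in> U"
  shows "wjet (\<lambda>t. f (z + t *s u)) (\<Sum>k\<in>UNIV. u $ k * d_z k f z) (\<Sum>k\<in>UNIV. cnj (u $ k) * d_zbar k f z)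
    ((\<Sum>k\<in>UNIV. \<Sum>l\<in>UNIV. u $ k * cnj (u $ l) * (d_z k (d_zbar l f) z + d_zbar l (d_z k f) z)) / 2)"
proof -
  have r1: "of_real r *s u = r *\<^sub>R u" "(\<i> * of_real r) *s u = r *\<^sub>R (\<i> *s u)" for r
    by (simp_all add: vec_eq_iff scaleR_conv_of_real[where 'a = complex] mult_ac)
  define b where "b v = dir_deriv (\<lambda>y. dir_deriv f v y) v z" for v
  have d: "dir_deriv f v z = (\<Sum>k\<in>UNIV. v $ k * d_z k f z) + (\<Sum>k\<in>UNIV. cnj (v $ k) * d_zbar k f z)" for v
    using dir_deriv_wirtinger[OF C_2_onD(1)[OF assms(1,3)], of v] by (simp add: sum.distrib)
  have 1: "dir_deriv f u z = (\<Sum>k\<in>UNIV. u $ k * d_z k f z) + (\<Sum>k\<in>UNIV. cnj (u $ k) * d_zbar k f z)"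
    by (rule d)
  have 2: "dir_deriv f (\<i> *s u) z = \<i> * ((\<Sum>k\<in>UNIV. u $ k * d_z k f z) - (\<Sum>k\<in>UNIV. cnj (u $ k) * d_zbar k f z))"
    by (simp add: d sum_distrib_left sum_negf algebra_simps)
  have sw: "(\<Sum>k\<in>UNIV. \<Sum>l\<in>UNIV. cnj (u $ k) * u $ l * d_z l (d_zbar k f) z) =
     (\<Sum>k\<in>UNIV. \<Sum>l\<in>UNIV. u $ k * cnj (u $ l) * d_z k (d_zbar l f) z)"
    by (subst sum.swap) (simp add: mult_ac)
  have "b u + b (\<i> *s u) = (\<Sum>k\<in>UNIV. \<Sum>l\<in>UNIV. 2 * (u $ k * cnj (u $ l) * d_zbar l (d_z k f) z)
     + 2 * (cnj (u $ k) * u $ l * d_z l (d_zbar k f) z))"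
    unfolding b_def dir_deriv_twice[OF assms] sum.distrib[symmetric]
    by (intro sum.cong refl) (simp add: algebra_simps)
  also have "\<dots> = 2 * (\<Sum>k\<in>UNIV. \<Sum>l\<in>UNIV. u $ k * cnj (u $ l) * d_zbar l (d_z k f) z)
     + 2 * (\<Sum>k\<in>UNIV. \<Sum>l\<in>UNIV. cnj (u $ k) * u $ l * d_z l (d_zbar k f) z)"
    by (simp add: sum.distrib sum_distrib_left)
  also have "\<dots> = 4 * ((\<Sum>k\<in>UNIV. \<Sum>l\<in>UNIV. u $ k * cnj (u $ l) * (d_z k (d_zbar l f) z + d_zbar l (d_z k f) z)) / 2)"
    unfolding sw by (simp add: sum.distrib distrib_left)
  finally show ?thesis
    unfolding wjet_def r1 1[symmetric] 2[symmetric]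
    using jet2_line[OF assms, folded b_def]
    by (intro exI[of _ "b u"] exI[of _ "b (\<i> *s u)"] conjI)
qed

section \<open>Curves adapted to the Chern connection\<close>

text \<open>Conjugation makes \<open>H *v cvec v\<close> the covector dual to \<open>v\<close>, that
  is, x \<mapsto> \<open>cform H x v\<close>.\<close>

definition cvec :: "complex ^ 'n \<Rightarrow> complex ^ 'n" where
  "cvec v = (\<chi> k. cnj (v $ k))"

lemma cvec_nth [simp]: "cvec v $ k = cnj (v $ k)"
  by (simp add: cvec_def)

lemma cvec_cvec [simp]: "cvec (cvec v) = v"
  by (simp add: vec_eq_iff)

lemma cform_eq: "cform M v w = (\<Sum>i\<in>UNIV. v $ i * (M *v cvec w) $ i)"
  by (simp add: cform_def matrix_vector_mult_def sum_distrib_left mult_ac)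

lemma cform_eq_transpose: "cform M v w = (\<Sum>j\<in>UNIV. (transpose M *v v) $ j * cnj (w $ j))"
  unfolding cform_def
  by (subst sum.swap) (simp add: matrix_vector_mult_def transpose_def sum_distrib_right)

lemma cform_matrix_mult: "cform (M ** N) v w = cform N (transpose M *v v) w"
  by (simp only: cform_eq_transpose matrix_transpose_mul matrix_vector_mul_assoc)

lemma cform_minus_left: "cform M (- v) w = - cform M v w"
  by (simp add: cform_def sum_negf)

definition hol_part :: "(complex ^ 'n \<Rightarrow> complex ^ 'n ^ 'n) \<Rightarrow> complex ^ 'n \<Rightarrow> complex ^ 'n \<Rightarrow> complex ^ 'n ^ 'n" where
  "hol_part g z u = (\<chi> i j. \<Sum>k\<in>UNIV. u $ k * d_z k (\<lambda>w. g w $ i $ j) z)"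

definition antihol_part :: "(complex ^ 'n \<Rightarrow> complex ^ 'n ^ 'n) \<Rightarrow> complex ^ 'n \<Rightarrow> complex ^ 'n \<Rightarrow> complex ^ 'n ^ 'n" where
  "antihol_part g z u = (\<chi> i j. \<Sum>k\<in>UNIV. cnj (u $ k) * d_zbar k (\<lambda>w. g w $ i $ j) z)"

definition levi_part :: "(complex ^ 'n \<Rightarrow> complex ^ 'n ^ 'n) \<Rightarrow> complex ^ 'n \<Rightarrow> complex ^ 'n \<Rightarrow> complex ^ 'n ^ 'n" where
  "levi_part g z u = (\<chi> i j. (\<Sum>k\<in>UNIV. \<Sum>l\<in>UNIV. u $ k * cnj (u $ l) *
     (d_z k (d_zbar l (\<lambda>w. g w $ i $ j)) z + d_zbar l (d_z k (\<lambda>w. g w $ i $ j)) z)) / 2)"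

text \<open>The curvature \<Theta>(u, ubar, a, abar). The real part makes it a real number before
  any symmetry of the mixed derivatives is known.\<close>

definition chern_form :: "(complex ^ 'n \<Rightarrow> complex ^ 'n ^ 'n) \<Rightarrow> complex ^ 'n \<Rightarrow> complex ^ 'n \<Rightarrow> complex ^ 'n \<Rightarrow> real" where
  "chern_form g z u a = Re (\<Sum>i\<in>UNIV. \<Sum>j\<in>UNIV. \<Sum>k\<in>UNIV. \<Sum>l\<in>UNIV.
     u $ k * cnj (u $ l) * chern_curvature g z k l i j * (a $ i * cnj (a $ j)))"

text \<open>The frame runs through the directions of differentiation, not through the pair to which
  the curvature endomorphism is applied; this is why the second Ricci-Chern curvature appears and no
  other trace.\<close>

lemma sum_chern_form:
  fixes g :: "complex ^ 'n::finite \<Rightarrow> complex ^ 'n ^ 'n"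
  assumes "unitary_frame (g z) e"
  shows "(\<Sum>m\<in>UNIV. chern_form g z (e m) a) = herm_form (second_ricci g z) a"
proof -
  let ?t = "\<lambda>k l i j. chern_curvature g z k l i j * (a $ i * cnj (a $ j))"
  have "(\<Sum>m\<in>UNIV. chern_form g z (e m) a) =
     Re (\<Sum>m\<in>UNIV. \<Sum>i\<in>UNIV. \<Sum>j\<in>UNIV. \<Sum>k\<in>UNIV. \<Sum>l\<in>UNIV. (e m $ k * cnj (e m $ l)) * ?t k l i j)"
    by (simp add: chern_form_def mult.assoc)
  also have "(\<Sum>m\<in>UNIV. \<Sum>i\<in>UNIV. \<Sum>j\<in>UNIV. \<Sum>k\<in>UNIV. \<Sum>l\<in>UNIV. (e m $ k * cnj (e m $ l)) * ?t k l i j) =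
     (\<Sum>i\<in>UNIV. \<Sum>j\<in>UNIV. \<Sum>k\<in>UNIV. \<Sum>l\<in>UNIV. \<Sum>m\<in>UNIV. (e m $ k * cnj (e m $ l)) * ?t k l i j)"
    by (subst sum.swap, rule sum.cong[OF refl], subst sum.swap, rule sum.cong[OF refl],
        subst sum.swap, rule sum.cong[OF refl], rule sum.swap)
  also have "\<dots> = (\<Sum>i\<in>UNIV. \<Sum>j\<in>UNIV. \<Sum>k\<in>UNIV. \<Sum>l\<in>UNIV. inv_metric (g z) k l * ?t k l i j)"
    by (simp only: sum_distrib_right[symmetric] unitary_frame_inv_metric(1)[OF assms])
  also have "Re \<dots> = herm_form (second_ricci g z) a"
    by (simp add: herm_form_def second_ricci_def sum_distrib_right mult.assoc)
  finally show ?thesis .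
qed

text \<open>One coordinate domain with its metric. Class C^2 is asked for, as all local arguments
  are of second order.\<close>

locale hermitian_patch =
  fixes U :: "(complex ^ 'n::finite) set" and g :: "complex ^ 'n \<Rightarrow> complex ^ 'n ^ 'n"
  assumes open_U: "open U"
    and C2: "C_k_on 2 U (\<lambda>w. g w $ i $ j)"
    and herm: "z \<in> U \<Longrightarrow> hermitian_mat (g z)"
    and pos: "z \<in> U \<Longrightarrow> pos_mat (g z)"
begin

lemma wjet_metric:
  assumes "z \<in> U"
  shows "wjet (\<lambda>t. g (z + t *s u) $ i $ j) (hol_part g z u $ i $ j) (antihol_part g z u $ i $ j)
    (levi_part g z u $ i $ j)"
  using wjet_line[OF C2[of i j] open_U assms, of u] by (simp add: hol_part_def antihol_part_def levi_part_def)

lemma metric_cnj: "z \<in> U \<Longrightarrow> g z $ j $ i = cnj (g z $ i $ j)"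
  using herm unfolding hermitian_mat_def by blast

lemma d_zbar_metric:
  assumes "z \<in> U"
  shows "d_zbar k (\<lambda>w. g w $ i $ j) z = cnj (d_z k (\<lambda>w. g w $ j $ i) z)"
proof -
  have "d_zbar k (\<lambda>w. g w $ i $ j) z = d_zbar k (\<lambda>w. cnj (g w $ j $ i)) z"
    by (rule d_z_cong_open(2)[OF C_2_onD(1)[OF C2 assms] open_U assms]) (rule metric_cnj)
  then show ?thesis using d_zbar_cnj[OF C_2_onD(1)[OF C2 assms]] by metis
qed

lemma antihol_part_eq:
  assumes "z \<in> U"
  shows "antihol_part g z u $ i $ j = cnj (hol_part g z u $ j $ i)"
  by (simp add: antihol_part_def hol_part_def d_zbar_metric[OF assms])

lemma d_zbar_d_z_metric:
  assumes "z \<in> U"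
  shows "d_zbar l (d_z k (\<lambda>w. g w $ i $ j)) z = cnj (d_z l (d_zbar k (\<lambda>w. g w $ j $ i)) z)"
proof -
  have "d_z k (\<lambda>w. g w $ i $ j) y = cnj (d_zbar k (\<lambda>w. g w $ j $ i) y)" if "y \<in> U" for y
    using d_zbar_metric[OF that, of k j i] by simp
  then have "d_zbar l (d_z k (\<lambda>w. g w $ i $ j)) z = d_zbar l (\<lambda>y. cnj (d_zbar k (\<lambda>w. g w $ j $ i) y)) z"
    by (intro d_z_cong_open(2)[OF C_2_on_wirtinger(1)[OF C2 assms] open_U assms])
  then show ?thesis using d_zbar_cnj[OF C_2_on_wirtinger(2)[OF C2 assms]] by metis
qed

text \<open>Conjugation exchanges the two orders of differentiation and transposes \<open>g\<close>,
  so both halves of \<open>levi_part\<close> have the same real part. This takes the place of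
  commuting mixed derivatives.\<close>

lemma Re_cform_levi_part:
  assumes "z \<in> U"
  shows "Re (cform (levi_part g z u) a a) = Re (\<Sum>i\<in>UNIV. \<Sum>j\<in>UNIV. \<Sum>k\<in>UNIV. \<Sum>l\<in>UNIV.
     u $ k * cnj (u $ l) * d_z k (d_zbar l (\<lambda>w. g w $ i $ j)) z * (a $ i * cnj (a $ j)))"
proof -
  define P where "P = (\<Sum>i\<in>UNIV. \<Sum>j\<in>UNIV. \<Sum>k\<in>UNIV. \<Sum>l\<in>UNIV.
     u $ k * cnj (u $ l) * d_z k (d_zbar l (\<lambda>w. g w $ i $ j)) z * (a $ i * cnj (a $ j)))"
  define P' where "P' = (\<Sum>i\<in>UNIV. \<Sum>j\<in>UNIV. \<Sum>k\<in>UNIV. \<Sum>l\<in>UNIV.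
     u $ k * cnj (u $ l) * d_zbar l (d_z k (\<lambda>w. g w $ i $ j)) z * (a $ i * cnj (a $ j)))"
  have "2 * cform (levi_part g z u) a a = (\<Sum>i\<in>UNIV. \<Sum>j\<in>UNIV. \<Sum>k\<in>UNIV. \<Sum>l\<in>UNIV.
     u $ k * cnj (u $ l) * (d_z k (d_zbar l (\<lambda>w. g w $ i $ j)) z + d_zbar l (d_z k (\<lambda>w. g w $ i $ j)) z)
       * (a $ i * cnj (a $ j)))"
    unfolding cform_def sum_distrib_left
    by (intro sum.cong refl) (simp add: levi_part_def flip: sum_distrib_right)
  also have "\<dots> = P + P'"
    by (simp add: P_def P'_def distrib_left distrib_right sum.distrib)
  finally have 1: "2 * cform (levi_part g z u) a a = P + P'" .
  have "cnj P' = (\<Sum>i\<in>UNIV. \<Sum>j\<in>UNIV. \<Sum>k\<in>UNIV. \<Sum>l\<in>UNIV.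
     u $ l * cnj (u $ k) * d_z l (d_zbar k (\<lambda>w. g w $ j $ i)) z * (a $ j * cnj (a $ i)))"
    unfolding P'_def by (simp add: d_zbar_d_z_metric[OF assms] mult_ac)
  also have "\<dots> = (\<Sum>j\<in>UNIV. \<Sum>i\<in>UNIV. \<Sum>l\<in>UNIV. \<Sum>k\<in>UNIV.
     u $ l * cnj (u $ k) * d_z l (d_zbar k (\<lambda>w. g w $ j $ i)) z * (a $ j * cnj (a $ i)))"
    by (rule trans[OF sum.swap], rule sum.cong[OF refl], rule sum.cong[OF refl], rule sum.swap)
  finally have "cnj P' = P" by (simp add: P_def)
  then have "Re P' = Re P" by (metis cnj.simps(1))
  with arg_cong[OF 1, of Re] show ?thesis by (simp add: P_def)
qed

text \<open>The quadratic term of the curvature regroups into a product of three matrices, which is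
  the shape in which the adapted curves below produce it.\<close>

lemma chern_form_eq:
  assumes "z \<in> U"
  shows "chern_form g z u a = - Re (cform (levi_part g z u) a a)
     + Re (cform (hol_part g z u ** matrix_inv (g z) ** antihol_part g z u) a a)"
proof -
  define P where "P = (\<Sum>i\<in>UNIV. \<Sum>j\<in>UNIV. \<Sum>k\<in>UNIV. \<Sum>l\<in>UNIV.
     u $ k * cnj (u $ l) * d_z k (d_zbar l (\<lambda>w. g w $ i $ j)) z * (a $ i * cnj (a $ j)))"
  define G where "G i j = (\<Sum>k\<in>UNIV. \<Sum>l\<in>UNIV. u $ k * cnj (u $ l) *
     (\<Sum>p\<in>UNIV. \<Sum>q\<in>UNIV. inv_metric (g z) p q * d_zbar l (\<lambda>w. g w $ p $ j) z * d_z k (\<lambda>w. g w $ i $ q) z))" for i j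
  have G: "G i j = (hol_part g z u ** matrix_inv (g z) ** antihol_part g z u) $ i $ j" for i j
  proof -
    let ?s = "\<lambda>p q k l. u $ k * d_z k (\<lambda>w. g w $ i $ q) z * matrix_inv (g z) $ q $ p * (cnj (u $ l) * d_zbar l (\<lambda>w. g w $ p $ j) z)"
    have "G i j = (\<Sum>k\<in>UNIV. \<Sum>l\<in>UNIV. \<Sum>p\<in>UNIV. \<Sum>q\<in>UNIV. ?s p q k l)"
      unfolding G_def inv_metric_def sum_distrib_left by (intro sum.cong refl) (simp add: mult_ac)
    also have "\<dots> = (\<Sum>k\<in>UNIV. \<Sum>p\<in>UNIV. \<Sum>l\<in>UNIV. \<Sum>q\<in>UNIV. ?s p q k l)"
      by (rule sum.cong[OF refl], rule sum.swap)
    also have "\<dots> = (\<Sum>p\<in>UNIV. \<Sum>k\<in>UNIV. \<Sum>l\<in>UNIV. \<Sum>q\<in>UNIV. ?s p q k l)"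
      by (rule sum.swap)
    also have "\<dots> = (\<Sum>p\<in>UNIV. \<Sum>k\<in>UNIV. \<Sum>q\<in>UNIV. \<Sum>l\<in>UNIV. ?s p q k l)"
      by (rule sum.cong[OF refl], rule sum.cong[OF refl], rule sum.swap)
    also have "\<dots> = (\<Sum>p\<in>UNIV. \<Sum>q\<in>UNIV. \<Sum>k\<in>UNIV. \<Sum>l\<in>UNIV. ?s p q k l)"
      by (rule sum.cong[OF refl], rule sum.swap)
    also have "\<dots> = (\<Sum>p\<in>UNIV. (\<Sum>q\<in>UNIV. (\<Sum>k\<in>UNIV. u $ k * d_z k (\<lambda>w. g w $ i $ q) z) * matrix_inv (g z) $ q $ p)
        * (\<Sum>l\<in>UNIV. cnj (u $ l) * d_zbar l (\<lambda>w. g w $ p $ j) z))"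
      by (simp only: sum_distrib_left[symmetric] sum_distrib_right[symmetric])
    also have "\<dots> = (hol_part g z u ** matrix_inv (g z) ** antihol_part g z u) $ i $ j"
      by (simp add: matrix_matrix_mult_def hol_part_def antihol_part_def)
    finally show ?thesis .
  qed
  have "(\<Sum>i\<in>UNIV. \<Sum>j\<in>UNIV. \<Sum>k\<in>UNIV. \<Sum>l\<in>UNIV.
       u $ k * cnj (u $ l) * chern_curvature g z k l i j * (a $ i * cnj (a $ j))) =
     - P + (\<Sum>i\<in>UNIV. \<Sum>j\<in>UNIV. G i j * (a $ i * cnj (a $ j)))"
    unfolding P_def G_def chern_curvature_def
    by (simp only: distrib_left distrib_right sum.distrib sum_negf[symmetric] sum_distrib_right)
      (simp add: sum_negf)
  also have "(\<Sum>i\<in>UNIV. \<Sum>j\<in>UNIV. G i j * (a $ i * cnj (a $ j))) =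
      cform (hol_part g z u ** matrix_inv (g z) ** antihol_part g z u) a a"
    by (simp add: cform_def G mult.assoc)
  finally show ?thesis
    using Re_cform_levi_part[OF assms, of u a] by (simp add: chern_form_def P_def)
qed

lemma matrix_inv_metric:
  assumes "z \<in> U"
  shows "matrix_inv (g z) ** g z = mat 1" "g z ** matrix_inv (g z) = mat 1"
  using exists_unitary_frame[OF herm[OF assms] pos[OF assms]] unitary_frame_inv_metric by metis+

end

text \<open>A curve of vectors through \<open>a\<close> over the complex line \<open>t \<mapsto> z + t u\<close> whose image under \<open>Q\<close> is
  holomorphic to second order, and whose squared length has a critical point with
  \<open>\<partial>\<partial>bar\<close>-derivative \<open>\<kappa>\<close>.\<close>

definition adapted_curve :: "(complex ^ 'n ^ 'n \<Rightarrow> complex ^ 'n \<Rightarrow> complex ^ 'n) \<Rightarrow>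
    (complex ^ 'n \<Rightarrow> complex ^ 'n ^ 'n) \<Rightarrow> complex ^ 'n \<Rightarrow> complex ^ 'n \<Rightarrow> complex ^ 'n \<Rightarrow> real \<Rightarrow>
    (complex \<Rightarrow> complex ^ 'n) \<Rightarrow> bool" where
  "adapted_curve Q g z u a \<kappa> w \<longleftrightarrow> w 0 = a \<and>
     (\<forall>k. \<exists>\<alpha>. wjet (\<lambda>t. Q (g (z + t *s u)) (w t) $ k) \<alpha> 0 0) \<and>
     (\<exists>\<mu>. wjet (\<lambda>t. cform (g (z + t *s u)) (w t) (w t)) 0 0 \<mu> \<and> Re \<mu> = \<kappa>)"

context hermitian_patch
begin

text \<open>The curve is affine, \<open>a + t b\<close>, with \<open>b\<close> chosen so that its
  Chern covariant derivative along \<open>u\<close> vanishes at \<open>z\<close>. Then the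
  \<partial>\<partial>bar-derivative of the squared length reduces to
  \<open>cform L a a + cform B b a\<close>, whose real part is minus the curvature.\<close>

lemma adapted_curve_vector:
  assumes z: "z \<in> U"
  shows "\<exists>w. adapted_curve (\<lambda>H v. v) g z u a (- chern_form g z u a) w"
proof -
  define H A B L K where "H = g z" and "A = hol_part g z u" and "B = antihol_part g z u"
    and "L = levi_part g z u" and "K = matrix_inv (g z)"
  define b where "b = - (transpose (A ** K) *v a)"
  define w where "w t = (\<chi> k. a $ k + b $ k * t)" for t :: complex
  have jw: "wjet (\<lambda>t. w t $ k) (b $ k) 0 0" for k
    using wjet_add[OF wjet_const[of "a $ k"] wjet_cmult[OF wjet_ident, of "b $ k"]] by (simp add: w_def)
  have jH: "wjet (\<lambda>t. g (z + t *s u) $ i $ j) (A $ i $ j) (B $ i $ j) (L $ i $ j)" for i j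
    unfolding A_def B_def L_def by (rule wjet_metric[OF z])
  have w0: "w 0 $ k = a $ k" for k by (simp add: w_def)
  have KH: "K ** H = mat 1" using matrix_inv_metric[OF z] by (simp add: K_def H_def)
  have "transpose H *v b = - (transpose (A ** (K ** H)) *v a)"
    by (simp only: b_def matrix_transpose_mul matrix_vector_mul_assoc matrix_mul_assoc vec.neg)
  then have Hb: "transpose H *v b = - (transpose A *v a)" by (simp only: KH matrix_mul_rid)
  have tr: "(transpose M *v x) $ j = (\<Sum>i\<in>UNIV. M $ i $ j * x $ i)" for M :: "complex ^ 'n ^ 'n" and x j
    by (simp only: matrix_vector_mult_def transpose_def vec_lambda_beta)
  \<comment> \<open>The vanishing of the covariant derivative, lowered by the metric. It removes the
    \<partial>-derivative of the squared length and, in its \<partial>\<partial>bar-derivative, all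
    terms paired with the conjugate of \<open>b\<close>.\<close>
  have crit: "(\<Sum>i\<in>UNIV. H $ i $ j * b $ i + A $ i $ j * a $ i) = 0" for j
    using arg_cong[OF Hb, of "\<lambda>x. x $ j"]
    by (simp only: tr sum.distrib vector_uminus_component) simp
  have "wjet (\<lambda>t. \<Sum>j\<in>UNIV. \<Sum>i\<in>UNIV. g (z + t *s u) $ i $ j * w t $ i * cnj (w t $ j))
     (\<Sum>j\<in>UNIV. \<Sum>i\<in>UNIV. (H $ i $ j * b $ i + A $ i $ j * a $ i) * cnj (a $ j))
     (\<Sum>j\<in>UNIV. \<Sum>i\<in>UNIV. H $ i $ j * a $ i * cnj (b $ j) + B $ i $ j * a $ i * cnj (a $ j))
     (\<Sum>j\<in>UNIV. \<Sum>i\<in>UNIV. (H $ i $ j * b $ i + A $ i $ j * a $ i) * cnj (b $ j)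
        + (L $ i $ j * a $ i + B $ i $ j * b $ i) * cnj (a $ j))"
    (is "wjet ?f ?\<alpha> ?\<beta> ?\<mu>")
  proof (intro wjet_sum)
    fix i j
    show "wjet (\<lambda>t. g (z + t *s u) $ i $ j * w t $ i * cnj (w t $ j))
       ((H $ i $ j * b $ i + A $ i $ j * a $ i) * cnj (a $ j))
       (H $ i $ j * a $ i * cnj (b $ j) + B $ i $ j * a $ i * cnj (a $ j))
       ((H $ i $ j * b $ i + A $ i $ j * a $ i) * cnj (b $ j)
        + (L $ i $ j * a $ i + B $ i $ j * b $ i) * cnj (a $ j))"
      using wjet_mult[OF wjet_mult[OF jH[of i j] jw[of i]] wjet_cnj[OF jw[of j]]]
      by (simp add: w0 H_def algebra_simps)
  qed
  moreover have "?f = (\<lambda>t. cform (g (z + t *s u)) (w t) (w t))"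
    unfolding cform_def by (subst sum.swap) simp
  moreover have \<alpha>: "?\<alpha> = 0" by (simp add: sum_distrib_right[symmetric] crit)
  moreover have "?\<beta> = 0"
  proof -
    have cH: "cnj (H $ i $ j) = H $ j $ i" for i j
      using metric_cnj[OF z, of j i] by (simp add: H_def)
    have cA: "cnj (A $ i $ j) = B $ j $ i" for i j
      using antihol_part_eq[OF z, of u j i] by (simp add: A_def B_def)
    have "cnj ?\<alpha> = (\<Sum>j\<in>UNIV. \<Sum>i\<in>UNIV. H $ j $ i * a $ j * cnj (b $ i) + B $ j $ i * a $ j * cnj (a $ i))"
      by (simp add: cH cA algebra_simps)
    also have "\<dots> = ?\<beta>" by (rule sum.swap)
    finally show ?thesis using \<alpha> by simp
  qed
  moreover have "?\<mu> = cform L a a + cform B b a"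
  proof -
    have "?\<mu> = (\<Sum>j\<in>UNIV. \<Sum>i\<in>UNIV. (H $ i $ j * b $ i + A $ i $ j * a $ i) * cnj (b $ j))
       + (\<Sum>j\<in>UNIV. \<Sum>i\<in>UNIV. (L $ i $ j * a $ i + B $ i $ j * b $ i) * cnj (a $ j))"
      by (simp only: sum.distrib)
    also have "(\<Sum>j\<in>UNIV. \<Sum>i\<in>UNIV. (H $ i $ j * b $ i + A $ i $ j * a $ i) * cnj (b $ j)) = 0"
      by (simp add: sum_distrib_right[symmetric] crit)
    also have "(\<Sum>j\<in>UNIV. \<Sum>i\<in>UNIV. (L $ i $ j * a $ i + B $ i $ j * b $ i) * cnj (a $ j)) = cform L a a + cform B b a"
      unfolding cform_def by (subst sum.swap) (simp add: sum.distrib distrib_right)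
    finally show ?thesis by simp
  qed
  moreover have "Re (cform L a a + cform B b a) = - chern_form g z u a"
    unfolding chern_form_eq[OF z] cform_matrix_mult b_def
    by (simp add: A_def B_def K_def L_def cform_minus_left)
  ultimately have 1: "wjet (\<lambda>t. cform (g (z + t *s u)) (w t) (w t)) 0 0 (cform L a a + cform B b a)"
    and 2: "Re (cform L a a + cform B b a) = - chern_form g z u a" by simp_all
  have 3: "w 0 = a" by (simp add: vec_eq_iff w0)
  have 4: "\<forall>k. \<exists>\<alpha>. wjet (\<lambda>t. w t $ k) \<alpha> 0 0" by (intro allI exI) (rule jw)
  show ?thesis
    unfolding adapted_curve_def
    by (intro exI[of _ w] conjI exI[of _ "cform L a a + cform B b a"]; fact)
qed

text \<open>Here the dual covector \<open>g *v y\<close> has to be holomorphic to second order: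
  \<open>c\<close> and \<open>d\<close> solve the linear equations that kill its \<partial>bar- and
  \<partial>\<partial>bar-derivatives. That \<open>y\<close> has no term linear in \<open>t\<close>
  says that the covariant derivative of the covector along \<open>u\<close> vanishes at
  \<open>z\<close>. In the squared length only \<open>d\<close> survives at second order, and it
  carries the curvature with the opposite sign.\<close>

lemma adapted_curve_covector:
  assumes z: "z \<in> U"
  shows "\<exists>w. adapted_curve (\<lambda>H v. H *v cvec v) g z u a (chern_form g z u a) w"
proof -
  define H A B L K where "H = g z" and "A = hol_part g z u" and "B = antihol_part g z u"
    and "L = levi_part g z u" and "K = matrix_inv (g z)"
  define c where "c = - (K *v (B *v cvec a))"
  define d where "d = - (K *v (A *v c + L *v cvec a))"
  \<comment> \<open>the 2-jet of the inverse metric applied to a covector; being a polynomial, it spares the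
    differentiation of the inverse matrix\<close>
  define y where "y t = (\<chi> k. cnj (a $ k) + c $ k * cnj t + d $ k * (t * cnj t))" for t :: complex
  have jy: "wjet (\<lambda>t. y t $ k) 0 (c $ k) (d $ k)" for k
  proof -
    have 1: "wjet (\<lambda>t. cnj t) 0 1 0" using wjet_cnj[OF wjet_ident] by simp
    have 2: "wjet (\<lambda>t. t * cnj t) 0 0 1" using wjet_mult[OF wjet_ident 1] by simp
    show ?thesis
      using wjet_add[OF wjet_add[OF wjet_const[of "cnj (a $ k)"] wjet_cmult[OF 1, of "c $ k"]]
          wjet_cmult[OF 2, of "d $ k"]] by (simp add: y_def)
  qed
  have jH: "wjet (\<lambda>t. g (z + t *s u) $ i $ j) (A $ i $ j) (B $ i $ j) (L $ i $ j)" for i j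
    unfolding A_def B_def L_def by (rule wjet_metric[OF z])
  have y0: "y 0 $ k = cnj (a $ k)" for k by (simp add: y_def)
  have HK: "H *v (K *v x) = x" for x
    using matrix_inv_metric[OF z] by (simp add: K_def H_def matrix_vector_mul_assoc)
  have Hc: "H *v c = - (B *v cvec a)"
    by (simp add: c_def vec.neg HK)
  have Hd: "H *v d = - (A *v c + L *v cvec a)"
    unfolding d_def by (simp add: vec.neg HK)
  have jQ: "wjet (\<lambda>t. (g (z + t *s u) *v y t) $ k) ((A *v cvec a) $ k) 0 0" for k
  proof -
    have "wjet (\<lambda>t. \<Sum>l\<in>UNIV. g (z + t *s u) $ k $ l * y t $ l)
       (\<Sum>l\<in>UNIV. A $ k $ l * cnj (a $ l))
       (\<Sum>l\<in>UNIV. H $ k $ l * c $ l + B $ k $ l * cnj (a $ l))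
       (\<Sum>l\<in>UNIV. H $ k $ l * d $ l + (A $ k $ l * c $ l + L $ k $ l * cnj (a $ l)))"
    proof (intro wjet_sum)
      fix l
      show "wjet (\<lambda>t. g (z + t *s u) $ k $ l * y t $ l) (A $ k $ l * cnj (a $ l))
         (H $ k $ l * c $ l + B $ k $ l * cnj (a $ l))
         (H $ k $ l * d $ l + (A $ k $ l * c $ l + L $ k $ l * cnj (a $ l)))"
        using wjet_mult[OF jH[of k l] jy[of l]] by (simp add: y0 H_def add.assoc)
    qed
    moreover have "(\<Sum>l\<in>UNIV. H $ k $ l * c $ l + B $ k $ l * cnj (a $ l)) = 0"
      using arg_cong[OF Hc, of "\<lambda>x. x $ k"] by (simp add: matrix_vector_mult_def sum.distrib)
    moreover have "(\<Sum>l\<in>UNIV. H $ k $ l * d $ l + (A $ k $ l * c $ l + L $ k $ l * cnj (a $ l))) = 0"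
      using arg_cong[OF Hd, of "\<lambda>x. x $ k"] by (simp add: matrix_vector_mult_def sum.distrib)
    ultimately show ?thesis by (simp add: matrix_vector_mult_def)
  qed
  define w where "w t = cvec (y t)" for t
  have cw: "cvec (w t) = y t" for t by (simp add: w_def)
  have w0: "w 0 = a" by (simp add: w_def vec_eq_iff y0)
  \<comment> \<open>Hermitian symmetry moves \<open>H\<close> onto \<open>c\<close> and
    \<open>d\<close>, where \<open>Hc\<close> and \<open>Hd\<close> evaluate it.\<close>
  have dual: "(\<Sum>k\<in>UNIV. cnj (x $ k) * (H *v cvec a) $ k) = cnj (\<Sum>l\<in>UNIV. a $ l * (H *v x) $ l)" for x
  proof -
    have "cnj (\<Sum>l\<in>UNIV. a $ l * (H *v x) $ l) = cnj (cform H a (cvec x))"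
      by (simp add: cform_eq)
    also have "\<dots> = cform H (cvec x) a" using cnj_cform[OF herm[OF z]] by (simp add: H_def)
    also have "\<dots> = (\<Sum>k\<in>UNIV. cnj (x $ k) * (H *v cvec a) $ k)" by (simp add: cform_eq)
    finally show ?thesis by simp
  qed
  have "wjet (\<lambda>t. \<Sum>k\<in>UNIV. w t $ k * (g (z + t *s u) *v y t) $ k)
     (\<Sum>k\<in>UNIV. a $ k * (A *v cvec a) $ k + cnj (c $ k) * (H *v cvec a) $ k) (\<Sum>k\<in>(UNIV :: 'n set). 0)
     (\<Sum>k\<in>UNIV. cnj (d $ k) * (H *v cvec a) $ k)" (is "wjet ?f ?\<alpha> ?\<beta> ?\<mu>")
  proof (intro wjet_sum)
    fix k
    have "y 0 = cvec a" by (simp add: vec_eq_iff y0)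
    then show "wjet (\<lambda>t. w t $ k * (g (z + t *s u) *v y t) $ k)
     (a $ k * (A *v cvec a) $ k + cnj (c $ k) * (H *v cvec a) $ k) 0
     (cnj (d $ k) * (H *v cvec a) $ k)"
      using wjet_mult[OF wjet_cnj[OF jy[of k]] jQ[of k]] by (simp add: w_def H_def)
  qed
  moreover have "?f = (\<lambda>t. cform (g (z + t *s u)) (w t) (w t))"
    by (simp add: cform_eq cw)
  moreover have "?\<alpha> = 0"
  proof -
    have "cnj (\<Sum>l\<in>UNIV. a $ l * (B *v cvec a) $ l) =
        (\<Sum>l\<in>UNIV. \<Sum>k\<in>UNIV. a $ k * (A $ k $ l * cnj (a $ l)))"
      using antihol_part_eq[OF z]
      by (simp add: matrix_vector_mult_def A_def B_def sum_distrib_left mult_ac)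
    also have "\<dots> = (\<Sum>k\<in>UNIV. a $ k * (A *v cvec a) $ k)"
      by (subst sum.swap) (simp add: matrix_vector_mult_def sum_distrib_left)
    finally show ?thesis
      by (simp add: sum.distrib dual Hc sum_negf)
  qed
  moreover have "Re ?\<mu> = chern_form g z u a"
  proof -
    have "cform (A ** K ** B) a a = - (\<Sum>l\<in>UNIV. a $ l * (A *v c) $ l)"
      by (simp add: cform_eq c_def vec.neg matrix_vector_mul_assoc[symmetric] sum_negf)
    moreover have "cform L a a = (\<Sum>l\<in>UNIV. a $ l * (L *v cvec a) $ l)" by (rule cform_eq)
    moreover have "Re ?\<mu> = - Re (\<Sum>l\<in>UNIV. a $ l * (A *v c) $ l) - Re (\<Sum>l\<in>UNIV. a $ l * (L *v cvec a) $ l)"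
      unfolding dual Hd by (simp add: distrib_left sum.distrib sum_negf sum_subtractf algebra_simps)
    ultimately show ?thesis
      unfolding chern_form_eq[OF z] by (simp add: A_def B_def K_def L_def)
  qed
  ultimately have 1: "wjet (\<lambda>t. cform (g (z + t *s u)) (w t) (w t)) 0 0 ?\<mu>"
    and 2: "Re ?\<mu> = chern_form g z u a"
    by simp_all
  have 3: "\<forall>k. \<exists>\<alpha>. wjet (\<lambda>t. (g (z + t *s u) *v cvec (w t)) $ k) \<alpha> 0 0"
    unfolding cw by (intro allI exI) (rule jQ)
  show ?thesis
    unfolding adapted_curve_def by (intro exI[of _ w] conjI exI[of _ ?\<mu>]; fact)
qed

end

section \<open>The Bochner inequality for the operator norm of a tensor\<close>

text \<open>Uniform continuity on a closed ball times \<open>K\<close> makes \<open>f z\<close> and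
  \<open>f z0\<close> uniformly close on \<open>K\<close>; evaluating each at the maximiser of the
  other compares the suprema.\<close>

lemma continuous_on_Sup_compact:
  fixes f :: "'a::heine_borel \<Rightarrow> 'b::metric_space \<Rightarrow> real"
  assumes U: "open U" and K: "compact K" "K \<noteq> {}"
    and cont: "continuous_on (U \<times> K) (\<lambda>x. f (fst x) (snd x))"
  shows "\<And>z. z \<in> U \<Longrightarrow> \<exists>v\<in>K. f z v = Sup (f z ` K)"
    and "\<And>z v. z \<in> U \<Longrightarrow> v \<in> K \<Longrightarrow> f z v \<le> Sup (f z ` K)"
    and "continuous_on U (\<lambda>z. Sup (f z ` K))"
proof -
  have max: "\<exists>v\<in>K. \<forall>w\<in>K. f z w \<le> f z v" if "z \<in> U" for z
  proof -
    have "continuous_on K (\<lambda>v. f (fst (z, v)) (snd (z, v)))"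
      using that by (intro continuous_on_compose2[OF cont] continuous_intros) auto
    then show ?thesis using continuous_attains_sup[OF K, of "f z"] by simp
  qed
  show att: "\<exists>v\<in>K. f z v = Sup (f z ` K)" if z: "z \<in> U" for z
  proof -
    obtain v where v: "v \<in> K" "\<And>w. w \<in> K \<Longrightarrow> f z w \<le> f z v" using max[OF z] by auto
    then have "Sup (f z ` K) = f z v" by (intro cSup_eq_maximum) auto
    with v show ?thesis by metis
  qed
  show le: "f z v \<le> Sup (f z ` K)" if "z \<in> U" "v \<in> K" for z v
  proof (rule cSup_upper)
    obtain v where "\<forall>w\<in>K. f z w \<le> f z v" using max[OF \<open>z \<in> U\<close>] by auto
    then show "bdd_above (f z ` K)" by (intro bdd_aboveI2[where M = "f z v"]) auto
  qed (use that in auto)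
  show "continuous_on U (\<lambda>z. Sup (f z ` K))"
    unfolding continuous_on_iff
  proof (intro ballI allI impI)
    fix z0 and \<epsilon> :: real assume z0: "z0 \<in> U" and \<epsilon>: "\<epsilon> > 0"
    obtain r where r: "r > 0" "cball z0 r \<subseteq> U" using U z0 open_contains_cball by blast
    have "uniformly_continuous_on (cball z0 r \<times> K) (\<lambda>x. f (fst x) (snd x))"
      using r K by (intro compact_uniformly_continuous continuous_on_subset[OF cont] compact_Times) auto
    then obtain d where d: "d > 0" "\<And>x x'. x \<in> cball z0 r \<times> K \<Longrightarrow> x' \<in> cball z0 r \<times> K \<Longrightarrow>
        dist x' x < d \<Longrightarrow> dist (f (fst x') (snd x')) (f (fst x) (snd x)) < \<epsilon>"
      unfolding uniformly_continuous_on_def using \<epsilon> by metis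
    show "\<exists>d>0. \<forall>z\<in>U. dist z z0 < d \<longrightarrow> dist (Sup (f z ` K)) (Sup (f z0 ` K)) < \<epsilon>"
    proof (intro exI[of _ "min d r"] conjI ballI impI)
      fix z assume z: "z \<in> U" "dist z z0 < min d r"
      have close: "\<bar>f z v - f z0 v\<bar> < \<epsilon>" if "v \<in> K" for v
        using d(2)[of "(z0, v)" "(z, v)"] z r that
        by (auto simp: dist_prod_def dist_real_def dist_commute)
      obtain v where v: "v \<in> K" "f z v = Sup (f z ` K)" using att[OF z(1)] by auto
      obtain v0 where v0: "v0 \<in> K" "f z0 v0 = Sup (f z0 ` K)" using att[OF z0] by auto
      show "dist (Sup (f z ` K)) (Sup (f z0 ` K)) < \<epsilon>"
        using close[OF v(1)] close[OF v0(1)] le[OF z0 v(1)] le[OF z(1) v0(1)] v v0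
        by (simp add: dist_real_def)
    qed (use d r in auto)
  qed
qed

text \<open>\<open>hol_on\<close> speaks of first derivatives only. On a complex line it becomes
  holomorphy in one variable, and Cauchy's theory supplies the second derivative.\<close>

lemma hol_on_wjet_line:
  fixes f :: "complex ^ 'n::finite \<Rightarrow> complex"
  assumes "hol_on U f" "open U" "z \<in> U"
  shows "\<exists>\<alpha>. wjet (\<lambda>t. f (z + t *s u)) \<alpha> 0 0"
proof -
  have bl: "bounded_linear (\<lambda>t::complex. t *s u)"
    unfolding linear_conv_bounded_linear[symmetric]
    by (intro linearI) (simp_all add: vec_eq_iff algebra_simps)
  define T where "T = (\<lambda>t. z + t *s u) -` U"
  have T: "open T" "0 \<in> T"
    using assms(2,3) unfolding T_def
    by (auto intro!: open_vimage continuous_intros bounded_linear.continuous_on[OF bl] simp: continuous_on_id)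
  have "(\<lambda>t. f (z + t *s u)) holomorphic_on T"
    unfolding holomorphic_on_def
  proof
    fix t assume t: "t \<in> T"
    then obtain f' where f': "(f has_derivative f') (at (z + t *s u))" "\<And>c v. f' (c *s v) = c * f' v"
      using assms(1) unfolding hol_on_def T_def by auto
    have "((\<lambda>t. z + t *s u) has_derivative (\<lambda>h. h *s u)) (at t)"
      using bounded_linear.has_derivative[OF bl has_derivative_ident]
      by (auto intro!: derivative_eq_intros)
    from diff_chain_at[OF this f'(1)] have "((\<lambda>t. f (z + t *s u)) has_derivative (\<lambda>h. h * f' u)) (at t)"
      by (simp add: o_def f'(2))
    moreover have "(\<lambda>h. h * f' u) = (*) (f' u)" by (simp add: fun_eq_iff)
    ultimately have "((\<lambda>t. f (z + t *s u)) has_field_derivative f' u) (at t)"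
      by (simp add: has_field_derivative_def)
    then show "(\<lambda>t. f (z + t *s u)) field_differentiable at t within T"
      unfolding field_differentiable_def by (blast intro: has_field_derivative_at_within)
  qed
  with T show ?thesis using wjet_holomorphic by blast
qed

lemma hol_on_continuous: "hol_on U f \<Longrightarrow> continuous_on U f"
  unfolding hol_on_def
  by (metis continuous_at_imp_continuous_on has_derivative_continuous)

section \<open>Evaluation of tensors on vectors and the operator norm\<close>

definition tensor_eval :: "nat \<Rightarrow> ('n::finite list \<Rightarrow> complex) \<Rightarrow> (nat \<Rightarrow> complex ^ 'n) \<Rightarrow> complex" where
  "tensor_eval p s v = (\<Sum>I | length I = p. s I * (\<Prod>m<p. v m $ (I ! m)))"

lemma finite_multi_indices: "finite {I :: 'n::finite list. length I = p}"
  using finite_lists_length_eq[of "UNIV :: 'n set" p] by simp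

lemma tensor_eval_scale:
  "tensor_eval p s (\<lambda>m. c m *s v m) = (\<Prod>m<p. c m) * tensor_eval p s v"
  unfolding tensor_eval_def sum_distrib_left
  by (intro sum.cong refl) (simp add: prod.distrib mult_ac)

lemma tensor_eval_cong: "(\<And>m. m < p \<Longrightarrow> v m = w m) \<Longrightarrow> tensor_eval p s v = tensor_eval p s w"
  unfolding tensor_eval_def by (intro sum.cong refl) (auto intro!: prod.cong)

lemma tensor_eval_zero_vector:
  assumes "m < p" "v m = 0"
  shows "tensor_eval p s v = 0"
  unfolding tensor_eval_def
proof (intro sum.neutral ballI)
  fix I
  have "(\<Prod>m<p. v m $ (I ! m)) = 0" using assms by (intro prod_zero bexI[of _ m]) auto
  then show "s I * (\<Prod>m<p. v m $ (I ! m)) = 0" by simp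
qed

text \<open>Infinite sequences, of which only the first \<open>p\<close> entries are read: one set
  serves every \<open>p\<close> and is compact by Tychonoff. The norm is Euclidean, so the set does
  not move with the base point.\<close>

definition unit_tuples :: "(nat \<Rightarrow> complex ^ 'n::finite) set" where
  "unit_tuples = {v. \<forall>m. norm (v m) = 1}"

lemma compact_unit_tuples: "compact (unit_tuples :: (nat \<Rightarrow> complex ^ 'n::finite) set)"
proof -
  have "compactin (product_topology (\<lambda>m. euclidean) (UNIV :: nat set)) (PiE UNIV (\<lambda>m. sphere (0 :: complex ^ 'n) 1))"
    by (simp add: compactin_PiE)
  moreover have "PiE UNIV (\<lambda>m. sphere 0 1) = (unit_tuples :: (nat \<Rightarrow> complex ^ 'n) set)"
    by (auto simp: unit_tuples_def PiE_UNIV_domain)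
  ultimately show ?thesis by (simp add: euclidean_product_topology)
qed

lemma unit_tuples_nonempty: "(unit_tuples :: (nat \<Rightarrow> complex ^ 'n::finite) set) \<noteq> {}"
proof -
  obtain x :: "complex ^ 'n" where "norm x = 1" using vector_choose_size[of 1] by auto
  then have "(\<lambda>m. x) \<in> unit_tuples" by (simp add: unit_tuples_def)
  then show ?thesis by blast
qed

text \<open>When \<open>Q\<close> is homogeneous over the reals, positive rescaling of the arguments
  leaves the quotient unchanged, so Euclidean unit vectors may stand for metric unit vectors. For
  \<open>p = 0\<close> it is the modulus of the single component.\<close>

definition tensor_ratio :: "nat \<Rightarrow> (complex ^ 'n::finite ^ 'n \<Rightarrow> complex ^ 'n \<Rightarrow> complex ^ 'n) \<Rightarrow>
    complex ^ 'n ^ 'n \<Rightarrow> ('n list \<Rightarrow> complex) \<Rightarrow> (nat \<Rightarrow> complex ^ 'n) \<Rightarrow> real" where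
  "tensor_ratio p Q H s v =
     cmod (tensor_eval p s (\<lambda>m. Q H (v m))) / (\<Prod>m<p. sqrt (herm_form H (v m)))"

definition tensor_norm :: "nat \<Rightarrow> (complex ^ 'n::finite ^ 'n \<Rightarrow> complex ^ 'n \<Rightarrow> complex ^ 'n) \<Rightarrow>
    complex ^ 'n ^ 'n \<Rightarrow> ('n list \<Rightarrow> complex) \<Rightarrow> real" where
  "tensor_norm p Q H s = Sup (tensor_ratio p Q H s ` unit_tuples)"

context hermitian_patch
begin

lemma g_entry_cont: "continuous_on U (\<lambda>z. g z $ i $ j)"
  using C_2_onD(1)[OF C2] by (intro continuous_at_imp_continuous_on ballI differentiable_imp_continuous_within)

lemma g_cont: "continuous_on U g"
proof -
  have "continuous_on U (\<lambda>z. \<chi> i j. g z $ i $ j)"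
    by (intro continuous_on_vec_lambda g_entry_cont)
  then show ?thesis by simp
qed

lemma herm_form_nonneg: "z \<in> U \<Longrightarrow> herm_form (g z) x \<ge> 0"
  using pos by (cases "x = 0") (auto simp: pos_mat_def herm_form_def less_imp_le)

end

text \<open>
  The map \<open>Q\<close> turns a tangent vector into an argument of the tensor: the identity for forms, and the
  dual covector for polyvectors, so that the metric itself measures the arguments in both cases.
  The sign \<open>\<sigma>\<close> is \<open>-1\<close> for forms and \<open>1\<close> for polyvectors.
\<close>

locale tensor_patch = hermitian_patch U g
  for U :: "(complex ^ 'n::finite) set" and g +
  fixes p :: nat and Q :: "complex ^ 'n ^ 'n \<Rightarrow> complex ^ 'n \<Rightarrow> complex ^ 'n" and \<sigma> :: real
    and s :: "complex ^ 'n \<Rightarrow> 'n list \<Rightarrow> complex"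
  assumes hol: "hol_on U (\<lambda>z. s z I)"
    and Q_scale: "Q H (of_real r *s v) = of_real r *s Q H v"
    and Q_cont: "continuous_on UNIV (\<lambda>x. Q (fst x) (snd x))"
    and adapted: "z \<in> U \<Longrightarrow> \<exists>w. adapted_curve Q g z u a (\<sigma> * chern_form g z u a) w"
begin

abbreviation ratio where "ratio z v \<equiv> tensor_ratio p Q (g z) (s z) v"
abbreviation N where "N z \<equiv> tensor_norm p Q (g z) (s z)"

lemma ratio_scale:
  assumes "\<And>m. r m > 0"
  shows "tensor_ratio p Q H s' (\<lambda>m. of_real (r m) *s v m) = tensor_ratio p Q H s' v"
proof -
  have pos: "(\<Prod>m<p. r m) > 0" using assms by (intro prod_pos) auto
  have "sqrt ((r m)\<^sup>2 * x) = r m * sqrt x" for m x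
    using assms[of m] by (simp add: real_sqrt_mult)
  then have 1: "(\<Prod>m<p. sqrt (herm_form H (of_real (r m) *s v m))) = (\<Prod>m<p. r m) * (\<Prod>m<p. sqrt (herm_form H (v m)))"
    by (simp add: herm_form_scale prod.distrib)
  have 2: "cmod (tensor_eval p s' (\<lambda>m. Q H (of_real (r m) *s v m))) =
      (\<Prod>m<p. r m) * cmod (tensor_eval p s' (\<lambda>m. Q H (v m)))"
    using pos by (simp add: Q_scale tensor_eval_scale norm_mult flip: of_real_prod)
  show ?thesis
    unfolding tensor_ratio_def 1 2 by (rule mult_divide_mult_cancel_left) (rule pos[THEN less_imp_neq, THEN not_sym])
qed

lemma ratio_cont: "continuous_on (U \<times> unit_tuples) (\<lambda>x. ratio (fst x) (snd x))"
proof -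
  let ?D = "U \<times> (unit_tuples :: (nat \<Rightarrow> complex ^ 'n) set)"
  have v: "continuous_on ?D (\<lambda>x. snd x m)" for m
    by (rule continuous_on_product_then_coordinatewise) (intro continuous_intros)
  have gc: "continuous_on ?D (\<lambda>x. g (fst x))"
    by (rule continuous_on_compose2[OF g_cont]) (auto intro!: continuous_intros)
  have Qc: "continuous_on ?D (\<lambda>x. Q (g (fst x)) (snd x m))" for m
    using continuous_on_compose2[OF Q_cont continuous_on_Pair[OF gc v[of m]]] by simp
  have sc: "continuous_on ?D (\<lambda>x. s (fst x) I)" for I
    by (rule continuous_on_compose2[OF hol_on_continuous[OF hol]]) (auto intro!: continuous_intros)
  have "(\<Prod>m<p. sqrt (herm_form (g z) (v m))) \<noteq> 0" if "(z, v) \<in> ?D" for z v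
  proof -
    have "herm_form (g z) (v m) > 0" for m
    proof -
      have "norm (v m) = 1" using that by (auto simp: unit_tuples_def)
      then have "v m \<noteq> 0" by auto
      then show ?thesis using pos[of z] that by (auto simp: pos_mat_def)
    qed
    then show ?thesis by (simp add: less_imp_neq[symmetric])
  qed
  then show ?thesis
    unfolding tensor_ratio_def tensor_eval_def
    by (intro continuous_on_divide continuous_on_norm continuous_on_sum continuous_on_mult
        continuous_on_prod sc continuous_on_real_sqrt continuous_on_component[OF Qc])
      (auto simp: herm_form_def intro!: continuous_intros continuous_on_component[OF gc] continuous_on_component[OF v]
        continuous_on_component[OF continuous_on_component[OF gc]])
qed

lemmas Sup_ratio = continuous_on_Sup_compact[OF open_U compact_unit_tuples unit_tuples_nonempty ratio_cont,
    folded tensor_norm_def]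

lemma ratio_le:
  assumes z: "z \<in> U" and v: "\<And>m. v m \<noteq> 0"
  shows "ratio z v \<le> N z"
proof -
  have "ratio z v = ratio z (\<lambda>m. of_real (1 / norm (v m)) *s v m)"
    by (rule ratio_scale[symmetric]) (use v in auto)
  moreover have "(\<lambda>m. complex_of_real (1 / norm (v m)) *s v m) \<in> unit_tuples"
  proof -
    have nr: "norm (complex_of_real r *s x) = \<bar>r\<bar> * norm x" for r and x :: "complex ^ 'n"
    proof -
      have "complex_of_real r *s x = r *\<^sub>R x" 
        by (simp add: vec_eq_iff scaleR_conv_of_real[where 'a = complex])
      then show ?thesis by simp
    qed
    have "norm (complex_of_real (1 / norm (v m)) *s v m) = 1" for m
      unfolding nr using v[of m] by simp
    then show ?thesis unfolding unit_tuples_def by blast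
  qed
  ultimately show ?thesis using Sup_ratio(2)[OF z] by metis
qed

lemma ratio_nonneg: "z \<in> U \<Longrightarrow> ratio z v \<ge> 0"
proof -
  assume z: "z \<in> U"
  then show ?thesis using herm_form_nonneg by (simp add: tensor_ratio_def prod_nonneg)
qed

lemma N_nonneg: "z \<in> U \<Longrightarrow> N z \<ge> 0"
  using Sup_ratio(1) ratio_nonneg by metis

lemma tensor_eval_le:
  assumes z: "z \<in> U"
  shows "cmod (tensor_eval p (s z) (\<lambda>m. Q (g z) (v m))) \<le> N z * (\<Prod>m<p. sqrt (herm_form (g z) (v m)))"
proof (cases "\<exists>m<p. v m = 0")
  case True
  then obtain m where m: "m < p" "v m = 0" by blast
  have "Q (g z) (v m) = 0" using Q_scale[of "g z" 0 "v m"] m by simp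
  from tensor_eval_zero_vector[OF m(1), of "\<lambda>m. Q (g z) (v m)"] this
  have "tensor_eval p (s z) (\<lambda>m. Q (g z) (v m)) = 0" by simp
  then show ?thesis using N_nonneg[OF z] herm_form_nonneg[OF z] by (simp add: prod_nonneg)
next
  case False
  obtain x :: "complex ^ 'n" where "norm x = 1" using vector_choose_size[of 1] by auto
  then have x: "x \<noteq> 0" by auto
  \<comment> \<open>\<open>ratio_le\<close> asks for nonzero vectors at all positions; those from
    \<open>p\<close> on are filled with \<open>x\<close> and do not influence the ratio.\<close>
  define v' where "v' m = (if m < p then v m else x)" for m
  have "v' m \<noteq> 0" for m using False x by (auto simp: v'_def)
  then have "ratio z v' \<le> N z" by (rule ratio_le[OF z])
  moreover have "ratio z v' = ratio z v"
    unfolding tensor_ratio_def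
    by (intro arg_cong2[where f = "(/)"] arg_cong[where f = cmod] tensor_eval_cong prod.cong)
      (auto simp: v'_def)
  moreover have "(\<Prod>m<p. sqrt (herm_form (g z) (v m))) > 0"
    using False pos[OF z] by (intro prod_pos) (auto simp: pos_mat_def)
  ultimately show ?thesis
    by (simp add: tensor_ratio_def[of _ _ _ _ v] pos_divide_le_eq)
qed

lemma N_attained:
  assumes z: "z \<in> U"
  obtains a where "\<And>m. herm_form (g z) (a m) = 1"
    "N z = cmod (tensor_eval p (s z) (\<lambda>m. Q (g z) (a m)))"
proof -
  obtain v where v: "v \<in> unit_tuples" "ratio z v = N z" using Sup_ratio(1)[OF z] by blast
  have "norm (v m) = 1" for m using v(1) by (simp add: unit_tuples_def)
  then have "v m \<noteq> 0" for m by (metis norm_zero zero_neq_one)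
  then have hv: "herm_form (g z) (v m) > 0" for m using pos[OF z] by (simp add: pos_mat_def)
  define a where "a m = of_real (1 / sqrt (herm_form (g z) (v m))) *s v m" for m
  have a1: "herm_form (g z) (a m) = 1" for m
    using hv[of m] by (simp add: a_def herm_form_scale norm_divide power_divide)
  have "ratio z a = N z"
    unfolding a_def v(2)[symmetric] by (rule ratio_scale) (use hv in auto)
  then have "N z = cmod (tensor_eval p (s z) (\<lambda>m. Q (g z) (a m)))"
    by (simp add: tensor_ratio_def a1)
  with a1 show thesis by (rule that)
qed

text \<open>The Bochner inequality for \<open>N\<close> in the viscosity sense: a test function that touches
  \<open>C - N\<close> from below is compared, along a complex line, with the product of the lengths of adapted
  curves; the square roots are replaced by \<open>(1 + D) / 2\<close>, which has the same 2-jet at \<open>D = 1\<close>.\<close>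

lemma bochner_line:
  assumes z: "z \<in> U" and touch: "\<forall>\<^sub>F w in nhds z. N w + v w \<le> N z + v z"
    and jv: "wjet (\<lambda>t. of_real (v (z + t *s u))) \<alpha> \<beta> \<mu>"
    and a: "\<And>m. herm_form (g z) (a m) = 1" 
    and Na: "N z = cmod (tensor_eval p (s z) (\<lambda>m. Q (g z) (a m)))"
  shows "Re \<mu> \<le> N z / 2 * (\<sigma> * (\<Sum>i<p. chern_form g z u (a i)))"
proof -
  have "\<forall>i. \<exists>w. adapted_curve Q g z u (a i) (\<sigma> * chern_form g z u (a i)) w"
    using adapted[OF z] by blast
  then obtain w where w: "\<And>i. adapted_curve Q g z u (a i) (\<sigma> * chern_form g z u (a i)) (w i)"
    by metis
  define D where "D i t = cform (g (z + t *s u)) (w i t) (w i t)" for i t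
  have w0: "w i 0 = a i" for i using w by (simp add: adapted_curve_def)
  have "\<forall>i. \<exists>\<mu>. wjet (D i) 0 0 \<mu> \<and> Re \<mu> = \<sigma> * chern_form g z u (a i)"
    using w unfolding adapted_curve_def D_def by blast
  then obtain \<nu> where \<nu>: "\<And>i. wjet (D i) 0 0 (\<nu> i)" "\<And>i. Re (\<nu> i) = \<sigma> * chern_form g z u (a i)"
    by metis
  have D0: "D i 0 = 1" for i
    using a[of i] by (simp add: D_def w0 cform_self[OF herm[OF z]])
  define F where "F t = tensor_eval p (s (z + t *s u)) (\<lambda>m. Q (g (z + t *s u)) (w m t))" for t
  have "\<exists>\<alpha>. wjet (\<lambda>t. \<Sum>I | length I = p. s (z + t *s u) I * (\<Prod>m<p. Q (g (z + t *s u)) (w m t) $ (I ! m))) \<alpha> 0 0"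
  proof (rule wjet_sum_antiholomorphic_free)
    fix I :: "'n list"
    obtain \<alpha>1 where 1: "wjet (\<lambda>t. s (z + t *s u) I) \<alpha>1 0 0"
      using hol_on_wjet_line[OF hol open_U z] by blast
    have "\<exists>\<alpha>. wjet (\<lambda>t. \<Prod>m<p. Q (g (z + t *s u)) (w m t) $ (I ! m)) \<alpha> 0 0"
      by (rule wjet_prod_antiholomorphic_free) (use w in \<open>simp add: adapted_curve_def\<close>)
    then obtain \<alpha>2 where 2: "wjet (\<lambda>t. \<Prod>m<p. Q (g (z + t *s u)) (w m t) $ (I ! m)) \<alpha>2 0 0" by blast
    show "\<exists>\<alpha>. wjet (\<lambda>t. s (z + t *s u) I * (\<Prod>m<p. Q (g (z + t *s u)) (w m t) $ (I ! m))) \<alpha> 0 0"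
      using wjet_mult[OF 1 2] by auto
  qed
  then obtain \<alpha>F where jF: "wjet F \<alpha>F 0 0"
    unfolding F_def tensor_eval_def by blast
  have F0: "cmod (F 0) = N z" by (simp add: F_def w0 Na)
  \<comment> \<open>A phase that turns \<open>F 0\<close> into the nonnegative number
    \<open>N z\<close>, so that \<open>Re (c * F t)\<close> is bounded by the modulus of
    \<open>F t\<close> with equality at 0.\<close>
  define c where "c = (if F 0 = 0 then 1 else cnj (F 0) / of_real (cmod (F 0)))"
  have c: "cmod c = 1" "c * F 0 = of_real (N z)"
    using F0 N_nonneg[OF z] by (auto simp: c_def norm_divide complex_norm_square[symmetric] power2_eq_square mult.commute)
  define E where "E i t = (1 + D i t) / 2" for i t
  have jE: "wjet (E i) 0 0 (\<nu> i / 2)" for i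
    using wjet_cmult[OF wjet_add[OF wjet_const[of 1] \<nu>(1)[of i]], of "1/2"] by (simp add: E_def[abs_def])
  have E0: "E i 0 = 1" for i by (simp add: E_def D0)
  have jP: "wjet (\<lambda>t. \<Prod>i<p. E i t) 0 0 (\<Sum>i<p. \<nu> i / 2)"
    by (rule wjet_prod_critical) (auto intro: jE E0)
  \<comment> \<open>The touching condition bounds \<open>N\<close> on the line by the first factor.
    The real part of \<open>R\<close> is therefore nonnegative near 0, and it vanishes at 0.\<close>
  define R where "R t = (of_real (N z + v z) - of_real (v (z + t *s u))) * (\<Prod>i<p. E i t) - c * F t" for t
  \<comment> \<open>\<open>F\<close> has no \<partial>\<partial>bar-derivative and the product is
    critical at 0, so only the curvatures and \<mu> remain at second order.\<close>
  have jR: "wjet R (- \<alpha> - c * \<alpha>F) (- \<beta>) (of_real (N z) * (\<Sum>i<p. \<nu> i / 2) - \<mu>)"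
    using wjet_diff[OF wjet_mult[OF wjet_diff[OF wjet_const[of "of_real (N z + v z)"] jv] jP] wjet_cmult[OF jF, of c]]
    by (simp add: R_def[abs_def] E0)
  have R0: "Re (R 0) = 0" using c by (simp add: R_def E0)
  have "\<forall>\<^sub>F t in nhds 0. z + t *s u \<in> U \<and> N (z + t *s u) + v (z + t *s u) \<le> N z + v z"
  proof -
    have bl: "bounded_linear (\<lambda>t::complex. t *s u)"
      unfolding linear_conv_bounded_linear[symmetric]
      by (intro linearI) (simp_all add: vec_eq_iff algebra_simps)
    have "((\<lambda>t. z + t *s u) \<longlongrightarrow> z + 0 *s u) (nhds 0)"
      using bounded_linear.tendsto[OF bl filterlim_ident[of "nhds 0"]] by (intro tendsto_intros)
    then have lim: "filterlim (\<lambda>t. z + t *s u) (nhds z) (nhds 0)" by simp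
    have "\<forall>\<^sub>F w in nhds z. w \<in> U" using open_U z by (rule eventually_nhds_in_open)
    from eventually_conj[OF this touch] lim show ?thesis by (auto simp: filterlim_iff)
  qed
  then have "\<forall>\<^sub>F t in nhds 0. Re (R 0) \<le> Re (R t)"
  proof eventually_elim
    case (elim t)
    let ?z = "z + t *s u"
    define h where "h i = herm_form (g ?z) (w i t)" for i
    have h0: "h i \<ge> 0" for i using herm_form_nonneg elim by (simp add: h_def)
    have Eh: "E i t = of_real ((1 + h i) / 2)" for i
      using elim by (simp add: E_def D_def h_def cform_self[OF herm])
    have sq: "sqrt x \<le> (1 + x) / 2" if "x \<ge> 0" for x :: real
      using arith_geo_mean_sqrt[of 1 x] that by simp
    have "Re (c * F t) \<le> cmod (F t)"
      using complex_Re_le_cmod[of "c * F t"] c by (simp add: norm_mult)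
    also have "\<dots> \<le> N ?z * (\<Prod>i<p. sqrt (h i))"
      unfolding F_def h_def using elim by (intro tensor_eval_le) auto
    also have "\<dots> \<le> N ?z * (\<Prod>i<p. (1 + h i) / 2)"
      using N_nonneg elim h0 sq by (intro mult_left_mono prod_mono) auto
    also have "\<dots> \<le> (N z + v z - v ?z) * (\<Prod>i<p. (1 + h i) / 2)"
      using elim h0 by (intro mult_right_mono prod_nonneg) (auto simp: add_nonneg_nonneg)
    also have "\<dots> = Re ((of_real (N z + v z) - of_real (v ?z)) * (\<Prod>i<p. E i t))"
      by (simp only: Eh of_real_prod[symmetric] of_real_diff[symmetric] of_real_mult[symmetric] Re_complex_of_real)
    finally show ?case using R0 by (simp add: R_def)
  qed
  from wjet_local_min[OF jR this] have "0 \<le> N z * (\<Sum>i<p. Re (\<nu> i) / 2) - Re \<mu>"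
    by simp
  then show ?thesis by (simp add: \<nu>(2) sum_distrib_left sum_divide_distrib[symmetric] mult_ac)
qed

text \<open>The maximising tuple \<open>a\<close> depends on the point alone. The same
  \<open>a\<close> thus serves all directions of the frame, and the inequalities on the lines sum to
  a trace.\<close>

lemma bochner_inequality:
  assumes z: "z \<in> U" and frame: "unitary_frame (g z) e"
    and touch: "\<forall>\<^sub>F w in nhds z. N w + v w \<le> N z + v z"
    and jv: "\<And>m. \<exists>\<alpha> \<beta>. wjet (\<lambda>t. of_real (v (z + t *s e m))) \<alpha> \<beta> (\<mu> m)"
  obtains a where "\<And>i. herm_form (g z) (a i) = 1"
    "(\<Sum>m\<in>UNIV. Re (\<mu> m)) \<le> N z / 2 * (\<sigma> * (\<Sum>i<p. herm_form (second_ricci g z) (a i)))"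
proof -
  obtain a where a: "\<And>m. herm_form (g z) (a m) = 1"
    "N z = cmod (tensor_eval p (s z) (\<lambda>m. Q (g z) (a m)))" using N_attained[OF z] by blast
  have "Re (\<mu> m) \<le> N z / 2 * (\<sigma> * (\<Sum>i<p. chern_form g z (e m) (a i)))" for m
    using jv[of m] bochner_line[OF z touch _ a] by blast
  then have "(\<Sum>m\<in>UNIV. Re (\<mu> m)) \<le> (\<Sum>m\<in>UNIV. N z / 2 * (\<sigma> * (\<Sum>i<p. chern_form g z (e m) (a i))))"
    by (intro sum_mono)
  also have "\<dots> = N z / 2 * (\<sigma> * (\<Sum>m\<in>UNIV. \<Sum>i<p. chern_form g z (e m) (a i)))"
    by (simp add: sum_distrib_left)
  also have "(\<Sum>m\<in>UNIV. \<Sum>i<p. chern_form g z (e m) (a i)) = (\<Sum>i<p. herm_form (second_ricci g z) (a i))"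
    by (subst sum.swap) (simp add: sum_chern_form[where g = g and z = z and e = e, OF frame])
  finally show thesis using a(1) that by blast
qed

end

section \<open>The strong maximum principle\<close>

context hermitian_patch
begin

text \<open>With \<phi> = C - v this is the usual condition on functions \<phi> touching
  \<open>f\<close> from above, for the operator given by tracing \<partial>\<partial>bar in a
  unitary frame. The test function needs 2-jets on the frame lines only.\<close>

definition viscosity_subharmonic :: "(complex ^ 'n \<Rightarrow> real) \<Rightarrow> bool" where
  "viscosity_subharmonic f \<longleftrightarrow> (\<forall>z\<in>U. \<forall>e v \<mu>. unitary_frame (g z) e \<longrightarrow>
     (\<forall>\<^sub>F w in nhds z. f w + v w \<le> f z + v z) \<longrightarrow>
     (\<forall>m. \<exists>\<alpha> \<beta>. wjet (\<lambda>t. of_real (v (z + t *s e m))) \<alpha> \<beta> (\<mu> m)) \<longrightarrow>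
     (\<Sum>m\<in>UNIV. Re (\<mu> m)) \<le> 0)"

text \<open>Uniform ellipticity: extreme values on \<open>C\<close> times the unit sphere, extended
  to all vectors by homogeneity.\<close>

lemma uniform_metric_bounds:
  assumes C: "compact C" "C \<subseteq> U" "C \<noteq> {}"
  obtains a b where "a > 0" "b > 0"
    "\<And>w x. w \<in> C \<Longrightarrow> a * (norm x)\<^sup>2 \<le> herm_form (g w) x"
    "\<And>w x. w \<in> C \<Longrightarrow> herm_form (g w) x \<le> b * (norm x)\<^sup>2"
proof -
  let ?K = "C \<times> sphere (0 :: complex ^ 'n) 1"
  obtain x :: "complex ^ 'n" where "norm x = 1" using vector_choose_size[of 1] by auto
  then have K: "compact ?K" "?K \<noteq> {}" using C by (auto intro!: compact_Times simp: ex_in_conv[symmetric])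
  have gc: "continuous_on ?K (\<lambda>x. g (fst x))"
    by (rule continuous_on_compose2[OF g_cont]) (use C in \<open>auto intro!: continuous_intros\<close>)
  have cont: "continuous_on ?K (\<lambda>x. herm_form (g (fst x)) (snd x))"
    unfolding herm_form_def
    by (intro continuous_intros continuous_on_component[OF continuous_on_component[OF gc]]
        continuous_on_component[OF continuous_on_snd])
  obtain x0 where x0: "x0 \<in> ?K" "\<And>x. x \<in> ?K \<Longrightarrow> herm_form (g (fst x0)) (snd x0) \<le> herm_form (g (fst x)) (snd x)"
    using continuous_attains_inf[OF K cont] by blast
  obtain x1 where x1: "x1 \<in> ?K" "\<And>x. x \<in> ?K \<Longrightarrow> herm_form (g (fst x)) (snd x) \<le> herm_form (g (fst x1)) (snd x1)"
    using continuous_attains_sup[OF K cont] by blast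
  have pos0: "herm_form (g (fst x)) (snd x) > 0" if "x \<in> ?K" for x
  proof -
    have "snd x \<noteq> 0" "fst x \<in> U" using that C by auto
    then show ?thesis using pos by (simp add: pos_mat_def)
  qed
  have hom: "\<exists>y. norm y = 1 \<and> herm_form H x = herm_form H y * (norm x)\<^sup>2" if "x \<noteq> 0" for x :: "complex ^ 'n" and H
  proof -
    define y where "y = (1 / norm x) *\<^sub>R x"
    have "x = of_real (norm x) *s y"
      using that by (simp add: y_def vec_eq_iff scaleR_conv_of_real[where 'a = complex])
    then have "herm_form H x = (norm x)\<^sup>2 * herm_form H y"
      by (metis herm_form_scale norm_of_real abs_norm_cancel)
    moreover have "norm y = 1" using that by (simp add: y_def)
    ultimately show ?thesis by (metis mult.commute)
  qed
  show thesis
  proof (rule that[of "herm_form (g (fst x0)) (snd x0)" "herm_form (g (fst x1)) (snd x1)"])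
    fix w x assume w: "w \<in> C"
    show "herm_form (g (fst x0)) (snd x0) * (norm x)\<^sup>2 \<le> herm_form (g w) x"
    proof (cases "x = 0")
      case False
      then obtain y where "norm y = 1" "herm_form (g w) x = herm_form (g w) y * (norm x)\<^sup>2" using hom by blast
      then show ?thesis using x0(2)[of "(w, y)"] w by (simp add: mult_right_mono)
    qed (simp add: herm_form_def)
    show "herm_form (g w) x \<le> herm_form (g (fst x1)) (snd x1) * (norm x)\<^sup>2"
    proof (cases "x = 0")
      case False
      then obtain y where "norm y = 1" "herm_form (g w) x = herm_form (g w) y * (norm x)\<^sup>2" using hom by blast
      then show ?thesis using x1(2)[of "(w, y)"] w by (simp add: mult_right_mono)
    qed (simp add: herm_form_def)
  qed (use pos0 x0 x1 in auto)
qed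

end

section \<open>The barrier and its trace of \<partial>\<partial>bar\<close>

lemma wjet_norm_sq:
  fixes w y u :: "complex ^ 'n::finite"
  shows "wjet (\<lambda>t. of_real ((norm (w + t *s u - y))\<^sup>2)) (\<Sum>k\<in>UNIV. u $ k * cnj ((w - y) $ k))
    (cnj (\<Sum>k\<in>UNIV. u $ k * cnj ((w - y) $ k))) (of_real ((norm u)\<^sup>2))"
proof -
  have "wjet (\<lambda>t. \<Sum>k\<in>UNIV. ((w - y) $ k + u $ k * t) * cnj ((w - y) $ k + u $ k * t))
     (\<Sum>k\<in>UNIV. u $ k * cnj ((w - y) $ k)) (\<Sum>k\<in>UNIV. (w - y) $ k * cnj (u $ k)) (\<Sum>k\<in>UNIV. u $ k * cnj (u $ k))"
  proof (rule wjet_sum)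
    fix k
    have 1: "wjet (\<lambda>t. (w - y) $ k + u $ k * t) (u $ k) 0 0"
      using wjet_add[OF wjet_const[of "(w - y) $ k"] wjet_cmult[OF wjet_ident, of "u $ k"]] by simp
    show "wjet (\<lambda>t. ((w - y) $ k + u $ k * t) * cnj ((w - y) $ k + u $ k * t))
      (u $ k * cnj ((w - y) $ k)) ((w - y) $ k * cnj (u $ k)) (u $ k * cnj (u $ k))"
      using wjet_mult[OF 1 wjet_cnj[OF 1]] by simp
  qed
  moreover have "(\<Sum>k\<in>UNIV. ((w - y) $ k + u $ k * t) * cnj ((w - y) $ k + u $ k * t)) =
      of_real ((norm (w + t *s u - y))\<^sup>2)" for t
    unfolding norm_sq_vec of_real_sum
    by (intro sum.cong refl) (unfold complex_norm_square, simp add: algebra_simps)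
  moreover have "(\<Sum>k\<in>UNIV. u $ k * cnj (u $ k)) = of_real ((norm u)\<^sup>2)"
    unfolding norm_sq_vec of_real_sum by (simp only: complex_norm_square)
  moreover have "(\<Sum>k\<in>UNIV. (w - y) $ k * cnj (u $ k)) = cnj (\<Sum>k\<in>UNIV. u $ k * cnj ((w - y) $ k))"
    by (simp add: mult.commute)
  ultimately show ?thesis by simp
qed

text \<open>A polynomial substitute for Hopf's exponential barrier: with \<open>\<rho> = R\<^sup>2 - |w - y|\<^sup>2\<close>, the term
  \<open>k \<rho>\<^sup>2\<close> contributes \<open>2 k |\<partial>\<rho>|\<^sup>2\<close> on the sphere and leaves the sign of \<open>\<rho>\<close> unchanged near it.\<close>

definition barrier :: "real \<Rightarrow> real \<Rightarrow> complex ^ 'n::finite \<Rightarrow> complex ^ 'n \<Rightarrow> real" where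
  "barrier R k y w = (R\<^sup>2 - (norm (w - y))\<^sup>2) + k * (R\<^sup>2 - (norm (w - y))\<^sup>2)\<^sup>2"

lemma wjet_barrier:
  fixes w y u :: "complex ^ 'n::finite" and R k \<epsilon> :: real
  defines "\<rho> \<equiv> R\<^sup>2 - (norm (w - y))\<^sup>2"
  shows "\<exists>\<alpha> \<beta>. wjet (\<lambda>t. of_real (\<epsilon> * barrier R k y (w + t *s u))) \<alpha> \<beta>
    (of_real (\<epsilon> * (2 * k * (cmod (\<Sum>j\<in>UNIV. u $ j * cnj ((w - y) $ j)))\<^sup>2 - (1 + 2 * k * \<rho>) * (norm u)\<^sup>2)))"
proof -
  define P where "P = (\<Sum>j\<in>UNIV. u $ j * cnj ((w - y) $ j))"
  let ?\<rho> = "\<lambda>t. of_real (R\<^sup>2 - (norm (w + t *s u - y))\<^sup>2) :: complex"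
  have 1: "wjet ?\<rho> (- P) (- cnj P) (- of_real ((norm u)\<^sup>2))"
    using wjet_diff[OF wjet_const[of "of_real (R\<^sup>2)"] wjet_norm_sq[of w u y]]
    by (simp add: P_def)
  have "\<exists>\<alpha> \<beta>. wjet (\<lambda>t. of_real \<epsilon> * (?\<rho> t + of_real k * (?\<rho> t * ?\<rho> t))) \<alpha> \<beta>
     (of_real \<epsilon> * (- of_real ((norm u)\<^sup>2) + of_real k *
       (?\<rho> 0 * (- of_real ((norm u)\<^sup>2)) + (- P) * (- cnj P) + (- cnj P) * (- P) + (- of_real ((norm u)\<^sup>2)) * ?\<rho> 0)))"
    using wjet_cmult[OF wjet_add[OF 1 wjet_cmult[OF wjet_mult[OF 1 1], of "of_real k"]], of "of_real \<epsilon>"] by blast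
  moreover have "of_real \<epsilon> * (?\<rho> t + of_real k * (?\<rho> t * ?\<rho> t)) = of_real (\<epsilon> * barrier R k y (w + t *s u))" for t
    by (simp add: barrier_def power2_eq_square)
  moreover have "of_real \<epsilon> * (- of_real ((norm u)\<^sup>2) + of_real k *
       (?\<rho> 0 * (- of_real ((norm u)\<^sup>2)) + (- P) * (- cnj P) + (- cnj P) * (- P) + (- of_real ((norm u)\<^sup>2)) * ?\<rho> 0)) =
     of_real (\<epsilon> * (2 * k * (cmod P)\<^sup>2 - (1 + 2 * k * \<rho>) * (norm u)\<^sup>2))"
  proof -
    have "P * cnj P = of_real ((cmod P)\<^sup>2)" by (simp only: complex_norm_square)
    then have "?\<rho> 0 * (- of_real ((norm u)\<^sup>2)) + (- P) * (- cnj P) + (- cnj P) * (- P) + (- of_real ((norm u)\<^sup>2)) * ?\<rho> 0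
      = of_real (2 * (cmod P)\<^sup>2 - 2 * \<rho> * (norm u)\<^sup>2)"
      by (simp add: \<rho>_def mult.commute[of "cnj P"] algebra_simps)
    then show ?thesis by (simp only:) (simp add: algebra_simps)
  qed
  ultimately show ?thesis unfolding P_def[symmetric] by (simp only:)
qed

context hermitian_patch
begin

text \<open>\<open>T\<close> bounds the sum of the Euclidean squares of a unitary frame, each being
  at most 1/a; \<open>S\<close> bounds the squared gradient from below by
  \<open>unitary_frame_lower\<close>. With k = T / S the gradient term is at least 2T, while the
  remaining terms subtract at most T + T/2.\<close>

lemma barrier_strict:
  assumes z1: "z1 \<in> U" and y: "norm (z1 - y) = R" and R: "R > 0"
  obtains k \<delta> where "k > 0" "\<delta> > 0" "cball z1 \<delta> \<subseteq> U"
    "\<And>w. w \<in> cball z1 \<delta> \<Longrightarrow> \<bar>R\<^sup>2 - (norm (w - y))\<^sup>2\<bar> < 1 / k"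
    "\<And>w e. w \<in> cball z1 \<delta> \<Longrightarrow> unitary_frame (g w) e \<Longrightarrow>
      (\<Sum>m\<in>UNIV. 2 * k * (cmod (\<Sum>j\<in>UNIV. e m $ j * cnj ((w - y) $ j)))\<^sup>2
        - (1 + 2 * k * (R\<^sup>2 - (norm (w - y))\<^sup>2)) * (norm (e m))\<^sup>2) > 0"
proof -
  obtain \<delta>0 where \<delta>0: "\<delta>0 > 0" "cball z1 \<delta>0 \<subseteq> U" using open_U z1 open_contains_cball by blast
  obtain a b where ab: "a > 0" "b > 0"
    "\<And>w x. w \<in> cball z1 \<delta>0 \<Longrightarrow> a * (norm x)\<^sup>2 \<le> herm_form (g w) x"
    "\<And>w x. w \<in> cball z1 \<delta>0 \<Longrightarrow> herm_form (g w) x \<le> b * (norm x)\<^sup>2"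
    using uniform_metric_bounds[of "cball z1 \<delta>0"] \<delta>0 by auto
  define T where "T = real CARD('n) / a"
  define S where "S = R\<^sup>2 / (2 * b)"
  have T: "T > 0" using ab by (simp add: T_def)
  have S: "S > 0" using ab R by (simp add: S_def)
  define k where "k = T / S"
  have k: "k > 0" using T S by (simp add: k_def)
  \<comment> \<open>The bound R^2/2 keeps \<open>w\<close> away from \<open>y\<close> in the
    estimate by \<open>S\<close>, 1/k keeps 1 + k\<rho> positive, and S/(4T) limits 2k\<rho>t to
    T/2.\<close>
  define \<eta> where "\<eta> = min (R\<^sup>2 / 2) (min (1 / k) (S / (4 * T)))"
  have \<eta>: "\<eta> > 0" using R k S T by (simp add: \<eta>_def)
  have "isCont (\<lambda>w. R\<^sup>2 - (norm (w - y))\<^sup>2) z1" by (intro continuous_intros)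
  then have "\<forall>\<^sub>F w in nhds z1. \<bar>R\<^sup>2 - (norm (w - y))\<^sup>2\<bar> < \<eta>"
    using \<eta> y by (auto simp: continuous_at_eps_delta eventually_nhds_metric dist_real_def)
  then obtain \<delta>1 where \<delta>1: "\<delta>1 > 0" "\<And>w. dist w z1 < \<delta>1 \<Longrightarrow> \<bar>R\<^sup>2 - (norm (w - y))\<^sup>2\<bar> < \<eta>"
    unfolding eventually_nhds_metric by blast
  define \<delta> where "\<delta> = min \<delta>0 (\<delta>1 / 2)"
  show thesis
  proof (rule that[of k \<delta>])
    show "k > 0" by fact
    show "\<delta> > 0" using \<delta>0 \<delta>1 by (simp add: \<delta>_def)
    show "cball z1 \<delta> \<subseteq> U" using \<delta>0 by (auto simp: \<delta>_def)
    have \<rho>: "\<bar>R\<^sup>2 - (norm (w - y))\<^sup>2\<bar> < \<eta>" if "w \<in> cball z1 \<delta>" for w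
      using that \<delta>1 by (auto simp: \<delta>_def dist_commute)
    then show "\<bar>R\<^sup>2 - (norm (w - y))\<^sup>2\<bar> < 1 / k" if "w \<in> cball z1 \<delta>" for w
      using that by (fastforce simp: \<eta>_def)
    fix w e assume w: "w \<in> cball z1 \<delta>" and e: "unitary_frame (g w) e"
    have w0: "w \<in> cball z1 \<delta>0" using w by (simp add: \<delta>_def)
    then have wU: "w \<in> U" using \<delta>0 by blast
    let ?q = "w - y"
    let ?\<rho> = "R\<^sup>2 - (norm ?q)\<^sup>2"
    define t where "t = (\<Sum>m\<in>UNIV. (norm (e m))\<^sup>2)"
    define s where "s = (\<Sum>m\<in>UNIV. (cmod (\<Sum>j\<in>UNIV. e m $ j * cnj (?q $ j)))\<^sup>2)"
    have t: "0 \<le> t" "t \<le> T"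
    proof -
      have "(norm (e m))\<^sup>2 \<le> 1 / a" for m
        using ab(3)[OF w0, of "e m"] unitary_frame_unit[OF e] ab(1) by (simp add: field_simps)
      then have "t \<le> (\<Sum>m\<in>(UNIV :: 'n set). 1 / a)" unfolding t_def by (intro sum_mono)
      then show "t \<le> T" by (simp add: T_def)
      show "0 \<le> t" by (simp add: t_def sum_nonneg)
    qed
    have s: "s \<ge> S"
    proof -
      have "(norm ?q)\<^sup>2 \<le> b * s"
        unfolding s_def by (rule unitary_frame_lower[OF herm[OF wU] e ab(4)[OF w0]])
      moreover have "\<bar>?\<rho>\<bar> < R\<^sup>2 / 2" using \<rho>[OF w] by (simp add: \<eta>_def)
      then have "(norm ?q)\<^sup>2 \<ge> R\<^sup>2 / 2" by linarith
      ultimately show ?thesis using ab(2) by (simp add: S_def field_simps)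
    qed
    have "?\<rho> * t \<le> S / 4"
    proof -
      have "?\<rho> * t \<le> \<bar>?\<rho>\<bar> * T" using t by (intro mult_mono) auto
      also have "\<dots> \<le> S / (4 * T) * T" using \<rho>[OF w] T by (intro mult_right_mono) (auto simp: \<eta>_def)
      finally show ?thesis using T by simp
    qed
    then have "k * (?\<rho> * t) \<le> k * (S / 4)" using k by (intro mult_left_mono) auto
    moreover have "k * s \<ge> k * S" using k s by (intro mult_left_mono) auto
    moreover have "k * S = T" using S by (simp add: k_def)
    ultimately have "2 * (k * s) - t - 2 * (k * (?\<rho> * t)) > 0" using t T by simp
    moreover have "(\<Sum>m\<in>UNIV. 2 * k * (cmod (\<Sum>j\<in>UNIV. e m $ j * cnj (?q $ j)))\<^sup>2
        - (1 + 2 * k * ?\<rho>) * (norm (e m))\<^sup>2) = 2 * k * s - (1 + 2 * k * ?\<rho>) * t"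
      by (simp only: sum_subtractf s_def t_def sum_distrib_left)
    moreover have "2 * k * s - (1 + 2 * k * ?\<rho>) * t = 2 * (k * s) - t - 2 * (k * (?\<rho> * t))"
      by (simp add: distrib_right)
    ultimately show "(\<Sum>m\<in>UNIV. 2 * k * (cmod (\<Sum>j\<in>UNIV. e m $ j * cnj (?q $ j)))\<^sup>2
        - (1 + 2 * k * ?\<rho>) * (norm (e m))\<^sup>2) > 0"
      by (simp only:)
  qed
qed

text \<open>A small multiple of the barrier leaves the value at \<open>z1\<close> unchanged but
  pushes the sum below \<open>M\<close> on a small sphere around \<open>z1\<close>: in the ball
  about \<open>y\<close> because \<open>f\<close> has a gap there, outside because the barrier is
  negative. The sum then has an interior maximum, where the positive trace of the barrier
  contradicts subharmonicity.\<close>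

lemma no_touching_ball:
  assumes visc: "viscosity_subharmonic f" and cont: "continuous_on U f" and le: "\<And>z. z \<in> U \<Longrightarrow> f z \<le> M"
    and z1: "z1 \<in> U" "f z1 = M" and y: "norm (z1 - y) = R" and R: "R > 0"
    and inside: "\<And>w. w \<in> U \<Longrightarrow> norm (w - y) \<le> R \<Longrightarrow> w \<noteq> z1 \<Longrightarrow> f w < M"
  shows False
proof -
  obtain k \<delta> where k: "k > 0" and \<delta>: "\<delta> > 0" "cball z1 \<delta> \<subseteq> U"
    and \<rho>: "\<And>w. w \<in> cball z1 \<delta> \<Longrightarrow> \<bar>R\<^sup>2 - (norm (w - y))\<^sup>2\<bar> < 1 / k"
    and strict: "\<And>w e. w \<in> cball z1 \<delta> \<Longrightarrow> unitary_frame (g w) e \<Longrightarrow>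
      (\<Sum>m\<in>UNIV. 2 * k * (cmod (\<Sum>j\<in>UNIV. e m $ j * cnj ((w - y) $ j)))\<^sup>2
        - (1 + 2 * k * (R\<^sup>2 - (norm (w - y))\<^sup>2)) * (norm (e m))\<^sup>2) > 0"
    using barrier_strict[OF z1(1) y R] by blast
  have contb: "continuous_on A (barrier R k y)" for A
    unfolding barrier_def by (intro continuous_intros)
  let ?C = "sphere z1 \<delta> \<inter> cball y R"
  have C: "compact ?C" by (intro compact_Int) auto
  have CU: "?C \<subseteq> U" using \<delta> by (auto simp: subset_eq)
  have lt: "f w < M" if "w \<in> ?C" for w
    using that CU \<delta> by (intro inside) (auto simp: dist_norm norm_minus_commute)
  \<comment> \<open>The sphere avoids \<open>z1\<close>, so compactness yields a gap below
    \<open>M\<close>. An empty intersection, as for \<delta> > 2R, admits any gap.\<close>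
  obtain \<eta> where \<eta>: "\<eta> > 0" "\<And>w. w \<in> ?C \<Longrightarrow> f w \<le> M - \<eta>"
  proof (cases "?C = {}")
    case False
    then obtain x where x: "x \<in> ?C" "\<And>w. w \<in> ?C \<Longrightarrow> f w \<le> f x"
      using continuous_attains_sup[OF C False continuous_on_subset[OF cont CU]] by blast
    show thesis using lt[OF x(1)] x(2) by (intro that[of "M - f x"]) auto
  qed (use that[of 1] in auto)
  \<comment> \<open>The barrier is at most 2/k on the closed ball, so it uses up at most half of the
    gap \<eta>.\<close>
  define \<epsilon> where "\<epsilon> = \<eta> * k / 4"
  have \<epsilon>: "\<epsilon> > 0" using \<eta> k by (simp add: \<epsilon>_def)
  let ?v = "\<lambda>w. \<epsilon> * barrier R k y w"
  have bound: "barrier R k y w \<le> 2 / k" if "w \<in> cball z1 \<delta>" for w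
  proof -
    let ?r = "R\<^sup>2 - (norm (w - y))\<^sup>2"
    have "?r\<^sup>2 \<le> (1 / k)\<^sup>2" using \<rho>[OF that] k by (intro abs_le_square_iff[THEN iffD1]) auto
    then have "k * ?r\<^sup>2 \<le> k * (1 / k)\<^sup>2" using k by (intro mult_left_mono) auto
    also have "\<dots> = 1 / k" using k by (simp add: power2_eq_square)
    finally show ?thesis using \<rho>[OF that] by (simp add: barrier_def)
  qed
  have sphere: "f w + ?v w < M" if "w \<in> sphere z1 \<delta>" for w
  proof (cases "w \<in> cball y R")
    case True
    have "?v w \<le> \<epsilon> * (2 / k)" using bound[of w] that \<epsilon> by (intro mult_left_mono) auto
    also have "\<dots> = \<eta> / 2" using k by (simp add: \<epsilon>_def)
    finally show ?thesis using \<eta>(2)[of w] \<eta>(1) True that by auto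
  next
    case False
    let ?r = "R\<^sup>2 - (norm (w - y))\<^sup>2"
    have "R < norm (w - y)" using False by (simp add: dist_norm norm_minus_commute)
    then have "R\<^sup>2 < (norm (w - y))\<^sup>2" using R by (intro power_strict_mono) auto
    then have r: "?r < 0" by simp
    have "k * \<bar>?r\<bar> < k * (1 / k)" using \<rho>[of w] that k by (intro mult_strict_left_mono) auto
    moreover have "k * \<bar>?r\<bar> = - (k * ?r)" by (simp only: abs_of_neg[OF r] mult_minus_right)
    ultimately have "1 + k * ?r > 0" using k by simp
    \<comment> \<open>The barrier factors as \<rho>(1 + k\<rho>), and its second factor is positive
      here.\<close>
    then have "?r * (1 + k * ?r) < 0" using r by (rule mult_neg_pos[rotated])
    then have "barrier R k y w < 0" by (simp add: barrier_def power2_eq_square algebra_simps)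
    then have "?v w < 0" using \<epsilon> by (simp add: mult_pos_neg)
    moreover have "f w \<le> M" using le \<delta> that by (auto simp: subset_eq)
    ultimately show ?thesis by simp
  qed
  have "continuous_on (cball z1 \<delta>) (\<lambda>w. f w + ?v w)"
    by (intro continuous_intros contb continuous_on_subset[OF cont \<delta>(2)])
  then obtain z where z: "z \<in> cball z1 \<delta>" "\<And>w. w \<in> cball z1 \<delta> \<Longrightarrow> f w + ?v w \<le> f z + ?v z"
    using continuous_attains_sup[of "cball z1 \<delta>" "\<lambda>w. f w + ?v w"] \<delta> by auto
  have "f z1 + ?v z1 = M" using z1 y by (simp add: barrier_def)
  then have "f z + ?v z \<ge> M" using z(2)[of z1] \<delta> by simp
  then have "z \<notin> sphere z1 \<delta>" using sphere[of z] by auto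
  then have zb: "z \<in> ball z1 \<delta>" using z(1) by (simp add: less_le)
  then have touch: "\<forall>\<^sub>F w in nhds z. f w + ?v w \<le> f z + ?v z"
    using z(2) ball_subset_cball by (intro eventually_mono[OF eventually_nhds_in_open[OF open_ball zb]]) blast
  have zU: "z \<in> U" using z \<delta> by blast
  obtain e where e: "unitary_frame (g z) e" using exists_unitary_frame[OF herm[OF zU] pos[OF zU]] by blast
  define \<mu> where "\<mu> m = \<epsilon> * (2 * k * (cmod (\<Sum>j\<in>UNIV. e m $ j * cnj ((z - y) $ j)))\<^sup>2
        - (1 + 2 * k * (R\<^sup>2 - (norm (z - y))\<^sup>2)) * (norm (e m))\<^sup>2)" for m
  have j: "\<forall>m. \<exists>\<alpha> \<beta>. wjet (\<lambda>t. of_real (?v (z + t *s e m))) \<alpha> \<beta> (of_real (\<mu> m))"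
    unfolding \<mu>_def by (intro allI wjet_barrier)
  have "(\<Sum>m\<in>UNIV. Re (of_real (\<mu> m))) \<le> 0"
    using visc[unfolded viscosity_subharmonic_def, rule_format, OF zU e touch j[rule_format]] .
  moreover have "(\<Sum>m\<in>UNIV. \<mu> m) > 0"
    using strict[OF z(1) e] \<epsilon> unfolding \<mu>_def sum_distrib_left[symmetric] by (intro mult_pos_pos)
  ultimately show False by simp
qed

text \<open>From a point \<open>y0\<close> outside the level set, go to a nearest point
  \<open>z1\<close> of that set. The ball having the segment from \<open>y0\<close> to
  \<open>z1\<close> as a diameter meets the set in \<open>z1\<close> alone, which
  \<open>no_touching_ball\<close> forbids. Taking \<open>y0\<close> within r/2 of \<open>z\<close>
  keeps the relevant points in \<open>cball z r\<close>.\<close>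

lemma max_set_open:
  assumes visc: "viscosity_subharmonic f" and cont: "continuous_on U f" and le: "\<And>z. z \<in> U \<Longrightarrow> f z \<le> M"
  shows "open {z \<in> U. f z = M}"
  unfolding open_contains_ball
proof
  fix z assume z: "z \<in> {z \<in> U. f z = M}"
  then obtain r where r: "r > 0" "cball z r \<subseteq> U" using open_U open_contains_cball by blast
  have "ball z (r / 2) \<subseteq> {z \<in> U. f z = M}"
  proof (rule ccontr)
    assume "\<not> ball z (r / 2) \<subseteq> {z \<in> U. f z = M}"
    then obtain y0 where y0: "y0 \<in> ball z (r / 2)" "y0 \<notin> {z \<in> U. f z = M}" by blast
    define S where "S = {w \<in> cball z r. f w = M}"
    have "closed S"
      unfolding S_def by (intro continuous_closed_preimage_constant continuous_on_subset[OF cont r(2)]) auto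
    moreover have zS: "z \<in> S" using z r by (simp add: S_def)
    ultimately obtain z1 where z1: "z1 \<in> S" "\<And>w. w \<in> S \<Longrightarrow> dist y0 z1 \<le> dist y0 w"
      using distance_attains_inf[of S y0] by blast
    define R where "R = dist y0 z1 / 2"
    have "y0 \<in> U" using y0(1) r by (auto simp: subset_eq)
    then have "y0 \<notin> S" using y0 by (auto simp: S_def)
    then have R: "R > 0" using z1 by (auto simp: R_def)
    have Rr: "2 * R < r / 2" using z1(2)[OF zS] y0 by (simp add: R_def dist_commute)
    \<comment> \<open>Centring at the midpoint instead of at \<open>y0\<close> makes the contact
      unique: a ball about \<open>y0\<close> could touch the level set at several points.\<close>
    define y where "y = (1 / 2) *\<^sub>R (y0 + z1)"
    have "z1 - y = (1 / 2) *\<^sub>R (z1 - y0)" by (simp add: y_def algebra_simps flip: scaleR_left_distrib) 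
    then have ny: "norm (z1 - y) = R" by (simp add: R_def dist_norm norm_minus_commute)
    have z1U: "z1 \<in> U" "f z1 = M" using z1 r by (auto simp: S_def)
    show False
    proof (rule no_touching_ball[OF visc cont le z1U ny R])
      fix w assume w: "w \<in> U" "norm (w - y) \<le> R" "w \<noteq> z1"
      \<comment> \<open>By the parallelogram law a point \<open>w\<close> \<noteq> \<open>z1\<close>
        of the ball about \<open>y\<close> is strictly nearer to \<open>y0\<close> than
        \<open>z1\<close> is.\<close>
      have par: "(norm (p + q))\<^sup>2 + (norm (p - q))\<^sup>2 = 2 * (norm p)\<^sup>2 + 2 * (norm q)\<^sup>2" for p q :: "complex ^ 'n"
        by (simp add: power2_norm_eq_inner inner_add_left inner_add_right inner_diff_left inner_diff_right inner_commute)
      have yy: "w - y + (y - y0) = w - y0" "w - y - (y - y0) = w - z1" "norm (y - y0) = R"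
      proof -
        have "y + y = y0 + z1" by (simp add: y_def flip: scaleR_left_distrib)
        then have *: "y - y0 = z1 - y" by (simp add: algebra_simps)
        show "norm (y - y0) = R" unfolding * by (rule ny)
        show "w - y - (y - y0) = w - z1" unfolding * by simp
      qed simp
      have "(norm (w - y0))\<^sup>2 + (norm (w - z1))\<^sup>2 = 2 * (norm (w - y))\<^sup>2 + 2 * R\<^sup>2"
        using par[of "w - y" "y - y0"] unfolding yy .
      moreover have "(norm (w - y))\<^sup>2 \<le> R\<^sup>2" using w by (intro power_mono) auto
      moreover have "(norm (w - z1))\<^sup>2 > 0" using w by simp
      ultimately have "(norm (w - y0))\<^sup>2 < (2 * R)\<^sup>2" by (simp add: power2_eq_square)
      then have d: "norm (w - y0) < 2 * R" by (rule power2_less_imp_less) (use R in simp)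
      then have dR: "dist y0 w < 2 * R" by (simp add: dist_norm norm_minus_commute)
      then have "w \<notin> S" using z1(2)[of w] by (auto simp: R_def)
      moreover have "dist z w \<le> dist z y0 + dist y0 w" by (rule dist_triangle)
      then have "dist z w < r" using dR Rr y0(1) by simp
      ultimately have "f w \<noteq> M" by (auto simp: S_def)
      then show "f w < M" using le[OF w(1)] by simp
    qed
  qed
  then show "\<exists>e>0. ball z e \<subseteq> {z \<in> U. f z = M}" using r by (intro exI[of _ "r / 2"]) auto
qed

end

section \<open>Tensor sections over a Hermitian manifold\<close>

text \<open>The distributive law for \<open>p\<close> factors. Splitting off the head of a
  multi-index shifts the positions, which is why \<open>f\<close> is generalised in the
  induction.\<close>

lemma sum_prod_multi_index:
  fixes f :: "nat \<Rightarrow> 'n::finite \<Rightarrow> complex"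
  shows "(\<Sum>I | length I = p. \<Prod>m<p. f m (I ! m)) = (\<Prod>m<p. \<Sum>i\<in>UNIV. f m i)"
proof (induction p arbitrary: f)
  case (Suc p)
  have "(\<Sum>I | length I = Suc p. \<Prod>m<Suc p. f m (I ! m)) =
      (\<Sum>(i, I)\<in>UNIV \<times> {I. length I = p}. f 0 i * (\<Prod>m<p. f (Suc m) (I ! m)))"
    by (rule sum.reindex_bij_witness[of _ "\<lambda>(i, I). i # I" "\<lambda>I. (hd I, tl I)"])
      (auto simp: length_Suc_conv prod.lessThan_Suc_shift simp del: prod.lessThan_Suc)
  also have "\<dots> = (\<Sum>i\<in>UNIV. f 0 i) * (\<Prod>m<p. \<Sum>i\<in>UNIV. f (Suc m) i)"
    by (simp add: sum.cartesian_product[symmetric] sum_product[symmetric] Suc.IH[of "\<lambda>m. f (Suc m)"])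
  also have "\<dots> = (\<Prod>m<Suc p. \<Sum>i\<in>UNIV. f m i)"
    by (simp add: prod.lessThan_Suc_shift del: prod.lessThan_Suc)
  finally show ?case .
qed simp

text \<open>Naturality of evaluation. It is used with the Jacobian for forms and with its transpose,
  acting on covectors, for polyvectors.\<close>

lemma tensor_eval_transform:
  fixes B :: "complex ^ 'n::finite ^ 'n"
  assumes "\<And>I. length I = p \<Longrightarrow> s I = (\<Sum>J | length J = p. (\<Prod>m<p. B $ (J ! m) $ (I ! m)) * t J)"
  shows "tensor_eval p s v = tensor_eval p t (\<lambda>m. B *v v m)"
proof -
  have "tensor_eval p s v = (\<Sum>I | length I = p. \<Sum>J | length J = p.
      t J * (\<Prod>m<p. B $ (J ! m) $ (I ! m) * v m $ (I ! m)))"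
    unfolding tensor_eval_def by (intro sum.cong refl) (simp add: assms sum_distrib_left sum_distrib_right prod.distrib mult_ac)
  also have "\<dots> = (\<Sum>J | length J = p. \<Sum>I | length I = p.
      t J * (\<Prod>m<p. B $ (J ! m) $ (I ! m) * v m $ (I ! m)))"
    by (rule sum.swap)
  also have "\<dots> = (\<Sum>J | length J = p. t J * (\<Prod>m<p. \<Sum>i\<in>UNIV. B $ (J ! m) $ i * v m $ i))"
  proof (intro sum.cong refl)
    fix J :: "'n list"
    show "(\<Sum>I | length I = p. t J * (\<Prod>m<p. B $ (J ! m) $ (I ! m) * v m $ (I ! m))) =
        t J * (\<Prod>m<p. \<Sum>i\<in>UNIV. B $ (J ! m) $ i * v m $ i)"
      using sum_prod_multi_index[where p = p and f = "\<lambda>m i. B $ (J ! m) $ i * v m $ i"]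
      by (simp add: sum_distrib_left[symmetric])
  qed
  also have "\<dots> = tensor_eval p t (\<lambda>m. B *v v m)"
    by (simp add: tensor_eval_def matrix_vector_mult_def)
  finally show ?thesis .
qed

lemma tensor_eval_axis:
  fixes I :: "'n::finite list"
  assumes "length I = p"
  shows "tensor_eval p s (\<lambda>m. axis (I ! m) 1) = s I"
proof -
  have "s J * (\<Prod>m<p. axis (I ! m) 1 $ (J ! m)) = (if J = I then s I else 0)" if J: "length J = p" for J
  proof (cases "J = I")
    case False
    then obtain m where "m < p" "I ! m \<noteq> J ! m"
      using assms J by (auto simp: list_eq_iff_nth_eq)
    then have "(\<Prod>m<p. axis (I ! m) (1::complex) $ (J ! m)) = 0"
      by (intro prod_zero bexI[of _ m]) (auto simp: axis_def)
    then show ?thesis using False by simp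
  qed simp
  then have "tensor_eval p s (\<lambda>m. axis (I ! m) 1) = (\<Sum>J | length J = p. if J = I then s I else 0)"
    unfolding tensor_eval_def by (intro sum.cong refl) auto
  then show ?thesis using assms by (simp add: finite_multi_indices)
qed

section \<open>Charts and changes of coordinates on a Hermitian manifold\<close>

locale hermitian_manifold =
  fixes X :: "'a topology" and A :: "('a, 'n::finite) chart set" and h :: "('a, 'n) local_metric"
  assumes manifold: "complex_manifold X A" and compact: "compact_space X"
    and connected: "connected_space X" and metric: "hermitian_metric A h"
begin

lemma chart: "c \<in> A \<Longrightarrow> is_chart X c"
  using manifold by (simp add: complex_manifold_def)

lemma chart_cover: "x \<in> topspace X \<Longrightarrow> \<exists>c\<in>A. x \<in> fst c"
  using manifold by (auto simp: complex_manifold_def)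

lemma chart_patch: "c \<in> A \<Longrightarrow> hermitian_patch (chart_image c) (h c)"
  using chart[of c] metric
  unfolding hermitian_patch_def is_chart_def hermitian_metric_def smooth_on_def by blast

lemma inj_chart:
  assumes "c \<in> A" shows "inj_on (snd c) (fst c)"
proof -
  have "topspace (subtopology X (fst c)) = fst c"
    using chart[OF assms] openin_subset by (auto simp: is_chart_def)
  then show ?thesis
    using chart[OF assms] homeomorphic_imp_injective_map unfolding is_chart_def by metis
qed

lemma transition_coordinates:
  "c \<in> A \<Longrightarrow> x \<in> fst c \<Longrightarrow> transition c d (snd c x) = snd d x"
  using inj_chart by (simp add: transition_def)

definition jacobian :: "('a, 'n) chart \<Rightarrow> ('a, 'n) chart \<Rightarrow> complex ^ 'n \<Rightarrow> complex ^ 'n ^ 'n" where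
  "jacobian c d z = (\<chi> k i. transition_deriv c d z k i)"

lemma metric_transform:
  assumes "c \<in> A" "d \<in> A" "z \<in> overlap c d"
  shows "h c z = transpose (jacobian c d z) ** (h d (transition c d z) ** (\<chi> k i. cnj (jacobian c d z $ k $ i)))"
proof -
  have "h c z $ i $ j = (\<Sum>k\<in>UNIV. \<Sum>l\<in>UNIV.
      transition_deriv c d z k i * cnj (transition_deriv c d z l j) * h d (transition c d z) $ k $ l)" for i j
    using metric assms unfolding hermitian_metric_def by blast
  then show ?thesis
    by (simp add: vec_eq_iff matrix_matrix_mult_def transpose_def jacobian_def sum_distrib_left mult_ac)
qed

lemma cnj_matrix_cvec: "(\<chi> k i. cnj (M $ k $ i)) *v cvec v = cvec (M *v v)"
  by (simp add: vec_eq_iff matrix_vector_mult_def)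

lemma covector_transform:
  assumes "c \<in> A" "d \<in> A" "z \<in> overlap c d"
  shows "h c z *v cvec v =
    transpose (jacobian c d z) *v (h d (transition c d z) *v cvec (jacobian c d z *v v))"
  by (simp only: metric_transform[OF assms] matrix_vector_mul_assoc[symmetric] cnj_matrix_cvec)

lemma herm_form_transform:
  assumes "c \<in> A" "d \<in> A" "z \<in> overlap c d"
  shows "herm_form (h c z) v = herm_form (h d (transition c d z)) (jacobian c d z *v v)"
proof -
  let ?J = "jacobian c d z" and ?H = "h d (transition c d z)"
  have "cform (h c z) v v = cform (?H ** (\<chi> k i. cnj (?J $ k $ i))) (?J *v v) v"
    by (simp only: metric_transform[OF assms] cform_matrix_mult transpose_transpose)
  also have "\<dots> = cform ?H (?J *v v) (?J *v v)"
    by (simp only: cform_eq matrix_vector_mul_assoc[symmetric] cnj_matrix_cvec)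
  finally show ?thesis by (simp add: herm_form_eq)
qed

end

text \<open>Common interface of forms and polyvectors. \<open>transform\<close> makes evaluation
  independent of the chart, \<open>Q_surj\<close> lets the arguments reach every basis vector so
  that a vanishing norm kills the section, and \<open>curvature\<close> is the sign condition to
  which both cases reduce.\<close>

locale tensor_section = hermitian_manifold X A h
  for X :: "'a topology" and A :: "('a, 'n::finite) chart set" and h :: "('a, 'n) local_metric" +
  fixes p :: nat and Q :: "complex ^ 'n ^ 'n \<Rightarrow> complex ^ 'n \<Rightarrow> complex ^ 'n" and \<sigma> :: real
    and s :: "('a, 'n) local_section"
  assumes hol: "c \<in> A \<Longrightarrow> hol_on (chart_image c) (\<lambda>z. s c z I)"
    and Q_scale: "Q H (of_real r *s v) = of_real r *s Q H v"
    and Q_cont: "continuous_on UNIV (\<lambda>x. Q (fst x) (snd x))"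
    and adapted: "hermitian_patch U g \<Longrightarrow> z \<in> U \<Longrightarrow> \<exists>w. adapted_curve Q g z u a (\<sigma> * chern_form g z u a) w"
    and Q_surj: "pos_mat H \<Longrightarrow> y \<noteq> 0 \<Longrightarrow> \<exists>v. v \<noteq> 0 \<and> Q H v = y"
    and transform: "c \<in> A \<Longrightarrow> d \<in> A \<Longrightarrow> z \<in> overlap c d \<Longrightarrow>
      tensor_eval p (s c z) (\<lambda>m. Q (h c z) (vs m)) =
      tensor_eval p (s d (transition c d z)) (\<lambda>m. Q (h d (transition c d z)) (jacobian c d z *v vs m))"
    and alt: "alternating p (s c z)"
    and junk: "\<not> (c \<in> A \<and> z \<in> chart_image c) \<Longrightarrow> s c z = 0"
    and curvature: "c \<in> A \<Longrightarrow> z \<in> chart_image c \<Longrightarrow> \<sigma> * herm_form (second_ricci (h c) z) a \<le> 0"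
begin

lemma section_patch: "c \<in> A \<Longrightarrow> tensor_patch (chart_image c) (h c) Q \<sigma> (s c)"
  unfolding tensor_patch_def tensor_patch_axioms_def
  using chart_patch hol Q_scale Q_cont adapted by blast

abbreviation pointwise_norm where
  "pointwise_norm c z \<equiv> tensor_norm p Q (h c z) (s c z)"

text \<open>The Jacobian carries a maximising tuple in \<open>c\<close> to a competitor in
  \<open>d\<close> with the same ratio; exchanging the charts gives the reverse inequality.\<close>

lemma pointwise_norm_le:
  assumes c: "c \<in> A" and d: "d \<in> A" and x: "x \<in> fst c" "x \<in> fst d"
  shows "pointwise_norm c (snd c x) \<le> pointwise_norm d (snd d x)"
proof -
  define z where "z = snd c x"
  interpret C: tensor_patch "chart_image c" "h c" p Q \<sigma> "s c" by (rule section_patch[OF c])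
  interpret D: tensor_patch "chart_image d" "h d" p Q \<sigma> "s d" by (rule section_patch[OF d])
  have z: "z \<in> chart_image c" "z \<in> overlap c d" "transition c d z = snd d x" "snd d x \<in> chart_image d"
    using x c by (auto simp: z_def chart_image_def overlap_def transition_coordinates)
  obtain v where v: "v \<in> unit_tuples" "C.ratio z v = C.N z" using C.Sup_ratio(1)[OF z(1)] by blast
  define w where "w m = jacobian c d z *v v m" for m
  have hw: "herm_form (h c z) (v m) = herm_form (h d (snd d x)) (w m)" for m
    using herm_form_transform[OF c d z(2)] by (simp add: w_def z(3))
  have "C.ratio z v = D.ratio (snd d x) w"
    using transform[OF c d z(2), of v] by (simp add: tensor_ratio_def hw z(3) w_def)
  also have "\<dots> \<le> D.N (snd d x)"
  proof (rule D.ratio_le[OF z(4)])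
    fix m
    have "norm (v m) = 1" using v(1) by (simp add: unit_tuples_def)
    then have "v m \<noteq> 0" by auto
    \<comment> \<open>Since lengths are preserved, the image vector is nonzero; invertibility of the
      Jacobian is not invoked.\<close>
    then have "herm_form (h c z) (v m) > 0" using C.pos[OF z(1)] by (simp add: pos_mat_def)
    then show "w m \<noteq> 0" unfolding hw by (auto simp: herm_form_def)
  qed
  finally show ?thesis using v(2) by (simp add: z_def)
qed

lemma pointwise_norm_eq:
  assumes "c \<in> A" "d \<in> A" "x \<in> fst c" "x \<in> fst d"
  shows "pointwise_norm c (snd c x) = pointwise_norm d (snd d x)"
  using assms by (intro antisym pointwise_norm_le)

text \<open>The local norms paste to a continuous function on \<open>X\<close>, which has a maximum
  \<open>M\<close> by compactness. The set where \<open>M\<close> is attained is closed, and open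
  because each chart sees a viscosity subharmonic function, so connectedness makes it all of
  \<open>X\<close>.\<close>

lemma pointwise_norm_constant:
  obtains M where "\<And>c x. c \<in> A \<Longrightarrow> x \<in> fst c \<Longrightarrow> pointwise_norm c (snd c x) = M"
proof -
  have chart_cont: "continuous_map (subtopology X (fst c)) (top_of_set (chart_image c)) (snd c)"
    if "c \<in> A" for c
    using chart[OF that] homeomorphic_imp_continuous_map unfolding is_chart_def by blast
  have opn: "openin X (fst c)" if "c \<in> A" for c
    using chart[OF that] by (simp add: is_chart_def)
  have patch: "continuous_on (chart_image c) (pointwise_norm c)" if "c \<in> A" for c
    using tensor_patch.Sup_ratio(3)[OF section_patch[OF that]] .
  have top: "topspace X \<subseteq> (\<Union>c\<in>A. fst c)" using chart_cover by blast
  have cont: "continuous_map (subtopology X (fst c)) euclideanreal (\<lambda>x. pointwise_norm c (snd c x))"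
    if "c \<in> A" for c
    using continuous_map_compose[OF chart_cont[OF that], of euclideanreal "pointwise_norm c"] patch[OF that]
    by (simp add: o_def)
  obtain G where G: "continuous_map X euclideanreal G"
    "\<And>x c. c \<in> A \<Longrightarrow> x \<in> topspace X \<inter> fst c \<Longrightarrow> G x = pointwise_norm c (snd c x)"
    using pasting_lemma_exists[OF top opn cont] pointwise_norm_eq by (metis (no_types, lifting) IntD1 IntD2)
  have G': "G x = pointwise_norm c (snd c x)" if "c \<in> A" "x \<in> fst c" for c x
    using G(2)[of c x] that openin_subset[OF opn[OF that(1)]] by auto
  have ne: "topspace X \<noteq> {}" using manifold by (simp add: complex_manifold_def)
  have "compact (G ` topspace X)"
    using image_compactin[OF _ G(1), of "topspace X"] compact by (simp add: compact_space_def)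
  then obtain M where M: "M \<in> G ` topspace X" "\<And>y. y \<in> G ` topspace X \<Longrightarrow> y \<le> M"
    using compact_attains_sup[of "G ` topspace X"] ne by auto
  define S where "S = {x \<in> topspace X. G x = M}"
  have "closedin X S"
    using closedin_continuous_map_preimage[OF G(1), of "{M}"] by (simp add: S_def)
  moreover have "openin X S"
  proof -
    have "S = (\<Union>c\<in>A. {x \<in> fst c. snd c x \<in> {z \<in> chart_image c. pointwise_norm c z = M}})"
    proof (intro set_eqI iffI)
      fix x assume x: "x \<in> S"
      then obtain c where "c \<in> A" "x \<in> fst c" using chart_cover unfolding S_def by blast
      then show "x \<in> (\<Union>c\<in>A. {x \<in> fst c. snd c x \<in> {z \<in> chart_image c. pointwise_norm c z = M}})"
        using x G' by (auto simp: S_def chart_image_def)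
    next
      fix x assume "x \<in> (\<Union>c\<in>A. {x \<in> fst c. snd c x \<in> {z \<in> chart_image c. pointwise_norm c z = M}})"
      then obtain c where c: "c \<in> A" "x \<in> fst c" "pointwise_norm c (snd c x) = M" by auto
      then show "x \<in> S" using G'[OF c(1,2)] openin_subset[OF opn[OF c(1)]] by (auto simp: S_def)
    qed
    moreover have "openin X {x \<in> fst c. snd c x \<in> {z \<in> chart_image c. pointwise_norm c z = M}}" if c: "c \<in> A" for c
    proof -
      interpret tensor_patch "chart_image c" "h c" p Q \<sigma> "s c" by (rule section_patch[OF c])
      have "viscosity_subharmonic N"
        unfolding viscosity_subharmonic_def
      proof (intro ballI allI impI)
        fix z e v \<mu>
        assume z: "z \<in> chart_image c" and e: "unitary_frame (h c z) e"
          and touch: "\<forall>\<^sub>F w in nhds z. N w + v w \<le> N z + v z"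
          and jv: "\<forall>m. \<exists>\<alpha> \<beta>. wjet (\<lambda>t. of_real (v (z + t *s e m))) \<alpha> \<beta> (\<mu> m)"
        obtain a where a: "(\<Sum>m\<in>UNIV. Re (\<mu> m)) \<le>
            N z / 2 * (\<sigma> * (\<Sum>i<p. herm_form (second_ricci (h c) z) (a i)))"
          using bochner_inequality[OF z e touch jv[rule_format]] by blast
        have "\<sigma> * (\<Sum>i<p. herm_form (second_ricci (h c) z) (a i)) \<le> 0"
          unfolding sum_distrib_left using curvature[OF c z] by (intro sum_nonpos)
        then have "N z / 2 * (\<sigma> * (\<Sum>i<p. herm_form (second_ricci (h c) z) (a i))) \<le> 0"
          by (rule mult_nonneg_nonpos[rotated]) (use N_nonneg[OF z] in simp)
        with a show "(\<Sum>m\<in>UNIV. Re (\<mu> m)) \<le> 0" by linarith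
      qed
      moreover have "N z \<le> M" if z: "z \<in> chart_image c" for z
      proof -
        obtain x where x: "x \<in> fst c" "z = snd c x" using z by (auto simp: chart_image_def)
        then have "x \<in> topspace X" using openin_subset[OF opn[OF c]] by blast
        then show ?thesis using M(2)[OF imageI, of x] G'[OF c x(1)] x(2) by simp
      qed
      ultimately have "open {z \<in> chart_image c. N z = M}"
        by (intro max_set_open patch[OF c])
      then have "openin (top_of_set (chart_image c)) {z \<in> chart_image c. N z = M}"
        by (intro open_subset) auto
      from openin_continuous_map_preimage[OF chart_cont[OF c] this]
      have "openin (subtopology X (fst c))
         {x \<in> topspace X \<inter> fst c. snd c x \<in> {z \<in> chart_image c. N z = M}}" by simp
      moreover have "topspace X \<inter> fst c = fst c" using openin_subset[OF opn[OF c]] by blast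
      ultimately show ?thesis using openin_trans_full[OF _ opn[OF c]] by simp
    qed
    ultimately show ?thesis by auto
  qed
  ultimately have S: "S = topspace X"
    using connected M(1) unfolding connected_space_clopen_in S_def by blast
  have "pointwise_norm c (snd c x) = M" if "c \<in> A" "x \<in> fst c" for c x
  proof -
    have "x \<in> S" using openin_subset[OF opn[OF that(1)]] that(2) S by blast
    then show ?thesis using G'[OF that] by (simp add: S_def)
  qed
  then show thesis by (rule that)
qed

text \<open>Preimages of the standard basis under \<open>Q\<close> turn \<open>tensor_eval\<close>
  into a single component, which the norm bounds by 0.\<close>

lemma section_eq_zero:
  assumes "\<And>c x. c \<in> A \<Longrightarrow> x \<in> fst c \<Longrightarrow> pointwise_norm c (snd c x) \<le> 0"
  shows "s = 0"
proof -
  have "s c z I = 0" if cz: "c \<in> A" "z \<in> chart_image c" and I: "length I = p" for c z I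
  proof -
    interpret tensor_patch "chart_image c" "h c" p Q \<sigma> "s c" by (rule section_patch[OF cz(1)])
    have N: "N z \<le> 0" using assms[OF cz(1)] cz(2) by (auto simp: chart_image_def)
    have "\<forall>i. \<exists>v. Q (h c z) v = axis i 1"
      using Q_surj[OF pos[OF cz(2)]] by (metis axis_eq_0_iff zero_neq_one)
    then obtain v where v: "\<And>i. Q (h c z) (v i) = axis i 1" by metis
    have "cmod (tensor_eval p (s c z) (\<lambda>m. Q (h c z) (v (I ! m)))) \<le>
        N z * (\<Prod>m<p. sqrt (herm_form (h c z) (v (I ! m))))"
      by (rule tensor_eval_le[OF cz(2)])
    also have "\<dots> \<le> 0"
      using N herm_form_nonneg[OF cz(2)] by (intro mult_nonpos_nonneg prod_nonneg) auto
    finally show ?thesis by (simp add: v tensor_eval_axis[OF I])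
  qed
  moreover have "s c z I = 0" if "length I \<noteq> p" for c z I
    using alt that by (simp add: alternating_def)
  ultimately have "s c z I = 0" for c z I
    using junk by (cases "c \<in> A \<and> z \<in> chart_image c"; cases "length I = p") auto
  then show ?thesis by (simp add: fun_eq_iff)
qed

text \<open>Since the norm is constant, the zero test function touches it everywhere; at the point
  of strict sign the Bochner inequality reads 0 \<le> M/2 times a negative number.\<close>

lemma section_vanishes:
  assumes p: "p \<ge> 1" and c: "c \<in> A" "x \<in> fst c"
    and strict: "\<And>a. a \<noteq> 0 \<Longrightarrow> \<sigma> * herm_form (second_ricci (h c) (snd c x)) a < 0"
  shows "s = 0"
proof -
  obtain M where M: "\<And>c x. c \<in> A \<Longrightarrow> x \<in> fst c \<Longrightarrow> pointwise_norm c (snd c x) = M"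
    using pointwise_norm_constant by blast
  interpret tensor_patch "chart_image c" "h c" p Q \<sigma> "s c" by (rule section_patch[OF c(1)])
  define z where "z = snd c x"
  have z: "z \<in> chart_image c" using c by (simp add: z_def chart_image_def)
  have NM: "N w = M" if "w \<in> chart_image c" for w
    using that M[OF c(1)] by (auto simp: chart_image_def)
  obtain e where e: "unitary_frame (h c z) e" using exists_unitary_frame[OF herm[OF z] pos[OF z]] by blast
  have touch: "\<forall>\<^sub>F w in nhds z. N w + 0 \<le> N z + 0"
    using NM z by (intro eventually_mono[OF eventually_nhds_in_open[OF open_U z]]) simp
  have "\<exists>\<alpha> \<beta>. wjet (\<lambda>t. of_real 0) \<alpha> \<beta> 0" using wjet_const[of 0] by auto
  then obtain a where a: "\<And>i. herm_form (h c z) (a i) = 1"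
    "(\<Sum>m\<in>(UNIV :: 'n set). Re 0) \<le> N z / 2 * (\<sigma> * (\<Sum>i<p. herm_form (second_ricci (h c) z) (a i)))"
    using bochner_inequality[OF z e, of "\<lambda>_. 0" "\<lambda>_. 0"] touch by blast
  have "a i \<noteq> 0" for i using a(1)[of i] by (auto simp: herm_form_def)
  \<comment> \<open>The sum is nonempty because \<open>p \<ge> 1\<close>; for \<open>p = 0\<close>
    it would be 0.\<close>
  then have "\<sigma> * (\<Sum>i<p. herm_form (second_ricci (h c) z) (a i)) < 0"
    unfolding sum_distrib_left z_def
    using p strict sum_strict_mono[of "{..<p}" _ "\<lambda>_. 0 :: real"] by (auto simp: lessThan_empty_iff)
  then have "N z \<le> 0" using a(2) mult_pos_neg[of "N z / 2"] by (force simp: not_le[symmetric])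
  then have "M \<le> 0" using NM[OF z] by simp
  then show ?thesis using M by (intro section_eq_zero) simp
qed

end

section \<open>Holomorphic forms and polyvector fields\<close>

lemma hol_componentsD:
  assumes "hol_components A p s"
  shows "c \<in> A \<Longrightarrow> hol_on (chart_image c) (\<lambda>z. s c z I)"
    and "alternating p (s c z)"
    and "\<not> (c \<in> A \<and> z \<in> chart_image c) \<Longrightarrow> s c z = 0"
proof -
  note d = assms[unfolded hol_components_def]
  have 1: "\<forall>c z. \<not> (c \<in> A \<and> z \<in> chart_image c) \<longrightarrow> s c z = 0"
    and 2: "\<forall>c z. alternating p (s c z)"
    and 3: "\<forall>c\<in>A. \<forall>I. hol_on (chart_image c) (\<lambda>z. s c z I)"
    using conjunct1[OF d] conjunct1[OF conjunct2[OF d]] conjunct2[OF conjunct2[OF d]] .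
  show "hol_on (chart_image c) (\<lambda>z. s c z I)" if "c \<in> A" using 3 that by blast
  show "alternating p (s c z)" by (rule 2[rule_format])
  show "s c z = 0" if "\<not> (c \<in> A \<and> z \<in> chart_image c)" using 1[rule_format, OF that] .
qed

context hermitian_manifold
begin

lemma chart_image_point:
  assumes "c \<in> A" "z \<in> chart_image c"
  obtains x where "x \<in> topspace X" "x \<in> fst c" "z = snd c x"
proof -
  obtain x where "x \<in> fst c" "z = snd c x" using assms(2) by (auto simp: chart_image_def)
  moreover have "fst c \<subseteq> topspace X" using chart[OF assms(1)] openin_subset by (auto simp: is_chart_def)
  ultimately show thesis using that by blast
qed

text \<open>Forms are evaluated on vectors, whose adapted curves carry minus the curvature; hence
  \<sigma> = -1, matched by nonnegativity.\<close>

lemma form_tensor_section: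
  assumes s: "s \<in> holomorphic_forms A p"
    and curv: "\<forall>x\<in>topspace X. second_ricci_at nonneg_mat A h x"
  shows "tensor_section X A h p (\<lambda>H v. v) (- 1) s"
proof
  have comp: "hol_components A p s" using s by (simp add: holomorphic_forms_def)
  show "hol_on (chart_image c) (\<lambda>z. s c z I)" if "c \<in> A" for c I
    using comp that by (rule hol_componentsD)
  show "alternating p (s c z)" for c z
    using comp by (rule hol_componentsD)
  show "s c z = 0" if "\<not> (c \<in> A \<and> z \<in> chart_image c)" for c z
    using comp that by (rule hol_componentsD)
  show "continuous_on UNIV (\<lambda>x :: (complex ^ 'n ^ 'n) \<times> (complex ^ 'n). snd x)" by (intro continuous_intros)
  show "\<exists>w. adapted_curve (\<lambda>H v. v) g z u a (- 1 * chern_form g z u a) w"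
    if "hermitian_patch U g" "z \<in> U" for U g z u and a :: "complex ^ 'n"
    using hermitian_patch.adapted_curve_vector[OF that] by simp
  show "tensor_eval p (s c z) (\<lambda>m. vs m) = tensor_eval p (s d (transition c d z)) (\<lambda>m. jacobian c d z *v vs m)"
    if "c \<in> A" "d \<in> A" "z \<in> overlap c d" for c d z vs
  proof (rule tensor_eval_transform)
    fix I :: "'n list" assume "length I = p"
    then show "s c z I = (\<Sum>J | length J = p. (\<Prod>m<p. jacobian c d z $ (J ! m) $ (I ! m)) * s d (transition c d z) J)"
      using s that by (simp add: holomorphic_forms_def jacobian_def)
  qed
  show "- 1 * herm_form (second_ricci (h c) z) a \<le> 0" if cz: "c \<in> A" "z \<in> chart_image c" for c z a
  proof -
    obtain x where "x \<in> topspace X" "x \<in> fst c" "z = snd c x" using cz by (rule chart_image_point)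
    then have "nonneg_mat (second_ricci (h c) z)" using curv cz(1) by (simp add: second_ricci_at_def)
    then show ?thesis by (simp add: nonneg_mat_def)
  qed
qed auto

lemma polyvector_tensor_section:
  assumes s: "s \<in> holomorphic_polyvectors A p"
    and curv: "\<forall>x\<in>topspace X. second_ricci_at nonpos_mat A h x"
  shows "tensor_section X A h p (\<lambda>H v. H *v cvec v) 1 s"
proof
  have comp: "hol_components A p s" using s by (simp add: holomorphic_polyvectors_def)
  show "hol_on (chart_image c) (\<lambda>z. s c z I)" if "c \<in> A" for c I
    using comp that by (rule hol_componentsD)
  show "alternating p (s c z)" for c z
    using comp by (rule hol_componentsD)
  show "s c z = 0" if "\<not> (c \<in> A \<and> z \<in> chart_image c)" for c z
    using comp that by (rule hol_componentsD)
  show "H *v cvec (of_real r *s v) = of_real r *s (H *v cvec v)" for H :: "complex ^ 'n ^ 'n" and r v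
    by (simp add: vec_eq_iff matrix_vector_mult_def sum_distrib_left mult_ac)
  show "continuous_on UNIV (\<lambda>x :: (complex ^ 'n ^ 'n) \<times> (complex ^ 'n). fst x *v cvec (snd x))"
  proof -
    have "continuous_on UNIV (\<lambda>x :: (complex ^ 'n ^ 'n) \<times> (complex ^ 'n).
        (\<chi> i. \<Sum>j\<in>UNIV. fst x $ i $ j * cnj (snd x $ j)) :: complex ^ 'n)"
      by (intro continuous_on_vec_lambda continuous_intros)
    then show ?thesis by (simp add: matrix_vector_mult_def)
  qed
  show "\<exists>w. adapted_curve (\<lambda>H v. H *v cvec v) g z u a (1 * chern_form g z u a) w"
    if "hermitian_patch U g" "z \<in> U" for U g z u and a :: "complex ^ 'n"
    using hermitian_patch.adapted_curve_covector[OF that] by simp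
  show "\<exists>v. v \<noteq> 0 \<and> H *v cvec v = y" if H: "pos_mat H" "y \<noteq> 0" for H :: "complex ^ 'n ^ 'n" and y
  proof -
    obtain K where K: "H ** K = mat 1" using pos_mat_invertible[OF H(1)] by (auto simp: invertible_def)
    then have eq: "H *v cvec (cvec (K *v y)) = y" by (simp add: matrix_vector_mul_assoc)
    have "cvec (K *v y) \<noteq> 0"
    proof
      assume "cvec (K *v y) = 0"
      then have "K *v y = 0" by (metis cvec_cvec cvec_nth complex_cnj_zero vec_eq_iff zero_index)
      then show False using eq H(2) by simp
    qed
    with eq show ?thesis by blast
  qed
  show "tensor_eval p (s c z) (\<lambda>m. h c z *v cvec (vs m)) =
      tensor_eval p (s d (transition c d z)) (\<lambda>m. h d (transition c d z) *v cvec (jacobian c d z *v vs m))"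
    if "c \<in> A" "d \<in> A" "z \<in> overlap c d" for c d z vs
    unfolding covector_transform[OF that]
  \<comment> \<open>Contravariant components in \<open>d\<close> are expressed through those in
    \<open>c\<close>, so naturality is read backwards, the transposed Jacobian pulling covectors
    back to \<open>c\<close>.\<close>
  proof (rule tensor_eval_transform[symmetric])
    fix I :: "'n list" assume "length I = p"
    then show "s d (transition c d z) I =
        (\<Sum>J | length J = p. (\<Prod>m<p. transpose (jacobian c d z) $ (J ! m) $ (I ! m)) * s c z J)"
      using s that by (simp add: holomorphic_polyvectors_def jacobian_def transpose_def)
  qed
  show "1 * herm_form (second_ricci (h c) z) a \<le> 0" if cz: "c \<in> A" "z \<in> chart_image c" for c z a
  proof -
    obtain x where "x \<in> topspace X" "x \<in> fst c" "z = snd c x" using cz by (rule chart_image_point)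
    then have "nonpos_mat (second_ricci (h c) z)" using curv cz(1) by (simp add: second_ricci_at_def)
    then show ?thesis by (simp add: nonpos_mat_def)
  qed
qed

lemma holomorphic_forms_zero:
  assumes curv: "\<forall>x\<in>topspace X. second_ricci_at nonneg_mat A h x"
    and "x \<in> topspace X" "second_ricci_at pos_mat A h x" and "p \<ge> 1"
  shows "holomorphic_forms A p = {0}"
proof -
  obtain c where c: "c \<in> A" "x \<in> fst c" using chart_cover assms(2) by blast
  have "s = 0" if "s \<in> holomorphic_forms A p" for s
    using tensor_section.section_vanishes[OF form_tensor_section[OF that curv] \<open>p \<ge> 1\<close> c] assms(3) c
    by (simp add: second_ricci_at_def pos_mat_def)
  moreover have "0 \<in> holomorphic_forms A p"
    using module.subspace_0[OF _ subspace_holomorphic_forms] vector_space_section_scale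
    by (simp add: vector_space_def module_def)
  ultimately show ?thesis by blast
qed

lemma holomorphic_polyvectors_zero:
  assumes curv: "\<forall>x\<in>topspace X. second_ricci_at nonpos_mat A h x"
    and "x \<in> topspace X" "second_ricci_at neg_mat A h x" and "p \<ge> 1"
  shows "holomorphic_polyvectors A p = {0}"
proof -
  obtain c where c: "c \<in> A" "x \<in> fst c" using chart_cover assms(2) by blast
  have "s = 0" if "s \<in> holomorphic_polyvectors A p" for s
    using tensor_section.section_vanishes[OF polyvector_tensor_section[OF that curv] \<open>p \<ge> 1\<close> c] assms(3) c
    by (simp add: second_ricci_at_def neg_mat_def)
  moreover have "0 \<in> holomorphic_polyvectors A p"
    by (simp add: holomorphic_polyvectors_def hol_components_def alternating_def hol_on_zero)
  ultimately show ?thesis by blast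
qed

section \<open>Holomorphic functions and the arithmetic genus\<close>

definition unit_function :: "('a, 'n) local_section" where
  "unit_function c z I = (if c \<in> A \<and> z \<in> chart_image c \<and> I = [] then 1 else 0)"

lemma unit_function_form: "unit_function \<in> holomorphic_forms A 0"
proof -
  have "hol_on (chart_image c) (\<lambda>z. unit_function c z I)" if c: "c \<in> A" for c I
    unfolding hol_on_def
  proof
    fix z assume z: "z \<in> chart_image c"
    have opn: "open (chart_image c)" using chart[OF c] by (simp add: is_chart_def)
    have "((\<lambda>z. if I = [] then 1 else 0 :: complex) has_derivative (\<lambda>v. 0)) (at z)"
      by (rule has_derivative_const)
    then have "((\<lambda>z. unit_function c z I) has_derivative (\<lambda>v. 0)) (at z)"
      by (rule has_derivative_transform_within_open[OF _ opn z]) (use c in \<open>simp add: unit_function_def\<close>)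
    then show "\<exists>f'. ((\<lambda>z. unit_function c z I) has_derivative f') (at z) \<and> (\<forall>a v. f' (a *s v) = a * f' v)"
      by (intro exI[of _ "\<lambda>v. 0"]) simp
  qed
  moreover have "alternating 0 (unit_function c z)" for c z
    by (simp add: alternating_def unit_function_def)
  moreover have "unit_function c z = 0" if "\<not> (c \<in> A \<and> z \<in> chart_image c)" for c z
    using that by (auto simp: unit_function_def)
  ultimately have "hol_components A 0 unit_function"
    unfolding hol_components_def by (intro conjI allI impI ballI)
  moreover have "unit_function c z I =
      (\<Sum>J | length J = 0. (\<Prod>m<0. transition_deriv c d z (J ! m) (I ! m)) * unit_function d (transition c d z) J)"
    if "c \<in> A" "d \<in> A" "z \<in> overlap c d" "length I = 0" for c d z I
  proof -
    obtain x where "x \<in> fst c" "x \<in> fst d" "z = snd c x"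
      using \<open>z \<in> overlap c d\<close> unfolding overlap_def by blast
    then have "z \<in> chart_image c" "transition c d z \<in> chart_image d"
      using \<open>c \<in> A\<close> by (simp_all add: chart_image_def transition_coordinates)
    then show ?thesis using that by (simp add: unit_function_def)
  qed
  ultimately show ?thesis
    unfolding holomorphic_forms_def by (intro CollectI conjI ballI allI impI)
qed

lemma hodge_00:
  assumes curv: "\<forall>x\<in>topspace X. second_ricci_at nonneg_mat A h x"
  shows "hodge_p0 A 0 = 1"
proof -
  interpret vs: vector_space "section_scale :: complex \<Rightarrow> ('a, 'n) local_section \<Rightarrow> _"
    by (rule vector_space_section_scale)
  obtain x0 where "x0 \<in> topspace X" using manifold unfolding complex_manifold_def by blast
  then obtain c0 where x0: "c0 \<in> A" "x0 \<in> fst c0" using chart_cover by blast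
  then have z0: "snd c0 x0 \<in> chart_image c0" by (simp add: chart_image_def)
  have one: "unit_function c0 (snd c0 x0) [] = 1" using x0 z0 by (simp add: unit_function_def)
  have "s \<in> vs.span {unit_function}" if s: "s \<in> holomorphic_forms A 0" for s
  proof -
    define a where "a = s c0 (snd c0 x0) []"
    define t where "t = s - section_scale a unit_function"
    have t: "t \<in> holomorphic_forms A 0"
      unfolding t_def
      by (intro vs.subspace_diff vs.subspace_scale subspace_holomorphic_forms s unit_function_form)
    interpret tensor_section X A h 0 "\<lambda>H v. v" "- 1" t by (rule form_tensor_section[OF t curv])
    obtain M where M: "\<And>c x. c \<in> A \<Longrightarrow> x \<in> fst c \<Longrightarrow> pointwise_norm c (snd c x) = M"
      using pointwise_norm_constant by blast
    have "t c0 (snd c0 x0) [] = 0" by (simp add: t_def section_scale_def one a_def)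
    \<comment> \<open>For \<open>p = 0\<close> there are no arguments and the ratio is the modulus
      of the component at \<open>[]\<close>, here 0.\<close>
    then have "tensor_ratio 0 (\<lambda>H v. v) (h c0 (snd c0 x0)) (t c0 (snd c0 x0)) v = 0" for v
      by (simp add: tensor_ratio_def tensor_eval_def)
    then have "pointwise_norm c0 (snd c0 x0) = 0"
      using unit_tuples_nonempty[where 'n = 'n] by (simp add: tensor_norm_def image_constant_conv)
    then have "t = 0" using M x0 by (intro section_eq_zero) auto
    then have "s = section_scale a unit_function" by (simp add: t_def)
    then show ?thesis by (simp add: vs.span_base vs.span_scale)
  qed
  moreover have "unit_function \<noteq> 0"
  proof
    assume "unit_function = 0"
    then have "unit_function c0 (snd c0 x0) [] = 0" by simp
    with one show False by simp
  qed
  ultimately show ?thesis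
    unfolding hodge_p0_def
    using unit_function_form by (intro vs.dim_unique[of "{unit_function}"]) auto
qed

lemma arithmetic_genus_one:
  assumes curv: "\<forall>x\<in>topspace X. second_ricci_at nonneg_mat A h x"
    and "x \<in> topspace X" "second_ricci_at pos_mat A h x"
  shows "arithmetic_genus A = 1"
proof -
  interpret vs: vector_space "section_scale :: complex \<Rightarrow> ('a, 'n) local_section \<Rightarrow> _"
    by (rule vector_space_section_scale)
  \<comment> \<open>The empty set is a basis of \<open>{0}\<close>, so only the summand with
    \<open>p = 0\<close> survives.\<close>
  have "hodge_p0 A p = 0" if "p \<ge> 1" for p
    unfolding hodge_p0_def holomorphic_forms_zero[OF assms that]
    by (rule vs.dim_unique[of "{}"]) (simp_all add: vs.independent_empty)
  then have "arithmetic_genus A = (\<Sum>p=0..CARD('n). if p = 0 then 1 else 0)"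
    unfolding arithmetic_genus_def by (intro sum.cong refl) (auto simp: hodge_00[OF curv])
  then show ?thesis by simp
qed

end

theorem corollary1p2:
  fixes X :: "'a topology"
    and A :: "('a, 'n::finite) chart set"
    and h :: "('a, 'n) local_metric"
  assumes manifold: "complex_manifold X A"
    and compact: "compact_space X"
    and connected: "connected_space X"
    and metric: "hermitian_metric A h"
  shows "((\<forall>x\<in>topspace X. second_ricci_at nonneg_mat A h x) \<and>
          (\<exists>x\<in>topspace X. second_ricci_at pos_mat A h x) \<longrightarrow>
            (\<forall>p. 1 \<le> p \<and> p \<le> CARD('n) \<longrightarrow> holomorphic_forms A p = {0}) \<and>
            arithmetic_genus A = 1) \<and>
         ((\<forall>x\<in>topspace X. second_ricci_at nonpos_mat A h x) \<and>
          (\<exists>x\<in>topspace X. second_ricci_at neg_mat A h x) \<longrightarrow>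
            (\<forall>p. 1 \<le> p \<and> p \<le> CARD('n) \<longrightarrow> holomorphic_polyvectors A p = {0}))"
proof -
  interpret hermitian_manifold X A h
    using assms by (rule hermitian_manifold.intro)
  show ?thesis
  proof (rule conjI; rule impI)
    assume "(\<forall>x\<in>topspace X. second_ricci_at nonneg_mat A h x) \<and>
        (\<exists>x\<in>topspace X. second_ricci_at pos_mat A h x)"
    then obtain x where "\<forall>x\<in>topspace X. second_ricci_at nonneg_mat A h x"
      "x \<in> topspace X" "second_ricci_at pos_mat A h x" by blast
    from holomorphic_forms_zero[OF this] arithmetic_genus_one[OF this]
    show "(\<forall>p. 1 \<le> p \<and> p \<le> CARD('n) \<longrightarrow> holomorphic_forms A p = {0}) \<and> arithmetic_genus A = 1"
      by simp
  next
    assume "(\<forall>x\<in>topspace X. second_ricci_at nonpos_mat A h x) \<and>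
        (\<exists>x\<in>topspace X. second_ricci_at neg_mat A h x)"
    then obtain x where "\<forall>x\<in>topspace X. second_ricci_at nonpos_mat A h x"
      "x \<in> topspace X" "second_ricci_at neg_mat A h x" by blast
    from holomorphic_polyvectors_zero[OF this]
    show "\<forall>p. 1 \<le> p \<and> p \<le> CARD('n) \<longrightarrow> holomorphic_polyvectors A p = {0}" by simp
  qed
qed

end
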